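(* For all $n>0$, $T_{\tilde S_n}(s,q)=T_n(1,s,q)$.
   Context: $T_n(x,s,q)\in\mathbb Z[x,s,q]$ (Cigler's $q$-Chebyshev polynomials of the first kind) are defined by $T_0=1$, $T_1=x$, and $T_n(x,s,q)=(1+q^{n-1})\,x\,T_{n-1}(x,s,q)+q^{n-1}s\,T_{n-2}(x,s,q)$ for $n\ge2$. Coxeter notions. For a Coxeter system $(W,S)$ with $S$ finite and length $\ell$, $P_W(q)=\sum_{w\in W}q^{\ell(w)}$; for $J\subset S$, $W_J=\langle J\rangle$, $W^J=\{w:\ell(ws)>\ell(w)\ \forall s\in J\}$. For an involutive automorphism $\diamond$ of $W$ with $S^\diamond=S$: $\mathbf I_\diamond(W)=\{w:w^{-1}=w^\diamond\}$, and $\ell'_\diamond:\mathbf I_\diamond(W)\to\mathbb N$ is the unique function with $\ell'_\diamond(1)=0$, $\ell'_\diamond(sws^\diamond)=\ell'_\diamond(w)$ ($s\in S$), and $\ell'_\diamond(ws)-\ell'_\diamond(w)=\ell(ws)-\ell(w)$ whenever $s\in S$ and $w,ws\in\mathbf I_\diamond(W)$; $L_{W,\diamond}(q)=\sum_{w\in\mathbf I_\diamond(W)}q^{\ell(w)}\left(\frac{q-1}{q+1}\right)^{\ell'_\diamond(w)}$; for $\diamond=\mathrm{id}$ write $\mathbf I(W),\ell',L_W$. For $J\subset S$, $L^J_W(s,q)=\sum_{w\in\mathbf I(W)\cap W^J}q^{\ell(w)}\left(s\frac{1-q}{1+q}\right)^{\ell'(w)}\frac{P_{W_J}(q^2)}{P_{W_K}(q^2)}L_{W_K,\diamond}(q)$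 with $\diamond:x\mapsto wxw$, $K=J\cap wJw$, and $L_{W_K,\diamond}$ computed in $(W_K,K)$. For $n\ge2$, $\tilde S_n$ is the group of bijections $w$ of $\mathbb Z$ with $w(i+n)=w(i)+n$ and $\sum_{i=1}^nw(i)=\sum_{i=1}^n i$, with Coxeter generators $s_0,\dots,s_{n-1}$, $s_i$ mapping $j\mapsto j+1$ if $j\equiv i$, $j\mapsto j-1$ if $j\equiv i+1\pmod n$, fixing $j$ otherwise; $\tilde S_1$ is trivial. With $J=\{s_1,\dots,s_{n-1}\}$, $T_{\tilde S_n}(s,q)=L^J_{\tilde S_n}(s,q)/L_{\tilde S_n}(q)$. *)

theory Defs
  imports
    "HOL-Algebra.Generated_Groups"
    "HOL-Analysis.Infinite_Sum"
    "HOL-Computational_Algebra.Computational_Algebra"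
    "HOL-Number_Theory.Cong"
begin

text \<open>
  Generating functions live in the ring of formal power series in \<open>q\<close> over a field. A group that
  may be infinite is summed over with \<open>infsum\<close>, taken in the standard (\<open>q\<close>-adic) topology of
  \<^typ>\<open>'a fps\<close>; the sums converge because only finitely many elements have a given length.

  A Coxeter system \<open>(W, S)\<close> is represented by a group \<open>W\<close> together with the set \<open>S\<close> of its
  Coxeter generators; the definitions below are meaningful for Coxeter systems with \<open>S\<close> finite.
\<close>

subsection \<open>Cigler's q-Chebyshev polynomials of the first kind\<close>

text \<open>The polynomial with integer coefficients, evaluated in an arbitrary commutative ring.\<close>

fun qcheb_T :: "nat \<Rightarrow> 'a::comm_ring_1 \<Rightarrow> 'a \<Rightarrow> 'a \<Rightarrow> 'a" where
  "qcheb_T 0 x s q = 1"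
| "qcheb_T (Suc 0) x s q = x"
| "qcheb_T (Suc (Suc n)) x s q =
     (1 + q ^ Suc n) * x * qcheb_T (Suc n) x s q + q ^ Suc n * s * qcheb_T n x s q"

subsection \<open>Coxeter groups\<close>

definition cox_length :: "('w, 'm) monoid_scheme \<Rightarrow> 'w set \<Rightarrow> 'w \<Rightarrow> nat" where
  "cox_length W S w =
     (LEAST k. \<exists>xs. length xs = k \<and> set xs \<subseteq> S \<and> w = foldr (\<otimes>\<^bsub>W\<^esub>) xs \<one>\<^bsub>W\<^esub>)"

definition parabolic :: "('w, 'm) monoid_scheme \<Rightarrow> 'w set \<Rightarrow> ('w, 'm) monoid_scheme" where
  "parabolic W J = W\<lparr>carrier := generate W J\<rparr>"

definition poincare_series ::
    "('w, 'm) monoid_scheme \<Rightarrow> 'w set \<Rightarrow> 'a::field fps \<Rightarrow> 'a fps" where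
  "poincare_series W S q = (\<Sum>\<^sub>\<infinity>w\<in>carrier W. q ^ cox_length W S w)"

definition min_coset_reps :: "('w, 'm) monoid_scheme \<Rightarrow> 'w set \<Rightarrow> 'w set \<Rightarrow> 'w set" where
  "min_coset_reps W S J =
     {w \<in> carrier W. \<forall>s\<in>J. cox_length W S (w \<otimes>\<^bsub>W\<^esub> s) > cox_length W S w}"

definition twisted_invols :: "('w, 'm) monoid_scheme \<Rightarrow> ('w \<Rightarrow> 'w) \<Rightarrow> 'w set" where
  "twisted_invols W dia = {w \<in> carrier W. inv\<^bsub>W\<^esub> w = dia w}"

text \<open>
  The function written \<open>\<ell>'\<close>. It is characterized by its values on the twisted involutions only, so
  \<open>extensional\<close> is needed to make it unique as a total function.
\<close>

definition abs_length ::
    "('w, 'm) monoid_scheme \<Rightarrow> 'w set \<Rightarrow> ('w \<Rightarrow> 'w) \<Rightarrow> 'w \<Rightarrow> nat" where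
  "abs_length W S dia = (THE f.
     f \<in> extensional (twisted_invols W dia) \<and>
     f \<one>\<^bsub>W\<^esub> = 0 \<and>
     (\<forall>w \<in> twisted_invols W dia. \<forall>s\<in>S. f (s \<otimes>\<^bsub>W\<^esub> w \<otimes>\<^bsub>W\<^esub> dia s) = f w) \<and>
     (\<forall>w \<in> twisted_invols W dia. \<forall>s\<in>S. w \<otimes>\<^bsub>W\<^esub> s \<in> twisted_invols W dia \<longrightarrow>
        int (f (w \<otimes>\<^bsub>W\<^esub> s)) - int (f w) =
        int (cox_length W S (w \<otimes>\<^bsub>W\<^esub> s)) - int (cox_length W S w)))"

definition L_series ::
    "('w, 'm) monoid_scheme \<Rightarrow> 'w set \<Rightarrow> ('w \<Rightarrow> 'w) \<Rightarrow> 'a::field fps \<Rightarrow> 'a fps" where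
  "L_series W S dia q =
     (\<Sum>\<^sub>\<infinity>w\<in>twisted_invols W dia.
        q ^ cox_length W S w * ((q - 1) / (q + 1)) ^ abs_length W S dia w)"

definition LJ_series ::
    "('w, 'm) monoid_scheme \<Rightarrow> 'w set \<Rightarrow> 'w set \<Rightarrow> 'a::field fps \<Rightarrow> 'a fps \<Rightarrow> 'a fps" where
  "LJ_series W S J s q =
     (\<Sum>\<^sub>\<infinity>w\<in>twisted_invols W (\<lambda>x. x) \<inter> min_coset_reps W S J.
        let dia = (\<lambda>x. w \<otimes>\<^bsub>W\<^esub> x \<otimes>\<^bsub>W\<^esub> w); K = J \<inter> dia ` J
        in q ^ cox_length W S w
           * (s * ((1 - q) / (1 + q))) ^ abs_length W S (\<lambda>x. x) w
           * (poincare_series (parabolic W J) J (q ^ 2) / poincare_series (parabolic W K) K (q ^ 2))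
           * L_series (parabolic W K) K dia q)"

subsection \<open>The affine symmetric group\<close>

definition affine_sym :: "nat \<Rightarrow> (int \<Rightarrow> int) monoid" where
  "affine_sym n =
     \<lparr>carrier = {w. bij w \<and> (\<forall>i. w (i + int n) = w i + int n) \<and>
                    (\<Sum>i=1..int n. w i) = (\<Sum>i=1..int n. i)},
      monoid.mult = (\<lambda>v w. v \<circ> w), one = id\<rparr>"

definition affine_gen :: "nat \<Rightarrow> nat \<Rightarrow> int \<Rightarrow> int" where
  "affine_gen n i j =
     (if [j = int i] (mod int n) then j + 1
      else if [j = int i + 1] (mod int n) then j - 1
      else j)"

text \<open>For \<open>n = 1\<close> the group is trivial and has no Coxeter generators.\<close>

definition affine_gens :: "nat \<Rightarrow> (int \<Rightarrow> int) set" where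
  "affine_gens n = (if n \<ge> 2 then affine_gen n ` {0..<n} else {})"

definition finite_gens :: "nat \<Rightarrow> (int \<Rightarrow> int) set" where
  "finite_gens n = affine_gen n ` {1..<n}"

lemma carrier_affine_sym_1: "carrier (affine_sym 1) = {id}"
proof -
  have "w = id" if w: "w \<in> carrier (affine_sym 1)" for w
  proof
    fix i :: int
    have step: "w (j + 1) = w j + 1" for j
      using w by (simp add: affine_sym_def)
    have base: "w 1 = 1"
      using w by (simp add: affine_sym_def)
    show "w i = id i"
    proof (induction i rule: int_induct[where k = 1])
      case (step2 j)
      then show ?case using step[of "j - 1"] by simp
    qed (simp_all add: step base)
  qed
  moreover have "id \<in> carrier (affine_sym 1)"
    by (simp add: affine_sym_def)
  ultimately show ?thesis by blast
qed

definition T_affine :: "nat \<Rightarrow> 'a::field fps \<Rightarrow> 'a fps \<Rightarrow> 'a fps" where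
  "T_affine n s q =
     LJ_series (affine_sym n) (affine_gens n) (finite_gens n) s q
     / L_series (affine_sym n) (affine_gens n) (\<lambda>x. x) q"

subsection \<open>The two indeterminates\<close>

text \<open>
  The coefficient field is the field of rational functions in the indeterminate \<open>s\<close>. It contains
  the polynomials in \<open>s\<close> with integer coefficients, so two polynomials in \<open>s\<close> and \<open>q\<close> with
  integer coefficients are equal if and only if their images in \<^typ>\<open>int poly fract fps\<close> are.
\<close>

definition s_var :: "int poly fract fps" where
  "s_var = fps_const (to_fract [:0, 1:])"

definition q_var :: "int poly fract fps" where
  "q_var = fps_X"

end

theory Submission
  imports Defs
begin

text \<open>
  Write \<open>J\<close> for the finite generators. Involutions of the affine symmetric group are sorted along
  the \<open>J\<close>-double cosets: each one is uniquely \<open>x (y d) x\<^sup>-\<^sup>1\<close>, where \<open>d\<close> is the minimal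
  representative of its double coset (again an involution), \<open>y\<close> is a twisted involution of the
  stabilizer and \<open>x\<close> is a minimal coset representative; lengths and absolute lengths add up. Hence
  \<open>L\<close> is the specialization \<open>s = -1\<close> of \<open>L\<^sup>J\<close>, and no formula for the Poincare series of the affine
  group is needed. In type A the weighted sum over twisted involutions is a quotient of
  products of \<open>q\<close>-integers (Lusztig), and the representatives \<open>d\<close> correspond to the multiplicities
  \<open>b\<^sub>1, b\<^sub>2, \<dots>\<close> with which \<open>d\<close> shifts elements of the window \<open>1, \<dots>, n\<close> up by \<open>1, 2, \<dots>\<close> periods.
  Summing over all \<open>b\<close> with the \<open>q\<close>-binomial theorem leaves a finite sum over
  \<open>k = b\<^sub>1 + b\<^sub>2 + \<dots>\<close>, whose terms satisfy the recurrence of the \<open>q\<close>-Chebyshev polynomials up to a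
  factor that is independent of \<open>s\<close> and cancels because those polynomials are \<open>1\<close> at \<open>s = -1\<close>.
\<close>

subsection \<open>q-integers\<close>

text \<open>The series run over an infinite group, but every identity is proved for finite
  truncations and then read off coefficientwise. The truncation \<open>bounded_shift h\<close>
  bounds the number of periods by which points move. In the decomposition the factors x and y
  permute points within periods, so it constrains d alone; and by \<open>alen_unbounded\<close> an
  element outside it has length at least h. A twisted involution y for x \<mapsto> d x d is studied
  through y d, an ordinary involution of the affine group. Length and absolute length thus become
  two statistics of affine permutations: inversions (\<open>alen\<close>) and 2-cycles modulo n
  (\<open>cyc\<close>). The variable s enters only through the power with exponent
  \<open>cyc d\<close>: the remaining factor P_J(q^2) / P_K(q^2) L_K equals P_J(q^2) divided by
  \<open>Cprod\<close>. Since (q - 1) / (q + 1) is the negative of (1 - q) / (1 + q), the weight of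
  the double coset of d in L is its weight in the other series at s = -1.\<close>

definition qn :: "'a::comm_ring_1 \<Rightarrow> nat \<Rightarrow> 'a" where
  "qn q m = (\<Sum>p<m. q ^ p)"

lemma qn_Suc: "qn q (Suc m) = qn q m + (q ^ m :: 'a::comm_ring_1)"
  by (simp add: qn_def)

lemma qn_0 [simp]: "qn q 0 = 0" and qn_1 [simp]: "qn q (Suc 0) = 1"
  by (simp_all add: qn_def)

lemma qn_geometric: "qn q m * (q - 1) = (q ^ m - 1 :: 'a::comm_ring_1)"
  by (induction m) (simp_all add: qn_Suc algebra_simps)

text \<open>Multiplied by q - 1, both sides become q^(2m) - 1. In a general commutative ring this
  factor cannot be cancelled, hence the induction.\<close>

lemma qn_square: "qn q m * (1 + q ^ m) = (1 + q) * qn (q\<^sup>2) m" for q :: "'a::comm_ring_1"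
proof (induction m)
  case (Suc m)
  have p: "(q\<^sup>2) ^ m = q ^ m * q ^ m" by (simp add: power_mult_distrib power2_eq_square)
  have g: "qn q m * q = qn q m + q ^ m - 1" using qn_geometric[of q m] by (simp add: algebra_simps)
  have "qn q (Suc m) * (1 + q ^ Suc m) = qn q m + q ^ m * (qn q m * q) + q ^ m + q ^ m * q ^ m * q"
    by (simp add: qn_Suc algebra_simps)
  also have "\<dots> = qn q m * (1 + q ^ m) + q ^ m * q ^ m + q ^ m * q ^ m * q"
    unfolding g by (simp add: algebra_simps)
  also have "\<dots> = (1 + q) * qn (q\<^sup>2) (Suc m)"
    unfolding Suc qn_Suc p by (simp add: algebra_simps)
  finally show ?case .
qed simp

text \<open>For z = (q - 1) / (q + 1) the bracket is (1 + q^(r+1)) / (1 + q), so this is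
  \<open>qn_square\<close> again. It merges the two terms of \<open>twisted_gf_run_fixed\<close>
  into one q-integer in q^2.\<close>

lemma qn_absorb:
  fixes q z :: "'a::idom"
  assumes z: "z * (1 + q) = q - 1" "1 + q \<noteq> 0"
  shows "qn q (Suc r) * (1 + q * z * qn q r) = qn (q\<^sup>2) (Suc r)"
proof -
  have "(1 + q) * (qn q (Suc r) * (1 + q * z * qn q r)) =
      qn q (Suc r) * (1 + q + q * (z * (1 + q)) * qn q r)" by (simp add: algebra_simps)
  also have "\<dots> = qn q (Suc r) * (1 + q + q * (qn q r * (q - 1)))" unfolding z(1) by (simp add: algebra_simps)
  also have "\<dots> = qn q (Suc r) * (1 + q ^ Suc r)" unfolding qn_geometric by (simp add: algebra_simps)
  also have "\<dots> = (1 + q) * qn (q\<^sup>2) (Suc r)" by (rule qn_square)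
  finally show ?thesis using z(2) by simp
qed

subsection \<open>Affine permutations\<close>

locale affine =
  fixes n :: nat
  assumes n_ge_2: "2 \<le> n"
begin

lemma n_simps [simp]: "n \<noteq> 0" "0 < n" "n \<noteq> Suc 0" "n \<noteq> 1"
  using n_ge_2 by auto

abbreviation N :: int where "N \<equiv> int n"

abbreviation finv :: "(int \<Rightarrow> int) \<Rightarrow> int \<Rightarrow> int" where "finv w \<equiv> inv_into UNIV w"

text \<open>Subtracting i inside the sum makes the summand periodic, so that windows may be shifted
  and reindexed (\<open>sum_window\<close>, \<open>sum_window_aperm\<close>).\<close>

definition aperm :: "(int \<Rightarrow> int) set" where
  "aperm = {w. bij w \<and> (\<forall>i. w (i + N) = w i + N) \<and> (\<Sum>i=1..N. w i - i) = 0}"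

lemma carrier_affine_sym: "carrier (affine_sym n) = aperm"
  by (auto simp: affine_sym_def aperm_def sum_subtractf)

lemma aperm_bij: "w \<in> aperm \<Longrightarrow> bij w"
  and aperm_shift: "w \<in> aperm \<Longrightarrow> w (i + N) = w i + N"
  by (simp_all add: aperm_def)

lemma aperm_inj: "w \<in> aperm \<Longrightarrow> w x = w y \<longleftrightarrow> x = y"
  using aperm_bij bij_is_inj inj_eq by metis

lemma periodic_int_mult:
  fixes h :: "int \<Rightarrow> 'b"
  assumes "\<And>i. h (i + N) = h i"
  shows "h (i + N * k) = h i"
proof (induction k rule: int_induct[where k = 0])
  case (step1 k)
  have "h (i + N * (k + 1)) = h (i + N * k + N)" by (simp add: algebra_simps)
  with step1 show ?case using assms by simp
next
  case (step2 k)
  have "h (i + N * (k - 1)) = h (i + N * (k - 1) + N)" using assms by simp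
  also have "\<dots> = h (i + N * k)" by (simp add: algebra_simps)
  finally show ?case using step2 by simp
qed simp

lemma shift_mult:
  fixes w :: "int \<Rightarrow> int"
  assumes "\<And>i. w (i + N) = w i + N"
  shows "w (i + N * k) = w i + N * k"
  using assms periodic_int_mult[of "\<lambda>i. w i - i" i k] by (simp add: algebra_simps)

lemma aperm_shift_mult: "w \<in> aperm \<Longrightarrow> w (i + N * k) = w i + N * k"
  using shift_mult[of w] aperm_shift by blast

text \<open>An injective map commuting with the shift by N permutes the residue classes, so i
  \<mapsto> w i mod N maps any N consecutive integers bijectively onto
  \<open>{0..<N}\<close>.\<close>

lemma sum_period:
  fixes h :: "int \<Rightarrow> 'b::comm_monoid_add"
  assumes w: "inj w" "\<And>i. w (i + N) = w i + N" and h: "\<And>i. h (i + N) = h i"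
  shows "(\<Sum>i=a..<a+N. h (w i)) = (\<Sum>i=0..<N. h i)"
proof -
  have Npos: "N > 0" using n_ge_2 by simp
  have hm: "h (i mod N) = h i" for i
    using periodic_int_mult[of h "i mod N" "i div N"] h by simp
  have inj: "inj_on (\<lambda>i. w i mod N) {a..<a+N}"
  proof (rule inj_onI)
    fix i j assume ij: "i \<in> {a..<a+N}" "j \<in> {a..<a+N}" "w i mod N = w j mod N"
    then obtain k where "w i = w j + N * k" by (metis mod_eqE)
    then have "w i = w (j + N * k)" using shift_mult[of w] w(2) by simp
    then have e: "i = j + N * k" using w(1) by (simp add: inj_eq)
    then have "\<bar>N * k\<bar> < N" using ij by auto
    then have "k = 0" by (simp add: abs_mult mult_less_cancel_left1 mult_less_cancel_left2)
    with e show "i = j" by simp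
  qed
  have img: "(\<lambda>i. w i mod N) ` {a..<a+N} = {0..<N}"
  proof (rule card_subset_eq)
    show "card ((\<lambda>i. w i mod N) ` {a..<a+N}) = card {0..<N}"
      by (simp add: card_image inj)
  qed (use Npos in auto)
  have "(\<Sum>i=a..<a+N. h (w i)) = (\<Sum>i=a..<a+N. h (w i mod N))" by (simp add: hm)
  also have "\<dots> = (\<Sum>i=0..<N. h i)"
    using sum.reindex[OF inj, of h] by (simp add: img)
  finally show ?thesis .
qed

lemma sum_window:
  fixes h :: "int \<Rightarrow> 'b::comm_monoid_add"
  assumes "\<And>i. h (i + N) = h i"
  shows "(\<Sum>i=1..N. h i) = (\<Sum>i=a..<a+N. h i)"
proof -
  have "{1..N} = {1..<1+N}" by auto
  then show ?thesis
    using sum_period[of "\<lambda>x. x" h 1] sum_period[of "\<lambda>x. x" h a] assms by simp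
qed

lemma sum_window_aperm:
  fixes h :: "int \<Rightarrow> 'b::comm_monoid_add"
  assumes "inj w" "\<And>i. w (i + N) = w i + N" and "\<And>i. h (i + N) = h i"
  shows "(\<Sum>i=1..N. h (w i)) = (\<Sum>i=1..N. h i)"
proof -
  have "{1..N} = {1..<1+N}" by auto
  then show ?thesis
    using sum_period[of "\<lambda>x. x" h 1] sum_period[of w h 1] assms by simp
qed

lemma id_aperm [simp]: "id \<in> aperm" "(\<lambda>x. x) \<in> aperm"
  by (simp_all add: aperm_def id_def[symmetric])

lemma comp_aperm: assumes "v \<in> aperm" "w \<in> aperm" shows "v \<circ> w \<in> aperm"
proof -
  have "(\<Sum>i=1..N. v (w i) - i) = (\<Sum>i=1..N. v (w i) - w i) + (\<Sum>i=1..N. w i - i)"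
    by (simp flip: sum.distrib)
  also have "(\<Sum>i=1..N. v (w i) - w i) = (\<Sum>i=1..N. v i - i)"
    using assms by (intro sum_window_aperm[of w "\<lambda>j. v j - j"])
      (auto simp: aperm_bij aperm_shift bij_is_inj)
  finally show ?thesis using assms by (auto simp: aperm_def bij_comp)
qed

lemma inv_aperm: assumes "w \<in> aperm" shows "finv w \<in> aperm"
proof -
  have b: "bij w" using assms by (rule aperm_bij)
  have bi: "bij (finv w)" using b by (rule bij_imp_bij_inv)
  have sh: "finv w (i + N) = finv w i + N" for i
    by (metis aperm_shift assms b bij_inv_eq_iff)
  have "(\<Sum>i=1..N. finv w i - i) = (\<Sum>i=1..N. finv w (w i) - w i)"
    using assms by (intro sum_window_aperm[of w "\<lambda>j. finv w j - j", symmetric])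
      (auto simp: aperm_bij aperm_shift bij_is_inj sh)
  also have "\<dots> = - (\<Sum>i=1..N. w i - i)"
    using b by (simp add: bij_is_inj flip: sum_negf)
  finally show ?thesis using assms bi sh by (auto simp: aperm_def)
qed

lemma inv_aperm_simps [simp]: assumes "w \<in> aperm" shows "finv w (w x) = x" "w (finv w x) = x"
  using aperm_bij[OF assms] by (auto simp: bij_def surj_f_inv_f)

text \<open>Reindexing the displacements w i - i by w changes their sign, so their sum over a window
  is zero.\<close>

lemma periodic_involution_aperm:
  assumes "\<And>i. w (i + N) = w i + N" "\<And>i. w (w i) = i"
  shows "w \<in> aperm"
proof -
  have b: "bij w" using assms(2) by (rule involuntory_imp_bij)
  have "(\<Sum>i=1..N. w (w i) - w i) = (\<Sum>i=1..N. w i - i)"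
    using assms(1) b by (intro sum_window_aperm[of w "\<lambda>j. w j - j"])
      (auto simp: bij_is_inj)
  moreover have "(\<Sum>i=1..N. w (w i) - w i) = - (\<Sum>i=1..N. w i - i)"
    unfolding sum_negf[symmetric] by (simp add: assms(2))
  ultimately have "(\<Sum>i=1..N. w i - i) = 0" by linarith
  then show ?thesis using b assms(1) by (simp add: aperm_def)
qed

text \<open>The generator \<open>affine_gen n i\<close> with an arbitrary integer index. Only the
  index modulo N matters (\<open>refl_mod_cong\<close>), so an index such as d i need not be reduced
  to \<open>{0..<n}\<close>.\<close>

definition refl :: "int \<Rightarrow> int \<Rightarrow> int" where
  "refl a j = (if N dvd j - a then j + 1 else if N dvd j - a - 1 then j - 1 else j)"

lemma not_dvd_one [simp]: "\<not> N dvd 1" "\<not> N dvd - 1"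
  by simp_all

lemma dvd_diff_one: "N dvd x \<Longrightarrow> \<not> N dvd x - 1" "N dvd x \<Longrightarrow> \<not> N dvd x + 1"
  using not_dvd_one dvd_diff_right_iff[of N x 1] dvd_add_right_iff[of N x 1] by auto

lemma affine_gen_eq: "affine_gen n i = refl (int i)"
  by (auto simp: affine_gen_def refl_def fun_eq_iff cong_iff_dvd_diff algebra_simps)

lemma refl_shift: "refl a (j + N) = refl a j + N"
proof -
  have "N dvd j + N - a \<longleftrightarrow> N dvd j - a" "N dvd j + N - a - 1 \<longleftrightarrow> N dvd j - a - 1"
    using dvd_add_triv_right_iff[of N "j - a"] dvd_add_triv_right_iff[of N "j - a - 1"]
    by (simp_all only: diff_add_eq[symmetric] add_diff_eq) 
  then show ?thesis by (simp add: refl_def)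
qed

lemma refl_mod_cong: assumes "N dvd b - a" shows "refl b = refl a"
proof
  fix j
  have "N dvd j - a \<longleftrightarrow> N dvd j - b" "N dvd j - a - 1 \<longleftrightarrow> N dvd j - b - 1"
    using assms dvd_diff_right_iff[of N "b - a" "j-b"]  dvd_add_right_iff[of N "b - a" "j-b"]
     dvd_add_right_iff[of N "b - a" "j-b-1"] by (simp_all add: algebra_simps)
  then show "refl b j = refl a j" by (simp add: refl_def)
qed

lemma refl_refl [simp]: "refl a (refl a j) = j"
  using dvd_diff_one[of "j - a"] dvd_diff_one[of "j - a - 1"] by (auto simp: refl_def algebra_simps)

lemma refl_comp_refl [simp]: "refl a \<circ> refl a = id"
  by (simp add: fun_eq_iff)

lemma refl_self [simp]: "refl a a = a + 1" "refl a (a + 1) = a"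
  by (auto simp: refl_def)

text \<open>Points move by at most one, so only pairs at distance one or two need attention.\<close>

lemma refl_less:
  assumes "x < y" "\<not> (y = x + 1 \<and> N dvd x - a)" shows "refl a x < refl a y"
proof -
  have up: "refl a z \<le> z + 1" and down: "z - 1 \<le> refl a z" for z by (auto simp: refl_def)
  consider "y = x + 1" | "y = x + 2" | "y \<ge> x + 3" using assms(1) by linarith
  then show ?thesis
  proof cases
    case 1
    then have d: "\<not> N dvd x - a" "\<not> N dvd y - a - 1" using assms(2) by (simp_all add: algebra_simps)
    then have "refl a x \<le> x" "y \<le> refl a y" by (auto simp: refl_def)
    with 1 show ?thesis by linarith
  next
    \<comment> \<open>The gap could close only if x moves up and y moves down, that is, if N divides
      both x - a and x + 1 - a.\<close>
    case 2
    show ?thesis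
    proof (cases "N dvd x - a")
      case True
      then have "\<not> N dvd y - a - 1" using 2 dvd_diff_one(2)[OF True] by (simp add: algebra_simps)
      then have "y \<le> refl a y" by (auto simp: refl_def)
      with 2 up[of x] show ?thesis by linarith
    next
      case False
      then have "refl a x \<le> x" by (auto simp: refl_def)
      with 2 down[of y] show ?thesis by linarith
    qed
  next
    case 3
    with up[of x] down[of y] show ?thesis by linarith
  qed
qed

lemma refl_aperm [simp]: "refl a \<in> aperm"
  by (rule periodic_involution_aperm) (simp_all add: refl_shift)

lemma inv_refl [simp]: "finv (refl a) = refl a"
  by (rule inv_unique_comp) simp_all

lemma inv_comp: "v \<in> aperm \<Longrightarrow> w \<in> aperm \<Longrightarrow> finv (v \<circ> w) = finv w \<circ> finv v"
  by (simp add: o_inv_distrib aperm_bij)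

text \<open>An increasing bijection of the integers is a translation, and the normalization of the
  sum leaves only the identity.\<close>

lemma strict_mono_aperm_id:
  assumes w: "w \<in> aperm" and inc: "\<And>i. w i < w (i + 1)"
  shows "w = id"
proof -
  have st: "w (i + 1) = w i + 1" for i
  proof (rule ccontr)
    assume "w (i + 1) \<noteq> w i + 1"
    then have gap: "w i < w i + 1" "w i + 1 < w (i + 1)" using inc[of i] by auto
    have sm: "strict_mono w"
    proof (rule strict_monoI)
      fix x y :: int assume "x < y"
      then show "w x < w y"
        by (induction rule: int_gr_induct) (use inc less_trans in blast)+
    qed
    define j where "j = finv w (w i + 1)"
    have "w j = w i + 1" using w by (simp add: j_def)
    then have "w i < w j" "w j < w (i + 1)" using gap by auto
    then have "i < j" "j < i + 1" using sm by (auto simp: strict_mono_less)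
    then show False by simp
  qed
  have tr: "w i = i + (w 0)" for i
  proof (induction i rule: int_induct[where k = 0])
    case (step2 i)
    then show ?case using st[of "i - 1"] by simp
  qed (simp_all add: st)
  have "(\<Sum>i=1..N. w i - i) = N * w 0" by (subst tr) simp
  then have "w 0 = 0" using w n_ge_2 by (simp add: aperm_def)
  with tr show ?thesis by (simp add: fun_eq_iff)
qed

subsection \<open>Length\<close>

lemma div_shift: "(x + N) div N = x div N + 1" "(x - N) div N = x div N - 1"
  using div_mult_self1[of N x "-1"] by simp_all

lemma div_minus: "\<not> N dvd x \<Longrightarrow> (- x) div N = - (x div N) - 1"
  by (auto simp: zdiv_zminus1_eq_if dvd_eq_mod_eq_0)

lemma aperm_dvd_diff:
  assumes "w \<in> aperm" shows "N dvd w x - w y \<longleftrightarrow> N dvd x - y"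
proof
  assume "N dvd w x - w y"
  then obtain k where "w x = w y + N * k" by (metis dvdE diff_add_cancel add.commute)
  then have "w x = w (y + N * k)" using aperm_shift_mult[OF assms, of y k] by simp
  then show "N dvd x - y" using assms by (simp add: aperm_inj)
next
  assume "N dvd x - y"
  then obtain k where "x = y + N * k" by (metis dvdE diff_add_cancel add.commute)
  then show "N dvd w x - w y" using aperm_shift_mult[OF assms, of y k] by simp
qed

text \<open>The number of inversions of \<open>w\<close> between the residue classes of \<open>i\<close> and \<open>j\<close>.\<close>

definition class_inv :: "(int \<Rightarrow> int) \<Rightarrow> int \<Rightarrow> int \<Rightarrow> int" where
  "class_inv w i j = \<bar>(w j - w i) div N - (j - i) div N\<bar>"

text \<open>Every inversion between two classes is counted twice, hence the halving below.\<close>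

definition inv2 :: "(int \<Rightarrow> int) \<Rightarrow> int" where
  "inv2 w = (\<Sum>i=1..N. \<Sum>j=1..N. class_inv w i j)"

text \<open>Shi's formula for the length in the affine symmetric group;
  \<open>cox_length_parab\<close> proves that it is the Coxeter length.\<close>

definition alen :: "(int \<Rightarrow> int) \<Rightarrow> nat" where
  "alen w = nat (inv2 w) div 2"

lemma class_inv_shift:
  assumes "w \<in> aperm"
  shows "class_inv w (i + N) j = class_inv w i j" "class_inv w i (j + N) = class_inv w i j"
  using div_shift[of "w j - w i"] div_shift[of "j - i"]
  by (simp_all add: class_inv_def aperm_shift[OF assms] algebra_simps)

text \<open>Lets the window start at a, so that a and a + 1 both lie in it.\<close>

lemma inv2_window:
  assumes "w \<in> aperm"
  shows "inv2 w = (\<Sum>i=a..<a+N. \<Sum>j=a..<a+N. class_inv w i j)"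
proof -
  have "(\<Sum>j=1..N. class_inv w i j) = (\<Sum>j=a..<a+N. class_inv w i j)" for i
    by (rule sum_window) (simp add: class_inv_shift assms)
  then show ?thesis unfolding inv2_def
    by (simp only:) (rule sum_window, simp add: class_inv_shift assms)
qed

lemma inv2_nonneg: "0 \<le> inv2 w"
  by (simp add: inv2_def class_inv_def sum_nonneg)

text \<open>In a window starting at a, \<open>refl a\<close> just swaps a and a + 1. Reindexing by
  it leaves the values of w in place and alters only the differences of positions, whose quotient by
  N changes only for the two ordered pairs in \<open>E\<close>.\<close>

lemma inv2_comp_refl:
  assumes w: "w \<in> aperm"
  shows "inv2 (w \<circ> refl a) = (if w a < w (a + 1) then inv2 w + 2 else inv2 w - 2)"
proof -
  define R where "R = {a..<a+N}"
  define F where "F = (\<lambda>(i, j). \<bar>(w j - w i) div N - (j - i) div N\<bar>)"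
  define G where "G = (\<lambda>(i, j). \<bar>(w j - w i) div N - (refl a j - refl a i) div N\<bar>)"
  define E where "E = {(a, a + 1), (a + 1, a)}"
  have Npos: "N > 1" using n_ge_2 by simp
  have dvd0: "N dvd i - a \<longleftrightarrow> i = a" if "i \<in> R" for i
    using that zdvd_imp_le[of N "i - a"] by (cases "i = a") (auto simp: R_def)
  have dvd1: "N dvd i - a - 1 \<longleftrightarrow> i = a + 1" if "i \<in> R" for i
  proof
    assume d: "N dvd i - a - 1"
    show "i = a + 1"
    proof (cases "i = a")
      case False
      then have "i - a - 1 \<ge> 0" "i - a - 1 < N" using that by (auto simp: R_def)
      with d show ?thesis using zdvd_imp_le[of N "i - a - 1"] by fastforce
    qed (use d in simp)
  qed simp
  have sgR: "refl a i = (if i = a then a + 1 else if i = a + 1 then a else i)" if "i \<in> R" for i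
    using dvd0[OF that] dvd1[OF that] by (auto simp: refl_def)
  have bij: "bij_betw (refl a) R R"
    by (rule bij_betwI[where g = "refl a"]) (use Npos sgR in \<open>auto simp: R_def\<close>)
  have "inv2 (w \<circ> refl a) = (\<Sum>i\<in>R. \<Sum>j\<in>R. class_inv (w \<circ> refl a) i j)"
    unfolding R_def by (rule inv2_window) (simp add: comp_aperm w)
  also have "\<dots> = (\<Sum>i\<in>R. \<Sum>j\<in>R. class_inv (w \<circ> refl a) (refl a i) (refl a j))"
    by (subst sum.reindex_bij_betw[OF bij, symmetric], rule sum.cong[OF refl],
        subst sum.reindex_bij_betw[OF bij, symmetric]) simp
  also have "\<dots> = (\<Sum>p\<in>R\<times>R. G p)"
    by (simp add: class_inv_def G_def sum.cartesian_product)
  finally have g: "inv2 (w \<circ> refl a) = (\<Sum>p\<in>R\<times>R. G p)" .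
  have f: "inv2 w = (\<Sum>p\<in>R\<times>R. F p)"
    using inv2_window[OF w, of a] by (simp add: class_inv_def F_def sum.cartesian_product R_def)
  have small: "x div N = (if x < 0 then - 1 else 0)" if "- N < x" "x < N" for x
    using that div_shift(1)[of x] div_pos_pos_trivial[of x N] div_pos_pos_trivial[of "x + N" N]
    by (cases "x < 0") auto
  have eq: "G p = F p" if "p \<in> R \<times> R - E" for p
  proof -
    obtain i j where "p = (i, j)" by (cases p)
    with that have p: "p = (i, j)" "i \<in> R" "j \<in> R" "(i, j) \<notin> E" by simp_all
    have rng: "refl a i \<in> R" "refl a j \<in> R" using bij p by (auto simp: bij_betw_def)
    \<comment> \<open>Both differences lie strictly between -N and N, so the quotients depend on the
      sign alone, and the sign flips only on \<open>E\<close>.\<close>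
    have "(refl a j - refl a i) div N = (j - i) div N"
      using p rng by (subst (1 2) small) (auto simp: R_def sgR E_def split: if_splits)
    then show ?thesis by (simp add: F_def G_def p)
  qed
  have "(\<Sum>p\<in>R\<times>R. G p) - (\<Sum>p\<in>R\<times>R. F p) = (\<Sum>p\<in>R\<times>R. G p - F p)"
    by (simp add: sum_subtractf)
  also have "\<dots> = (\<Sum>p\<in>E. G p - F p)"
    by (rule sum.mono_neutral_right) (use eq Npos in \<open>auto simp: R_def E_def\<close>)
  also have "\<dots> = (G (a, a + 1) - F (a, a + 1)) + (G (a + 1, a) - F (a + 1, a))"
    by (simp add: E_def)
  finally have diff: "inv2 (w \<circ> refl a) - inv2 w =
      (G (a, a + 1) - F (a, a + 1)) + (G (a + 1, a) - F (a + 1, a))" by (simp add: f g)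
  define x where "x = (w (a + 1) - w a) div N"
  have "\<not> N dvd w (a + 1) - w a" using aperm_dvd_diff[OF w, of "a + 1" a] by simp
  then have y: "(w a - w (a + 1)) div N = - x - 1"
    using div_minus[of "w (a + 1) - w a"] by (simp add: x_def)
  have "w a \<noteq> w (a + 1)" using aperm_inj[OF w] by simp
  then have xs: "w a < w (a + 1) \<longleftrightarrow> 0 \<le> x"
    using Npos by (simp add: x_def pos_imp_zdiv_nonneg_iff order.strict_iff_order)
  have "1 div N = 0" "(-1) div N = -1" using Npos small[of 1] small[of "-1"] by auto
  \<comment> \<open>Each of the two pairs goes from |x| to |x + 1|, a change of 1 if x is
    nonnegative and of -1 otherwise.\<close>
  then have "G (a, a + 1) = \<bar>x + 1\<bar>" "F (a, a + 1) = \<bar>x\<bar>" "G (a + 1, a) = \<bar>x + 1\<bar>" "F (a + 1, a) = \<bar>x\<bar>"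
    by (simp_all add: G_def F_def y x_def[symmetric])
  with diff xs show ?thesis by auto
qed

lemma alen_comp_refl_up: "w \<in> aperm \<Longrightarrow> w a < w (a + 1) \<Longrightarrow> alen (w \<circ> refl a) = alen w + 1"
  using inv2_comp_refl[of w a] inv2_nonneg[of w] by (simp add: alen_def nat_add_distrib)

lemma alen_comp_refl_down:
  assumes "w \<in> aperm" "w (a + 1) < w a" shows "alen w = alen (w \<circ> refl a) + 1"
proof -
  have "alen ((w \<circ> refl a) \<circ> refl a) = alen (w \<circ> refl a) + 1"
    by (rule alen_comp_refl_up) (use assms comp_aperm in auto)
  then show ?thesis by (simp add: comp_assoc)
qed

lemma aperm_cases: "w \<in> aperm \<Longrightarrow> w a < w (a + 1) \<or> w (a + 1) < w a"
  using aperm_inj[of w a "a + 1"] by linarith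

lemma alen_id [simp]: "alen id = 0"
  by (simp add: alen_def inv2_def class_inv_def)

text \<open>The summand of \<open>finv w\<close> at (w i, w j) is that of w at (i, j), because the
  absolute difference in \<open>class_inv\<close> is symmetric in positions and values.\<close>

lemma alen_inv:
  assumes w: "w \<in> aperm" shows "alen (finv w) = alen w"
proof -
  have f: "finv w \<in> aperm" using w by (rule inv_aperm)
  have iw: "inj w" "\<And>i. w (i + N) = w i + N" using w by (auto simp: aperm_bij bij_is_inj aperm_shift)
  have "inv2 (finv w) = (\<Sum>i=1..N. \<Sum>j=1..N. class_inv (finv w) (w i) j)"
    unfolding inv2_def
    by (rule sum_window_aperm[OF iw, symmetric]) (simp add: class_inv_shift f)
  also have "\<dots> = (\<Sum>i=1..N. \<Sum>j=1..N. class_inv (finv w) (w i) (w j))"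
    by (intro sum.cong refl sum_window_aperm[OF iw, symmetric]) (simp add: class_inv_shift f)
  also have "\<dots> = inv2 w"
    unfolding inv2_def by (simp add: class_inv_def w abs_minus_commute)
  finally show ?thesis by (simp add: alen_def)
qed

lemma alen_refl_comp_up:
  assumes "w \<in> aperm" "finv w a < finv w (a + 1)" shows "alen (refl a \<circ> w) = alen w + 1"
proof -
  have "alen (refl a \<circ> w) = alen (finv (refl a \<circ> w))" using assms by (simp add: alen_inv comp_aperm)
  also have "\<dots> = alen (finv w \<circ> refl a)" using assms by (simp add: inv_comp)
  also have "\<dots> = alen w + 1" using assms by (simp add: alen_comp_refl_up inv_aperm alen_inv)
  finally show ?thesis .
qed

lemma involution_finv: "u \<circ> u = id \<Longrightarrow> finv u = u"
  by (rule inv_unique_comp)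

lemma involution_simp: "u \<circ> u = id \<Longrightarrow> u (u x) = x"
  by (metis comp_apply id_apply)

text \<open>If u moved a by N k, applying u twice would move it by 2 N k.\<close>

lemma involution_fix:
  assumes "u \<in> aperm" "u \<circ> u = id" "N dvd u a - a" shows "u a = a"
proof -
  obtain k where k: "u a = a + N * k" using assms(3) by (metis dvdE diff_add_cancel add.commute)
  have "u (u a) = u a + N * k" by (subst k) (simp add: aperm_shift_mult assms)
  then have "N * k = 0" using k assms involution_simp[of u a] by simp
  with k show ?thesis by simp
qed

lemma conj_involution: "u \<circ> u = id \<Longrightarrow> (refl a \<circ> u \<circ> refl a) \<circ> (refl a \<circ> u \<circ> refl a) = id"
  by (simp add: fun_eq_iff)

text \<open>Right multiplication raises the length by hypothesis. So does left multiplication unless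
  \<open>refl a\<close> swaps u a and u (a + 1); in that case \<open>involution_fix\<close> makes u
  fix both a and a + 1.\<close>

lemma alen_conj_up:
  assumes u: "u \<in> aperm" "u \<circ> u = id" and a: "u a < u (a + 1)" "\<not> (u a = a \<and> u (a + 1) = a + 1)"
  shows "alen (refl a \<circ> u \<circ> refl a) = alen u + 2"
proof -
  have "refl a (u a) < refl a (u (a + 1))"
    using involution_fix[OF u, of a] a by (intro refl_less) auto
  then have "alen (refl a \<circ> (u \<circ> refl a)) = alen (u \<circ> refl a) + 1"
    using u by (intro alen_refl_comp_up) (auto simp: comp_aperm inv_comp involution_finv)
  also have "alen (u \<circ> refl a) = alen u + 1" using u a by (simp add: alen_comp_refl_up)
  finally show ?thesis by (simp add: o_def)
qed

text \<open>The conjugate v satisfies the hypotheses of \<open>alen_conj_up\<close>. The case to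
  exclude is that u exchanges a and a + 1 up to a multiple of N; being an involution, it would
  exchange them exactly.\<close>

lemma alen_conj_down:
  assumes u: "u \<in> aperm" "u \<circ> u = id" and a: "u (a + 1) < u a" "u a \<noteq> a + 1"
  shows "alen u = alen (refl a \<circ> u \<circ> refl a) + 2"
proof -
  define v where "v = refl a \<circ> u \<circ> refl a"
  have uv: "u = refl a \<circ> v \<circ> refl a" by (simp add: v_def fun_eq_iff)
  have v: "v \<in> aperm" "v \<circ> v = id" using u by (auto simp: v_def comp_aperm conj_involution)
  have ne: "\<not> (u a = u (a + 1) + 1 \<and> N dvd u (a + 1) - a)"
  proof
    assume h: "u a = u (a + 1) + 1 \<and> N dvd u (a + 1) - a"
    then obtain k where k: "u (a + 1) = a + N * k" by (metis dvdE diff_add_cancel add.commute)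
    have "u (u (a + 1)) = u a + N * k" by (subst k) (simp add: aperm_shift_mult u)
    then have "N * k = 0" using h k involution_simp[OF u(2), of "a + 1"] by simp
    then show False using h k a by simp
  qed
  have "v a < v (a + 1)" using refl_less[OF a(1), of a] ne by (auto simp: v_def)
  moreover have "\<not> (v a = a \<and> v (a + 1) = a + 1)"
  proof
    assume "v a = a \<and> v (a + 1) = a + 1"
    moreover have "u (a + 1) = refl a (v a)" "u a = refl a (v (a + 1))" by (simp_all add: v_def)
    ultimately have "u (a + 1) = a + 1" "u a = a" by simp_all
    with a show False by simp
  qed
  ultimately have "alen u = alen v + 2" by (subst uv) (rule alen_conj_up[OF v])
  then show ?thesis by (simp only: v_def)
qed

subsection \<open>Parabolic subgroups\<close>

text \<open>Generators are indexed by all integers modulo \<open>n\<close>, so sets of generators are periodic sets.\<close>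

definition periodic :: "int set \<Rightarrow> bool" where
  "periodic K \<longleftrightarrow> (\<forall>i. i + N \<in> K \<longleftrightarrow> i \<in> K)"

lemma periodicD: assumes "periodic K" "N dvd i - j" shows "i \<in> K \<longleftrightarrow> j \<in> K"
proof -
  obtain k where "i = j + N * k" using assms(2) by (metis dvdE diff_add_cancel add.commute)
  then show ?thesis
    using periodic_int_mult[of "\<lambda>i. i \<in> K" j k] assms(1) by (simp add: periodic_def)
qed

text \<open>The parabolic subgroup with generators indexed by \<open>K\<close>, described by the cuts that it
  preserves.\<close>

definition parab :: "int set \<Rightarrow> (int \<Rightarrow> int) set" where
  "parab K = {w \<in> aperm. \<forall>i. i \<notin> K \<longrightarrow> (\<forall>j. w j \<le> i \<longleftrightarrow> j \<le> i)}"

lemma parab_aperm: "w \<in> parab K \<Longrightarrow> w \<in> aperm"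
  by (simp add: parab_def)

lemma parab_le: "w \<in> parab K \<Longrightarrow> i \<notin> K \<Longrightarrow> w j \<le> i \<longleftrightarrow> j \<le> i"
  by (simp add: parab_def)

lemma parab_id [simp]: "id \<in> parab K"
  by (simp add: parab_def)

lemma parab_UNIV: "parab UNIV = aperm"
  by (simp add: parab_def)

lemma parab_mono: "K \<subseteq> L \<Longrightarrow> parab K \<subseteq> parab L"
  by (auto simp: parab_def)

lemma parab_comp: "v \<in> parab K \<Longrightarrow> w \<in> parab K \<Longrightarrow> v \<circ> w \<in> parab K"
  by (simp add: parab_def comp_aperm)

lemma parab_finv: assumes "w \<in> parab K" shows "finv w \<in> parab K"
proof -
  have w: "w \<in> aperm" using assms by (rule parab_aperm)
  have "finv w j \<le> i \<longleftrightarrow> j \<le> i" if "i \<notin> K" for i j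
    using parab_le[OF assms that, of "finv w j"] w by simp
  then show ?thesis using w by (simp add: parab_def inv_aperm)
qed

lemma parab_refl: assumes "periodic K" "i \<in> K" shows "refl i \<in> parab K"
proof -
  have "refl i j \<le> m \<longleftrightarrow> j \<le> m" if "m \<notin> K" for m j
  proof -
    have m: "\<not> N dvd m - i" using periodicD[OF assms(1), of m i] that assms by blast
    have "refl i j = j + 1 \<and> j \<noteq> m \<or> refl i j = j - 1 \<and> j \<noteq> m + 1 \<or> refl i j = j"
    proof (cases "N dvd j - i")
      case True
      then show ?thesis using m by (auto simp: refl_def)
    next
      case False
      have "j \<noteq> m + 1" if "N dvd j - i - 1" using m that by auto
      with False show ?thesis by (auto simp: refl_def)
    qed
    then show ?thesis by auto
  qed
  then show ?thesis by (simp add: parab_def)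
qed

text \<open>At an index outside K the cut itself forces an ascent, so w increases
  everywhere.\<close>

lemma parab_no_descent:
  assumes "w \<in> parab K" and "\<And>i. i \<in> K \<Longrightarrow> w i < w (i + 1)"
  shows "w = id"
proof (rule strict_mono_aperm_id)
  show "w i < w (i + 1)" for i
  proof (cases "i \<in> K")
    case False
    then have "w i \<le> i" "\<not> w (i + 1) \<le> i" by (simp_all add: parab_le[OF assms(1)])
    then show ?thesis by linarith
  qed (rule assms(2))
qed (rule parab_aperm[OF assms(1)])

lemma parab_descent:
  assumes "w \<in> parab K" "w \<noteq> id" obtains i where "i \<in> K" "w (i + 1) < w i"
  using parab_no_descent[OF assms(1)] assms aperm_cases[OF parab_aperm[OF assms(1)]] by blast

text \<open>A nonidentity element of \<open>parab K\<close> has a descent in K, and removing it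
  stays in \<open>parab K\<close>. This links the description by cuts with words in the generators
  of K.\<close>

lemma parab_induct [consumes 2, case_names id step]:
  assumes "w \<in> parab K" "periodic K" and "P id"
    and step: "\<And>w i. w \<in> parab K \<Longrightarrow> i \<in> K \<Longrightarrow> w i < w (i + 1) \<Longrightarrow> P w \<Longrightarrow> P (w \<circ> refl i)"
  shows "P w"
  using assms(1)
proof (induction "alen w" arbitrary: w rule: less_induct)
  case less
  show ?case
  proof (cases "w = id")
    case False
    then obtain i where i: "i \<in> K" "w (i + 1) < w i" using parab_descent less.prems by blast
    have w: "w \<in> aperm" using less.prems by (rule parab_aperm)
    have v: "w \<circ> refl i \<in> parab K" using less.prems i assms(2) by (simp add: parab_comp parab_refl)
    have "P (w \<circ> refl i)" using less.hyps[OF _ v] alen_comp_refl_down[OF w i(2)] by simp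
    then have "P ((w \<circ> refl i) \<circ> refl i)" using i v by (intro step[OF v i(1)]) auto
    then show ?thesis by (simp add: comp_assoc)
  qed (use assms in simp)
qed

lemma aperm_word:
  assumes "set xs \<subseteq> range refl"
  shows "foldr (\<circ>) xs id \<in> aperm \<and> alen (foldr (\<circ>) xs id) \<le> length xs"
  using assms
proof (induction xs)
  case (Cons x xs)
  then obtain a where x: "x = refl a" by auto
  define w where "w = foldr (\<circ>) xs id"
  have "set xs \<subseteq> range refl" using Cons.prems by simp
  note IH = Cons.IH[OF this, folded w_def]
  have w: "w \<in> aperm" "alen w \<le> length xs" using IH by blast+
  have "alen (finv w \<circ> refl a) \<le> alen (finv w) + 1"
    using aperm_cases[of "finv w" a] alen_comp_refl_up[of "finv w" a] alen_comp_refl_down[of "finv w" a]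
    by (auto simp: inv_aperm w)
  moreover have "alen (refl a \<circ> w) = alen (finv w \<circ> refl a)"
    using alen_inv[of "refl a \<circ> w"] w by (simp add: comp_aperm inv_comp)
  ultimately have "alen (refl a \<circ> w) \<le> length (x # xs)" using w by (simp add: alen_inv)
  moreover have "refl a \<circ> w \<in> aperm" using w by (simp add: comp_aperm)
  ultimately show "foldr (\<circ>) (x # xs) id \<in> aperm \<and> alen (foldr (\<circ>) (x # xs) id) \<le> length (x # xs)"
    by (simp add: x w_def[symmetric])
qed simp

lemma parab_reduced_word:
  assumes "w \<in> parab K" "periodic K"
  shows "\<exists>xs. set xs \<subseteq> refl ` K \<and> foldr (\<circ>) xs id = w \<and> length xs = alen w"
  using assms
proof (induction rule: parab_induct)
  case (step w i)
  then obtain xs where xs: "set xs \<subseteq> refl ` K" "foldr (\<circ>) xs id = w" "length xs = alen w" by blast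
  have xs': "foldr (\<circ>) (xs @ [refl i]) id = foldr (\<circ>) xs id \<circ> refl i"
    by (induction xs) (simp_all add: comp_assoc)
  show "\<exists>xs. set xs \<subseteq> refl ` K \<and> foldr (\<circ>) xs id = w \<circ> refl i \<and> length xs = alen (w \<circ> refl i)"
    using xs(1,3) xs'[unfolded xs(2)] step.hyps(2) alen_comp_refl_up[OF parab_aperm[OF step.hyps(1)] step.hyps(3)]
    by (intro exI[of _ "xs @ [refl i]"]) simp
next
  case id
  show "\<exists>xs. set xs \<subseteq> refl ` K \<and> foldr (\<circ>) xs id = id \<and> length xs = alen id"
    by (rule exI[of _ "[]"]) simp
qed

text \<open>Stated for any structure with this multiplication and unit, so that it serves the whole
  group and its parabolic subgroups alike: the length computed in (W_K, K) is again
  \<open>alen\<close>.\<close>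

lemma cox_length_parab:
  assumes "w \<in> parab K" "periodic K" "monoid.mult G = (\<lambda>v w. v \<circ> w)" "one G = id"
  shows "cox_length G (refl ` K) w = alen w"
  unfolding cox_length_def
proof (rule Least_equality)
  have f: "foldr (\<otimes>\<^bsub>G\<^esub>) xs \<one>\<^bsub>G\<^esub> = foldr (\<circ>) xs id" for xs
    using assms(3,4) by simp
  show "\<exists>xs. length xs = alen w \<and> set xs \<subseteq> refl ` K \<and> w = foldr (\<otimes>\<^bsub>G\<^esub>) xs \<one>\<^bsub>G\<^esub>"
    using parab_reduced_word[OF assms(1,2)] by (auto simp: f)
  show "alen w \<le> k" if "\<exists>xs. length xs = k \<and> set xs \<subseteq> refl ` K \<and> w = foldr (\<otimes>\<^bsub>G\<^esub>) xs \<one>\<^bsub>G\<^esub>" for k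
    using that aperm_word by (force simp: f)
qed

section \<open>Groups and generators of the definitions\<close>

lemma affine_mult [simp]:
  "monoid.mult (affine_sym n) = (\<lambda>v w. v \<circ> w)" "one (affine_sym n) = id"
  by (simp_all add: affine_sym_def)

lemma affine_group: "group (affine_sym n)"
proof (rule groupI)
  fix x assume "x \<in> carrier (affine_sym n)"
  then have "finv x \<in> aperm \<and> finv x \<circ> x = id"
    by (simp add: carrier_affine_sym inv_aperm fun_eq_iff)
  then show "\<exists>y\<in>carrier (affine_sym n). y \<otimes>\<^bsub>affine_sym n\<^esub> x = \<one>\<^bsub>affine_sym n\<^esub>"
    by (auto simp: carrier_affine_sym)
qed (simp_all add: carrier_affine_sym comp_aperm comp_assoc)

lemma m_inv_affine: assumes "w \<in> aperm" shows "m_inv (affine_sym n) w = finv w"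
  by (rule group.inv_equality[OF affine_group])
    (use assms in \<open>simp_all add: carrier_affine_sym inv_aperm fun_eq_iff\<close>)

lemma generate_parab: assumes "periodic K" shows "generate (affine_sym n) (refl ` K) = parab K"
proof
  show "generate (affine_sym n) (refl ` K) \<subseteq> parab K"
  proof
    fix w assume "w \<in> generate (affine_sym n) (refl ` K)"
    then show "w \<in> parab K"
    proof (induction rule: generate.induct)
      case one
      show ?case unfolding affine_mult by (rule parab_id)
    next
      case (eng h1 h2)
      then show ?case unfolding affine_mult by (intro parab_comp)
    qed (auto simp: m_inv_affine parab_refl assms)
  qed
  show "parab K \<subseteq> generate (affine_sym n) (refl ` K)"
  proof
    fix w assume "w \<in> parab K"
    then show "w \<in> generate (affine_sym n) (refl ` K)" using assms
    proof (induction rule: parab_induct)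
      case id
      show ?case using generate.one[of "affine_sym n" "refl ` K"] unfolding affine_mult .
    next
      case (step w i)
      show "w \<circ> refl i \<in> generate (affine_sym n) (refl ` K)"
        using generate.eng[OF step.IH generate.incl[of "refl i" "refl ` K"]] step.hyps by simp
    qed
  qed
qed

abbreviation WG :: "int set \<Rightarrow> (int \<Rightarrow> int) monoid" where
  "WG K \<equiv> (affine_sym n)\<lparr>carrier := parab K\<rparr>"

lemma parabolic_parab: "periodic K \<Longrightarrow> parabolic (affine_sym n) (refl ` K) = WG K"
  by (simp add: parabolic_def generate_parab)

text \<open>With K = UNIV and d = id, results on twisted involutions of parabolic subgroups also
  cover the ordinary involutions of the whole group.\<close>

lemma WG_UNIV: "WG UNIV = affine_sym n"
  by (simp add: parab_UNIV affine_sym_def aperm_def sum_subtractf)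

lemma m_inv_WG: assumes "w \<in> parab K" "periodic K" shows "m_inv (WG K) w = finv w"
proof -
  have "subgroup (parab K) (affine_sym n)"
    unfolding generate_parab[OF assms(2), symmetric]
    by (rule group.generate_is_subgroup[OF affine_group]) (auto simp: carrier_affine_sym)
  then show ?thesis
    using group.m_inv_consistent[OF affine_group, of "parab K" w] assms
    by (simp add: m_inv_affine parab_aperm)
qed

lemma cox_length_WG: "w \<in> parab K \<Longrightarrow> periodic K \<Longrightarrow> cox_length (WG K) (refl ` K) w = alen w"
  by (rule cox_length_parab) simp_all

lemma affine_gens_eq: "affine_gens n = refl ` UNIV"
proof -
  have "refl a \<in> affine_gen n ` {0..<n}" for a
  proof -
    have "refl a = refl (int (nat (a mod N)))"
      by (rule refl_mod_cong) (simp add: mod_eq_dvd_iff[symmetric])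
    moreover have r: "0 \<le> a mod N" "a mod N < N" by simp_all
    then have "nat (a mod N) < n" by (simp add: nat_less_iff)
    ultimately show ?thesis unfolding affine_gen_eq by (intro image_eqI[of _ _ "nat (a mod N)"]) auto
  qed
  then show ?thesis using n_ge_2 by (auto simp: affine_gens_def affine_gen_eq)
qed

definition J :: "int set" where "J = {i. \<not> N dvd i}"

lemma periodic_J: "periodic J"
  by (simp add: periodic_def J_def)

lemma periodic_UNIV: "periodic UNIV"
  by (simp add: periodic_def)

lemma finite_gens_eq: "finite_gens n = refl ` J"
proof -
  have "refl a \<in> affine_gen n ` {1..<n}" if "a \<in> J" for a
  proof -
    have "refl a = refl (int (nat (a mod N)))"
      by (rule refl_mod_cong) (simp add: mod_eq_dvd_iff[symmetric])
    moreover have r: "0 \<le> a mod N" "a mod N < N" by simp_all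
    then have "nat (a mod N) < n" by (simp add: nat_less_iff)
    moreover have "a mod N \<noteq> 0" using that by (simp add: J_def dvd_eq_mod_eq_0)
    then have "nat (a mod N) \<noteq> 0" using r by linarith
    ultimately show ?thesis unfolding affine_gen_eq by (intro image_eqI[of _ _ "nat (a mod N)"]) auto
  qed
  moreover have "int i \<in> J" if "i \<in> {1..<n}" for i
    using that by (auto simp: J_def dest: nat_dvd_not_less)
  ultimately show ?thesis by (auto simp: finite_gens_def affine_gen_eq)
qed

subsection \<open>Twisted involutions and absolute length\<close>

definition moved :: "(int \<Rightarrow> int) \<Rightarrow> nat" where
  "moved u = (\<Sum>i=1..N. of_bool (u i \<noteq> i))"

text \<open>For an involution this is the number of 2-cycles modulo \<open>n\<close>, which is its absolute length.\<close>

definition cyc :: "(int \<Rightarrow> int) \<Rightarrow> nat" where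
  "cyc u = moved u div 2"

lemma moved_conj:
  assumes x: "x \<in> aperm" and u: "u \<in> aperm"
  shows "moved (x \<circ> u \<circ> finv x) = moved u"
proof -
  define h :: "int \<Rightarrow> nat" where "h j = of_bool (u j \<noteq> j)" for j
  define v where "v = finv x"
  have v: "v \<in> aperm" using x by (simp add: v_def inv_aperm)
  have eq: "x (u (v i)) = i \<longleftrightarrow> u (v i) = v i" for i
    using x by (metis v_def inv_aperm_simps)
  have "moved (x \<circ> u \<circ> v) = (\<Sum>i=1..N. h (v i))"
    by (simp add: moved_def h_def eq)
  also have "\<dots> = (\<Sum>i=1..N. h i)"
    using v by (intro sum_window_aperm) (auto simp: aperm_bij bij_is_inj aperm_shift h_def u)
  finally show ?thesis by (simp add: moved_def h_def v_def)
qed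

lemma cyc_conj: "x \<in> aperm \<Longrightarrow> u \<in> aperm \<Longrightarrow> cyc (x \<circ> u \<circ> finv x) = cyc u"
  by (simp add: cyc_def moved_conj)

lemma cyc_conj_refl: "u \<in> aperm \<Longrightarrow> cyc (refl a \<circ> u \<circ> refl a) = cyc u"
  using cyc_conj[of "refl a" u] by simp

lemma cyc_id [simp]: "cyc id = 0"
  by (simp add: cyc_def moved_def)

lemma sum_class: "(\<Sum>i=1..N. of_bool (N dvd i - a)) = (1::nat)"
proof -
  have per: "N dvd i + N - a \<longleftrightarrow> N dvd i - a" for i
    using dvd_add_triv_right_iff[of N "i - a"] by (simp add: algebra_simps)
  have "(\<Sum>i=1..N. of_bool (N dvd i - a)) = (\<Sum>i=a..<a+N. of_bool (N dvd i - a) :: nat)"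
    by (rule sum_window) (simp only: per)
  also have "\<dots> = (\<Sum>i=a..<a+N. of_bool (i = a))"
  proof (rule sum.cong)
    fix i assume i: "i \<in> {a..<a+N}"
    show "of_bool (N dvd i - a) = (of_bool (i = a) :: nat)"
      using i zdvd_imp_le[of N "i - a"] by (cases "i = a") auto
  qed simp
  also have "\<dots> = 1" by (simp add: of_bool_def)
  finally show ?thesis .
qed

lemma dvd_shiftE: assumes "N dvd x - a" obtains k where "x = a + N * k"
  using assms by (metis dvdE diff_add_cancel add.commute)

text \<open>The residue classes of a and a + 1 become moved, and no other class changes.\<close>

lemma moved_comp_refl:
  assumes u: "u \<in> aperm" "u a = a" "u (a + 1) = a + 1"
  shows "moved (u \<circ> refl a) = moved u + 2"
proof -
  have "of_bool (u (refl a i) \<noteq> i) =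
      of_bool (u i \<noteq> i) + of_bool (N dvd i - a) + (of_bool (N dvd i - (a + 1)) :: nat)" for i
  proof -
    consider "N dvd i - a" | "\<not> N dvd i - a" "N dvd i - (a + 1)" | "\<not> N dvd i - a" "\<not> N dvd i - (a + 1)"
      by blast
    then show ?thesis
    proof cases
      case 1
      then obtain k where k: "i = a + N * k" by (rule dvd_shiftE)
      have "u i = i" "u (i + 1) = i + 1"
        using aperm_shift_mult[OF u(1), of a k] aperm_shift_mult[OF u(1), of "a + 1" k] u k
        by (simp_all add: algebra_simps)
      then show ?thesis using 1 dvd_diff_one[OF 1] by (simp add: refl_def algebra_simps)
    next
      case 2
      then obtain k where k: "i = a + 1 + N * k" by (metis dvd_shiftE)
      have "u i = i" "u (i - 1) = i - 1"
        using aperm_shift_mult[OF u(1), of a k] aperm_shift_mult[OF u(1), of "a + 1" k] u k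
        by (simp_all add: algebra_simps)
      then show ?thesis using 2 by (simp add: refl_def algebra_simps)
    next
      case 3
      then show ?thesis by (simp add: refl_def algebra_simps)
    qed
  qed
  then have "moved (u \<circ> refl a) = moved u + (\<Sum>i=1..N. of_bool (N dvd i - a)) + (\<Sum>i=1..N. of_bool (N dvd i - (a + 1)))"
    by (simp add: moved_def sum.distrib)
  then show ?thesis by (simp only: sum_class)
qed

lemma cyc_comp_refl_fixed:
  assumes "u \<in> aperm" "u a = a" "u (a + 1) = a + 1"
  shows "cyc (u \<circ> refl a) = cyc u + 1"
  using moved_comp_refl[OF assms] by (simp add: cyc_def)

lemma cyc_comp_refl_swapped:
  assumes "u \<in> aperm" "u a = a + 1" "u (a + 1) = a"
  shows "cyc u = cyc (u \<circ> refl a) + 1"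
  using cyc_comp_refl_fixed[of "u \<circ> refl a" a] assms by (simp add: comp_aperm comp_assoc)

lemma conj_refl:
  assumes d: "d \<in> aperm" "d \<circ> d = id" "d (i + 1) = d i + 1"
  shows "d \<circ> refl i \<circ> d = refl (d i)"
proof
  fix x
  note dd = involution_simp[OF d(2)]
  have e1: "N dvd d x - i \<longleftrightarrow> N dvd x - d i" using aperm_dvd_diff[OF d(1), of x "d i"] by (simp add: dd)
  have e2: "N dvd d x - i - 1 \<longleftrightarrow> N dvd x - d i - 1"
    using aperm_dvd_diff[OF d(1), of x "d (i + 1)", unfolded dd] unfolding d(3) diff_diff_eq .
  have "d (d x + 1) = x + 1" if c: "N dvd d x - i"
  proof -
    obtain k where k: "d x = i + N * k" using c by (rule dvd_shiftE)
    have "x = d i + N * k" using dd[of x] by (simp add: k aperm_shift_mult d(1))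
    moreover have "d (d x + 1) = d (i + 1) + N * k"
      using aperm_shift_mult[OF d(1), of "i + 1" k] by (simp add: k algebra_simps)
    ultimately show ?thesis by (simp add: d(3))
  qed
  moreover have "d (d x - 1) = x - 1" if c: "N dvd d x - i - 1"
  proof -
    have "N dvd d x - (i + 1)" using c by (simp add: algebra_simps)
    then obtain k where k: "d x = i + 1 + N * k" by (rule dvd_shiftE)
    have "x = d i + 1 + N * k"
      using dd[of x] aperm_shift_mult[OF d(1), of "i + 1" k] by (simp add: k d(3))
    moreover have "d (d x - 1) = d i + N * k" by (simp add: k aperm_shift_mult d(1))
    ultimately show ?thesis by simp
  qed
  ultimately show "(d \<circ> refl i \<circ> d) x = refl (d i) x"
    using e1 e2 by (simp add: refl_def dd)
qed

text \<open>An involution swapping a and a + 1 commutes with \<open>refl a\<close>, and a product of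
  commuting involutions is an involution.\<close>

lemma commute_refl_swapped:
  assumes u: "u \<in> aperm" "u \<circ> u = id" "u a = a + 1"
  shows "(u \<circ> refl a) \<circ> (u \<circ> refl a) = id"
proof
  fix x
  note uu = involution_simp[OF u(2)]
  have ua: "u (a + 1) = a" using uu[of a] u(3) by simp
  have e1: "N dvd u x - a \<longleftrightarrow> N dvd x - a - 1" using aperm_dvd_diff[OF u(1), of x "a + 1"] unfolding ua diff_diff_eq .
  have e2: "N dvd u x - a - 1 \<longleftrightarrow> N dvd x - a" using aperm_dvd_diff[OF u(1), of x a] unfolding u(3) diff_diff_eq .
  have c: "u (refl a (u x)) = refl a x"
  proof (cases "N dvd x - a")
    case True
    then obtain k where k: "x = a + N * k" by (rule dvd_shiftE)
    then have ux: "u x = a + 1 + N * k" "u (a + N * k) = a + 1 + N * k"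
      using u by (simp_all add: aperm_shift_mult)
    then have "refl a (u x) = u x - 1" using True dvd_diff_one(1)[OF True] e1 e2 by (simp add: refl_def)
    then show ?thesis using True ux k by (simp add: refl_def)
  next
    case False
    show ?thesis
    proof (cases "N dvd x - a - 1")
      case True
      then have "N dvd x - (a + 1)" by (simp add: algebra_simps)
      then obtain k where k: "x = a + 1 + N * k" by (rule dvd_shiftE)
      then have ux: "u x = a + N * k" "u (a + 1 + N * k) = a + N * k"
        using aperm_shift_mult[OF u(1), of "a + 1" k] by (simp_all add: ua)
      then have "refl a (u x) = u x + 1" by (simp add: refl_def)
      then show ?thesis using True False ux k by (simp add: refl_def algebra_simps)
    next
      case 2: False
      then show ?thesis using False e1 e2 by (simp add: refl_def uu)
    qed
  qed
  then have "u (refl a (u (refl a x))) = x" using c uu refl_refl by metis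
  then show "((u \<circ> refl a) \<circ> (u \<circ> refl a)) x = id x" by simp
qed

text \<open>A product of two involutions is an involution only if they commute, so u preserves the
  pair a, a + 1 up to a multiple of N, and that multiple vanishes. The condition of
  \<open>abs_length\<close> relating f (w s) to f w concerns exactly these two cases.\<close>

lemma comp_refl_involution_cases:
  assumes u: "u \<in> aperm" "u \<circ> u = id" and us: "(u \<circ> refl a) \<circ> (u \<circ> refl a) = id"
  shows "u a = a \<and> u (a + 1) = a + 1 \<or> u a = a + 1 \<and> u (a + 1) = a"
proof -
  note uu = involution_simp[OF u(2)]
  have "u (refl a (u a)) = a + 1" using involution_simp[OF us, of "a + 1"] by simp
  then have k: "refl a (u a) = u (a + 1)" using uu by metis
  have ne: "u (a + 1) \<noteq> u a" using aperm_inj[OF u(1)] by simp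
  show ?thesis
  proof (cases "N dvd u a - a")
    case True
    then have "u a = a" using involution_fix[OF u] by simp
    with k show ?thesis by simp
  next
    case False
    then have d: "N dvd u a - (a + 1)" using k ne by (auto simp: refl_def algebra_simps split: if_splits)
    then obtain l where l: "u a = a + 1 + N * l" by (rule dvd_shiftE)
    have k2: "u (a + 1) = a + N * l" using k l False d by (simp add: refl_def algebra_simps)
    have "u (u a) = u (a + 1) + N * l" by (subst l) (rule aperm_shift_mult[OF u(1)])
    then have "N * l = 0" using uu[of a] k2 by simp
    then show ?thesis using l k2 by simp
  qed
qed

lemma alen_refl_comp_down:
  assumes "w \<in> aperm" "finv w (a + 1) < finv w a" shows "alen w = alen (refl a \<circ> w) + 1"
proof -
  have "alen w = alen (finv w)" using assms by (simp add: alen_inv)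
  also have "\<dots> = alen (finv w \<circ> refl a) + 1" using assms by (intro alen_comp_refl_down) (simp_all add: inv_aperm)
  also have "finv w \<circ> refl a = finv (refl a \<circ> w)" using assms by (simp add: inv_comp)
  also have "alen \<dots> = alen (refl a \<circ> w)" using assms by (simp add: alen_inv comp_aperm)
  finally show ?thesis .
qed

text \<open>Under this condition conjugation by the involution \<open>d\<close> permutes the generators indexed
  by \<open>K\<close>, sending the one with index \<open>i\<close> to the one with index \<open>d i\<close>.\<close>

definition adm :: "int set \<Rightarrow> (int \<Rightarrow> int) \<Rightarrow> bool" where
  "adm K d \<longleftrightarrow> periodic K \<and> d \<in> aperm \<and> d \<circ> d = id \<and> (\<forall>i\<in>K. d (i + 1) = d i + 1 \<and> d i \<in> K)"

text \<open>The condition says that the inverse of y is d y d, in a form that exhibits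
  \<open>y \<circ> d\<close> as an ordinary involution; \<open>twisted_invols_WG\<close> proves the
  agreement with \<open>twisted_invols\<close>.\<close>

definition twisted :: "int set \<Rightarrow> (int \<Rightarrow> int) \<Rightarrow> (int \<Rightarrow> int) set" where
  "twisted K d = {y \<in> parab K. (y \<circ> d) \<circ> (y \<circ> d) = id}"

text \<open>A cut at some m outside K between y i and y (i + 1) would separate i from i + 1, so m
  would be i, which lies in K.\<close>

lemma parab_block:
  assumes "y \<in> parab K" "i \<in> K"
  shows "{y i..<y (i + 1)} \<subseteq> K" "{y (i + 1)..<y i} \<subseteq> K"
proof -
  have "m \<in> K" if "y i \<le> m \<and> m < y (i + 1) \<or> y (i + 1) \<le> m \<and> m < y i" for m
  proof (rule ccontr)
    assume m: "m \<notin> K"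
    then have "m \<noteq> i" using assms(2) by blast
    with that parab_le[OF assms(1) m, of i] parab_le[OF assms(1) m, of "i + 1"] show False by linarith
  qed
  then show "{y i..<y (i + 1)} \<subseteq> K" "{y (i + 1)..<y i} \<subseteq> K" by auto
qed

lemma adm_translation:
  assumes "adm K d" "x \<le> x'" "{x..<x'} \<subseteq> K"
  shows "d x' = d x + (x' - x)"
  using assms(2,3)
proof (induction x' rule: int_ge_induct)
  case (step i)
  then have "i \<in> K" "{x..<i} \<subseteq> K" by auto
  with step assms(1) show ?case by (simp add: adm_def)
qed simp

text \<open>By \<open>parab_block\<close> all indices between the two images lie in K, and there d
  is a translation.\<close>

lemma adm_diff:
  assumes "adm K d" "y \<in> parab K" "i \<in> K"
  shows "d (y (i + 1)) - d (y i) = y (i + 1) - y i"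
  using parab_block[OF assms(2,3)] adm_translation[OF assms(1), of "y i" "y (i + 1)"]
    adm_translation[OF assms(1), of "y (i + 1)" "y i"] by linarith

context
  fixes K d
  assumes adm: "adm K d"
begin

lemma adm_simps:
  shows "periodic K" "d \<in> aperm" "d \<circ> d = id" "i \<in> K \<Longrightarrow> d (i + 1) = d i + 1" "i \<in> K \<Longrightarrow> d i \<in> K"
    "d (d x) = x"
  using adm involution_simp[of d] by (auto simp: adm_def)

lemma adm_conj: "i \<in> K \<Longrightarrow> d \<circ> refl i \<circ> d = refl (d i)"
  by (intro conj_refl) (simp_all add: adm_simps)

lemma adm_conj': assumes "i \<in> K" shows "refl i \<circ> d = d \<circ> refl (d i)" "d \<circ> refl i = refl (d i) \<circ> d"
  using adm_conj[OF assms] by (auto simp: fun_eq_iff adm_simps(6)) (metis adm_simps(6))+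

lemma twisted_parab: "y \<in> twisted K d \<Longrightarrow> y \<in> parab K"
  by (simp add: twisted_def)

lemma twisted_aperm: "y \<in> twisted K d \<Longrightarrow> y \<in> aperm"
  using twisted_parab parab_aperm by blast

lemma twisted_involution: assumes "y \<in> twisted K d" shows "y \<circ> d \<in> aperm" "(y \<circ> d) \<circ> (y \<circ> d) = id"
  using assms by (auto simp: twisted_def comp_aperm parab_aperm adm_simps)

lemma id_twisted: "id \<in> twisted K d"
  by (simp add: twisted_def adm_simps)

lemma finv_twisted: assumes "y \<in> twisted K d" shows "finv y = d \<circ> y \<circ> d"
proof (rule inv_unique_comp)
  have e: "y (d (y (d x))) = x" for x
    using involution_simp[OF twisted_involution(2)[OF assms], of x] by simp
  then show "y \<circ> (d \<circ> y \<circ> d) = id" by (simp add: fun_eq_iff)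
  have "d (y (d (y x))) = x" for x
    using e[of "d x"] by (metis adm_simps(6))
  then show "(d \<circ> y \<circ> d) \<circ> y = id" by (simp add: fun_eq_iff)
qed

text \<open>Since d turns \<open>refl i\<close> into \<open>refl (d i)\<close>, twisted conjugation
  of y becomes ordinary conjugation of \<open>y \<circ> d\<close>.\<close>

lemma twisted_conj:
  assumes "y \<in> twisted K d" "i \<in> K"
  shows "refl (d i) \<circ> y \<circ> refl i \<in> twisted K d"
    and "(refl (d i) \<circ> y \<circ> refl i) \<circ> d = refl (d i) \<circ> (y \<circ> d) \<circ> refl (d i)"
proof -
  show e: "(refl (d i) \<circ> y \<circ> refl i) \<circ> d = refl (d i) \<circ> (y \<circ> d) \<circ> refl (d i)"
    using adm_conj'(1)[OF assms(2)] by (simp add: comp_assoc)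
  have "refl (d i) \<circ> y \<circ> refl i \<in> parab K"
    using assms by (intro parab_comp parab_refl) (simp_all add: adm_simps twisted_parab)
  moreover have "(refl (d i) \<circ> y \<circ> refl i \<circ> d) \<circ> (refl (d i) \<circ> y \<circ> refl i \<circ> d) = id"
    unfolding e by (rule conj_involution[OF twisted_involution(2)[OF assms(1)]])
  ultimately show "refl (d i) \<circ> y \<circ> refl i \<in> twisted K d" by (simp add: twisted_def)
qed

lemma comp_refl_d: "i \<in> K \<Longrightarrow> (y \<circ> refl i) \<circ> d = (y \<circ> d) \<circ> refl (d i)"
  using adm_conj'(1) by (simp add: comp_assoc)

lemma comp_d_at: assumes "i \<in> K" shows "(y \<circ> d) (d i) = y i" "(y \<circ> d) (d i + 1) = y (i + 1)"
  using adm_simps(4)[OF assms] adm_simps(6)[of i] adm_simps(6)[of "i + 1"] by simp_all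

text \<open>The hypothesis means that \<open>y \<circ> d\<close> swaps d i and d i + 1. It commutes
  with that generator, so one-sided multiplication already gives a shorter twisted
  involution.\<close>

lemma twisted_reduce_swap:
  assumes y: "y \<in> twisted K d" and i: "i \<in> K" "y i = d i + 1"
  shows "y \<circ> refl i \<in> twisted K d" "alen y = alen (y \<circ> refl i) + 1"
    "alen (y \<circ> d) = alen (y \<circ> refl i \<circ> d) + 1" "cyc (y \<circ> d) = cyc (y \<circ> refl i \<circ> d) + 1"
proof -
  define u where "u = y \<circ> d"
  define j where "j = d i"
  have u: "u \<in> aperm" "u \<circ> u = id" using twisted_involution[OF y] by (simp_all add: u_def)
  have uj: "u j = y i" "u (j + 1) = y (i + 1)" unfolding u_def j_def using comp_d_at[OF i(1)] by simp_all
  then have sw: "u j = j + 1" using i by (simp add: j_def)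
  then have sw': "u (j + 1) = j" using involution_simp[OF u(2), of j] by simp
  have e: "y \<circ> refl i \<circ> d = u \<circ> refl j" using comp_refl_d[OF i(1)] by (simp add: u_def j_def)
  have "y \<circ> refl i \<in> parab K" using y i by (simp add: parab_comp parab_refl twisted_parab adm_simps)
  then show "y \<circ> refl i \<in> twisted K d"
    using commute_refl_swapped[OF u sw] e by (simp add: twisted_def)
  show "alen y = alen (y \<circ> refl i) + 1"
    by (rule alen_comp_refl_down) (use y uj sw sw' in \<open>auto simp: twisted_aperm\<close>)
  show "alen (y \<circ> d) = alen (y \<circ> refl i \<circ> d) + 1"
    unfolding e u_def[symmetric] by (rule alen_comp_refl_down) (use u sw sw' in auto)
  show "cyc (y \<circ> d) = cyc (y \<circ> refl i \<circ> d) + 1"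
    unfolding e u_def[symmetric] by (rule cyc_comp_refl_swapped[OF u(1) sw sw'])
qed

text \<open>A descent of the other kind is removed by twisted conjugation. For
  \<open>y \<circ> d\<close> this is \<open>alen_conj_down\<close>; for y itself the second drop is
  computed from \<open>finv y\<close> = d y d.\<close>

lemma twisted_reduce_conj:
  assumes y: "y \<in> twisted K d" and i: "i \<in> K" "y (i + 1) < y i" "y i \<noteq> d i + 1"
  defines "y' \<equiv> refl (d i) \<circ> y \<circ> refl i"
  shows "y' \<in> twisted K d" "alen y = alen y' + 2" "alen (y \<circ> d) = alen (y' \<circ> d) + 2" "cyc (y \<circ> d) = cyc (y' \<circ> d)"
proof -
  define u where "u = y \<circ> d"
  define j where "j = d i"
  have u: "u \<in> aperm" "u \<circ> u = id" using twisted_involution[OF y] by (simp_all add: u_def)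
  have uj: "u j = y i" "u (j + 1) = y (i + 1)" unfolding u_def j_def using comp_d_at[OF i(1)] by simp_all
  show "y' \<in> twisted K d" unfolding y'_def by (rule twisted_conj[OF y i(1)])
  have e: "y' \<circ> d = refl j \<circ> u \<circ> refl j" unfolding y'_def u_def j_def by (rule twisted_conj[OF y i(1)])
  show "alen (y \<circ> d) = alen (y' \<circ> d) + 2"
    unfolding e u_def[symmetric] by (rule alen_conj_down[OF u]) (use i uj in \<open>auto simp: j_def\<close>)
  show "cyc (y \<circ> d) = cyc (y' \<circ> d)"
    unfolding e u_def[symmetric] by (simp add: cyc_conj_refl u)
  have ya: "y \<in> aperm" using y by (rule twisted_aperm)
  have 1: "alen y = alen (y \<circ> refl i) + 1" by (rule alen_comp_refl_down[OF ya i(2)])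
  have fy: "finv y j = d (y i)" "finv y (j + 1) = d (y (i + 1))"
    using finv_twisted[OF y] uj by (simp_all add: u_def)
  have df: "d (y (i + 1)) - d (y i) = y (i + 1) - y i"
    by (rule adm_diff[OF adm twisted_parab[OF y] i(1)])
  have "refl i (d (y (i + 1))) < refl i (d (y i))"
  proof (rule refl_less)
    show "d (y (i + 1)) < d (y i)" using df i by simp
    show "\<not> (d (y i) = d (y (i + 1)) + 1 \<and> N dvd d (y (i + 1)) - i)"
    proof
      assume h: "d (y i) = d (y (i + 1)) + 1 \<and> N dvd d (y (i + 1)) - i"
      then obtain k where k: "d (y (i + 1)) = i + N * k" using dvd_shiftE by blast
      have "y (i + 1) = d (i + N * k)" using k adm_simps(6) by metis
      then have y1: "y (i + 1) = j + N * k" by (simp add: aperm_shift_mult adm_simps j_def)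
      have y0: "y i = j + 1 + N * k" using h df y1 by simp
      \<comment> \<open>Here u would exchange j and j + 1 up to N k; as u is an involution, k is 0
        and y i = d i + 1 after all.\<close>
      have "u (u (j + 1)) = u j + N * k" unfolding uj(2) y1 by (rule aperm_shift_mult[OF u(1)])
      then have "N * k = 0" using involution_simp[OF u(2), of "j + 1"] uj(1) y0 by simp
      then show False using y0 i(3) by (simp add: j_def)
    qed
  qed
  then have "alen (y \<circ> refl i) = alen (refl j \<circ> (y \<circ> refl i)) + 1"
    by (intro alen_refl_comp_down) (simp_all add: comp_aperm ya inv_comp fy)
  then show "alen y = alen y' + 2" using 1 by (simp add: y'_def j_def comp_assoc)
qed

text \<open>Every descent of y in K falls under one of the two reductions. The same scheme shows
  that the conditions in \<open>abs_length\<close> have only one solution.\<close>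

lemma twisted_induct [consumes 1, case_names id swap conj]:
  assumes "y \<in> twisted K d" and "P id"
    and swap: "\<And>y i. y \<in> twisted K d \<Longrightarrow> i \<in> K \<Longrightarrow> y i = d i + 1 \<Longrightarrow> y \<circ> refl i \<in> twisted K d \<Longrightarrow>
      P (y \<circ> refl i) \<Longrightarrow> P y"
    and conj: "\<And>y i. y \<in> twisted K d \<Longrightarrow> i \<in> K \<Longrightarrow> y (i + 1) < y i \<Longrightarrow> y i \<noteq> d i + 1 \<Longrightarrow>
      refl (d i) \<circ> y \<circ> refl i \<in> twisted K d \<Longrightarrow> P (refl (d i) \<circ> y \<circ> refl i) \<Longrightarrow> P y"
  shows "P y"
  using assms(1)
proof (induction "alen y" arbitrary: y rule: less_induct)
  case less
  show ?case
  proof (cases "y = id")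
    case False
    then obtain i where i: "i \<in> K" "y (i + 1) < y i"
      using parab_descent[OF twisted_parab[OF less.prems]] by blast
    show ?thesis
    proof (cases "y i = d i + 1")
      case True
      note r = twisted_reduce_swap[OF less.prems i(1) True]
      show ?thesis by (rule swap[OF less.prems i(1) True r(1) less.hyps[OF _ r(1)]]) (simp add: r(2))
    next
      case False
      note r = twisted_reduce_conj[OF less.prems i False]
      show ?thesis by (rule conj[OF less.prems i False r(1) less.hyps[OF _ r(1)]]) (simp add: r(2))
    qed
  qed (use assms(2) in simp)
qed

text \<open>Both reductions lower \<open>alen y\<close> and \<open>alen (y \<circ> d)\<close> by the
  same amount, so their difference is the one for y = id.\<close>

lemma twisted_alen: assumes "y \<in> twisted K d" shows "alen (y \<circ> d) = alen y + alen d"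
  using assms
proof (induction rule: twisted_induct)
  case (swap y i)
  then have "alen (y \<circ> refl i \<circ> d) = alen (y \<circ> refl i) + alen d" by blast
  with twisted_reduce_swap(2,3)[OF swap.hyps(1-3)] show "alen (y \<circ> d) = alen y + alen d" by linarith
next
  case (conj y i)
  then have "alen (refl (d i) \<circ> y \<circ> refl i \<circ> d) = alen (refl (d i) \<circ> y \<circ> refl i) + alen d" by blast
  with twisted_reduce_conj(2,3)[OF conj.hyps(1-4)] show "alen (y \<circ> d) = alen y + alen d" by linarith
next
  case id
  show "alen (id \<circ> d) = alen id + alen d" by simp
qed

text \<open>Guarantees that the subtraction of natural numbers in
  \<open>cyc (y \<circ> d) - cyc d\<close> does not truncate.\<close>

lemma twisted_cyc: assumes "y \<in> twisted K d" shows "cyc d \<le> cyc (y \<circ> d)"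
  using assms
proof (induction rule: twisted_induct)
  case (swap y i)
  then have "cyc d \<le> cyc (y \<circ> refl i \<circ> d)" by blast
  with twisted_reduce_swap(4)[OF swap.hyps(1-3)] show "cyc d \<le> cyc (y \<circ> d)" by linarith
next
  case (conj y i)
  then have "cyc d \<le> cyc (refl (d i) \<circ> y \<circ> refl i \<circ> d)" by blast
  with twisted_reduce_conj(4)[OF conj.hyps(1-4)] show "cyc d \<le> cyc (y \<circ> d)" by linarith
qed simp

lemma twisted_invols_WG: "twisted_invols (WG K) (\<lambda>x. d \<circ> x \<circ> d) = twisted K d"
proof -
  have "(w \<circ> d) \<circ> (w \<circ> d) = id" if "w \<in> parab K" "finv w = d \<circ> w \<circ> d" for w
  proof -
    have "w (finv w x) = x" for x using that(1) parab_aperm inv_aperm_simps by blast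
    then show ?thesis by (simp add: that(2) fun_eq_iff)
  qed
  then show ?thesis
    by (auto simp: twisted_invols_def m_inv_WG adm_simps twisted_parab finv_twisted) (auto simp: twisted_def)
qed

text \<open>Twisted conjugation becomes conjugation of \<open>y \<circ> d\<close>, which preserves
  \<open>cyc\<close>. If w and w s are both twisted involutions,
  \<open>comp_refl_involution_cases\<close> leaves two cases, in which \<open>alen\<close> and
  \<open>cyc\<close> both grow or both drop by one.\<close>

lemma abs_length_WG:
  assumes y: "y \<in> twisted K d"
  shows "abs_length (WG K) (refl ` K) (\<lambda>x. d \<circ> x \<circ> d) y = cyc (y \<circ> d) - cyc d"
proof -
  define F where "F = restrict (\<lambda>y. cyc (y \<circ> d) - cyc d) (twisted K d)"
  have "abs_length (WG K) (refl ` K) (\<lambda>x. d \<circ> x \<circ> d) = F"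
    unfolding abs_length_def twisted_invols_WG
  proof (rule the_equality)
    have conj: "F (refl i \<circ> w \<circ> (d \<circ> refl i \<circ> d)) = F w" if "w \<in> twisted K d" "i \<in> K" for w i
    proof -
      have di: "d i \<in> K" using that adm_simps by simp
      have "refl i \<circ> w \<circ> (d \<circ> refl i \<circ> d) = refl (d (d i)) \<circ> w \<circ> refl (d i)"
        using that adm_conj adm_simps by simp
      then show ?thesis
        using twisted_conj[OF that(1) di] twisted_involution(1)[OF that(1)] that
        by (simp add: F_def cyc_conj_refl)
    qed
    have step: "int (F (w \<circ> refl i)) - int (F w) = int (alen (w \<circ> refl i)) - int (alen w)"
      if w: "w \<in> twisted K d" "w \<circ> refl i \<in> twisted K d" and i: "i \<in> K" for w i
    proof -
      define u where "u = w \<circ> d"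
      define j where "j = d i"
      have u: "u \<in> aperm" "u \<circ> u = id" using twisted_involution[OF w(1)] by (simp_all add: u_def)
      have us: "w \<circ> refl i \<circ> d = u \<circ> refl j" using comp_refl_d[OF i] by (simp add: u_def j_def)
      have "(u \<circ> refl j) \<circ> (u \<circ> refl j) = id" using twisted_involution(2)[OF w(2)] us by simp
      note c = comp_refl_involution_cases[OF u this]
      have uj: "u j = w i" "u (j + 1) = w (i + 1)" unfolding u_def j_def using comp_d_at[OF i] by simp_all
      have le: "cyc d \<le> cyc u" "cyc d \<le> cyc (u \<circ> refl j)"
        using twisted_cyc[OF w(1)] twisted_cyc[OF w(2)] us by (simp_all add: u_def)
      have F: "F w = cyc u - cyc d" "F (w \<circ> refl i) = cyc (u \<circ> refl j) - cyc d"
        using w us by (simp_all add: F_def u_def)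
      show ?thesis
        using c
      proof
        assume c: "u j = j \<and> u (j + 1) = j + 1"
        then have "cyc (u \<circ> refl j) = cyc u + 1" using cyc_comp_refl_fixed u(1) by blast
        moreover have "alen (w \<circ> refl i) = alen w + 1"
          using alen_comp_refl_up[OF twisted_aperm[OF w(1)], of i] uj c by simp
        ultimately show ?thesis using le F by simp
      next
        assume c: "u j = j + 1 \<and> u (j + 1) = j"
        then have "cyc u = cyc (u \<circ> refl j) + 1" using cyc_comp_refl_swapped u(1) by blast
        moreover have "alen w = alen (w \<circ> refl i) + 1"
          using alen_comp_refl_down[OF twisted_aperm[OF w(1)], of i] uj c by simp
        ultimately show ?thesis using le F by simp
      qed
    qed
    have len: "cox_length (WG K) (refl ` K) w = alen w" if "w \<in> twisted K d" for w
      using cox_length_WG twisted_parab[OF that] adm_simps by blast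
    show "F \<in> extensional (twisted K d) \<and> F \<one>\<^bsub>WG K\<^esub> = 0 \<and>
      (\<forall>w\<in>twisted K d. \<forall>s\<in>refl ` K. F (s \<otimes>\<^bsub>WG K\<^esub> w \<otimes>\<^bsub>WG K\<^esub> (d \<circ> s \<circ> d)) = F w) \<and>
      (\<forall>w\<in>twisted K d. \<forall>s\<in>refl ` K. w \<otimes>\<^bsub>WG K\<^esub> s \<in> twisted K d \<longrightarrow>
        int (F (w \<otimes>\<^bsub>WG K\<^esub> s)) - int (F w) =
        int (cox_length (WG K) (refl ` K) (w \<otimes>\<^bsub>WG K\<^esub> s)) - int (cox_length (WG K) (refl ` K) w))"
      using conj step len id_twisted by (auto simp: F_def)
    fix f :: "(int \<Rightarrow> int) \<Rightarrow> nat"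
    assume f: "f \<in> extensional (twisted K d) \<and> f \<one>\<^bsub>WG K\<^esub> = 0 \<and>
      (\<forall>w\<in>twisted K d. \<forall>s\<in>refl ` K. f (s \<otimes>\<^bsub>WG K\<^esub> w \<otimes>\<^bsub>WG K\<^esub> (d \<circ> s \<circ> d)) = f w) \<and>
      (\<forall>w\<in>twisted K d. \<forall>s\<in>refl ` K. w \<otimes>\<^bsub>WG K\<^esub> s \<in> twisted K d \<longrightarrow>
        int (f (w \<otimes>\<^bsub>WG K\<^esub> s)) - int (f w) =
        int (cox_length (WG K) (refl ` K) (w \<otimes>\<^bsub>WG K\<^esub> s)) - int (cox_length (WG K) (refl ` K) w))"
    have f1: "f id = 0" using f by simp
    have f2: "f (refl i \<circ> w \<circ> (d \<circ> refl i \<circ> d)) = f w" if "w \<in> twisted K d" "i \<in> K" for w i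
      using f that by simp
    have f3: "int (f (w \<circ> refl i)) - int (f w) = int (alen (w \<circ> refl i)) - int (alen w)"
      if "w \<in> twisted K d" "i \<in> K" "w \<circ> refl i \<in> twisted K d" for w i
      using f that len by simp
    \<comment> \<open>At each reduction one of the conditions determines f from its value at the
      shorter element.\<close>
    have "f y = F y" if "y \<in> twisted K d" for y
      using that
    proof (induction rule: twisted_induct)
      case id
      show "f id = F id" using f1 id_twisted by (simp add: F_def)
    next
      case (swap y i)
      have "f (y \<circ> refl i) = F (y \<circ> refl i)" using swap by blast
      with f3[OF swap.hyps(1,2,4)] step[OF swap.hyps(1,4,2)] show "f y = F y" by linarith
    next
      case (conj y i)
      have di: "d i \<in> K" using conj.hyps adm_simps by simp
      have e: "refl (d i) \<circ> y \<circ> (d \<circ> refl (d i) \<circ> d) = refl (d i) \<circ> y \<circ> refl i"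
        using adm_conj[OF di] adm_simps(6) by simp
      have "f (refl (d i) \<circ> y \<circ> refl i) = F (refl (d i) \<circ> y \<circ> refl i)" using conj by blast
      with f2[OF conj.hyps(1) di] conj.hyps(1) \<open>\<And>i w. w \<in> twisted K d \<Longrightarrow> i \<in> K \<Longrightarrow> F (refl i \<circ> w \<circ> (d \<circ> refl i \<circ> d)) = F w\<close>[OF conj.hyps(1) di]
      show "f y = F y" unfolding e by simp
    qed
    then show "f = F"
      using f by (intro extensionalityI[of f "twisted K d" F]) (auto simp: F_def)
  qed
  then show ?thesis using y by (simp add: F_def)
qed

end

subsection \<open>Double cosets of the finite symmetric group\<close>

text \<open>Numbers the periods so that \<open>{1..N}\<close> is period 0, i.e. win i = k for N k <
  i \<le> N (k + 1). The elements of \<open>parab J\<close> are those that preserve it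
  (\<open>parab_J\<close>).\<close>

definition win :: "int \<Rightarrow> int" where "win i = (i - 1) div N"

lemma win_shift: "win (i + N * k) = win i + k"
proof -
  have "(i + N * k - 1) div N = (i - 1 + k * N) div N" by (simp add: algebra_simps)
  then show ?thesis by (simp add: win_def)
qed

lemma win_le: "win i \<le> k \<longleftrightarrow> i \<le> N * (k + 1)"
proof -
  define r where "r = (i - 1) mod N"
  have i: "i = N * win i + r + 1" by (simp add: win_def r_def)
  have r: "0 \<le> r" "r < N" by (simp_all add: r_def)
  show ?thesis
  proof
    assume "win i \<le> k"
    then have "N * win i \<le> N * k" by (intro mult_left_mono) simp_all
    with i r have "i \<le> N * k + N" by linarith
    then show "i \<le> N * (k + 1)" by (simp add: distrib_left)
  next
    assume le: "i \<le> N * (k + 1)"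
    show "win i \<le> k"
    proof (rule ccontr)
      assume "\<not> win i \<le> k"
      then have "N * (k + 1) \<le> N * win i" by (intro mult_left_mono) simp_all
      with le i r show False by linarith
    qed
  qed
qed

lemma win_mono: "i \<le> j \<Longrightarrow> win i \<le> win j"
  using win_le[of i "win j"] win_le[of j "win j"] by simp

lemma win_1N: "win i = 0 \<longleftrightarrow> i \<in> {1..N}"
  using win_le[of i 0] win_le[of i "-1"] by auto

lemma win_J: "i \<in> J \<longleftrightarrow> win (i + 1) = win i"
proof
  assume "i \<in> J"
  then have nd: "\<not> N dvd i" by (simp add: J_def)
  have "win (i + 1) \<le> win i"
  proof -
    have "i \<le> N * (win i + 1)" using win_le[of i "win i"] by simp
    moreover have "i \<noteq> N * (win i + 1)" using nd by (metis dvd_triv_left)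
    ultimately show ?thesis using win_le[of "i + 1" "win i"] by simp
  qed
  then show "win (i + 1) = win i" using win_mono[of i "i + 1"] by simp
next
  assume e: "win (i + 1) = win i"
  show "i \<in> J"
  proof (rule ccontr)
    assume "i \<notin> J"
    then obtain k where "i = N * k" by (auto simp: J_def)
    then have "win i \<le> k - 1" "\<not> win (i + 1) \<le> k - 1"
      using win_le[of i "k - 1"] win_le[of "i + 1" "k - 1"] by simp_all
    with e show False by simp
  qed
qed

lemma win_eq_J: assumes "win x = win y" shows "{x..<y} \<subseteq> J"
proof
  fix m assume "m \<in> {x..<y}"
  then have "win x \<le> win m" "win m \<le> win (m + 1)" "win (m + 1) \<le> win y"
    by (auto intro: win_mono)
  with assms show "m \<in> J" unfolding win_J by simp
qed

lemma win_aperm_shift: "w \<in> aperm \<Longrightarrow> win (w (i + N * k)) = win (w i) + k"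
  by (simp add: aperm_shift_mult win_shift)

lemma parab_J: "x \<in> parab J \<longleftrightarrow> x \<in> aperm \<and> (\<forall>i. win (x i) = win i)"
proof safe
  assume x: "x \<in> parab J"
  then show "x \<in> aperm" by (rule parab_aperm)
  fix i
  have "win (x i) \<le> k \<longleftrightarrow> win i \<le> k" for k
    unfolding win_le by (rule parab_le[OF x]) (simp add: J_def)
  then show "win (x i) = win i" by (meson order_antisym order_refl)
next
  assume x: "x \<in> aperm" "\<forall>i. win (x i) = win i"
  have "x j \<le> i \<longleftrightarrow> j \<le> i" if "i \<notin> J" for i j
  proof -
    have "N dvd i" using that by (simp add: J_def)
    then obtain k where k: "i = N * k" by (rule dvdE)
    have "win j \<le> k - 1 \<longleftrightarrow> j \<le> i" for j using win_le[of j "k - 1"] k by simp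
    then show ?thesis using x(2) by metis
  qed
  with x show "x \<in> parab J" by (simp add: parab_def)
qed

lemma chain_le:
  fixes f :: "int \<Rightarrow> int"
  assumes "x \<le> y" "\<And>i. x \<le> i \<Longrightarrow> i < y \<Longrightarrow> f i \<le> f (i + 1)" shows "f x \<le> f y"
  using assms
proof (induction y rule: int_ge_induct)
  case (step i)
  have "f x \<le> f i" using step by simp
  also have "f i \<le> f (i + 1)" using step by simp
  finally show ?case .
qed simp

lemma chain_less:
  fixes f :: "int \<Rightarrow> int"
  assumes "x < y" "\<And>i. x \<le> i \<Longrightarrow> i < y \<Longrightarrow> f i < f (i + 1)" shows "f x < f y"
proof -
  have "f x + (y - x) \<le> f y"
    using chain_le[of x y "\<lambda>i. f i - i"] assms by (force simp: algebra_simps)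
  with assms(1) show ?thesis by simp
qed

text \<open>For a minimal representative d these are the indices of K = J \<inter> d J d
  (\<open>stab_generators\<close>). Defined through periods, the set depends on u only via
  \<open>win\<close>, so it is the same for u = y d and for d.\<close>

definition stab :: "(int \<Rightarrow> int) \<Rightarrow> int set" where
  "stab u = {i \<in> J. win (u i) = win (u (i + 1))}"

definition invol_reps :: "(int \<Rightarrow> int) set" where
  "invol_reps = {d \<in> aperm. d \<circ> d = id \<and> (\<forall>i\<in>J. d i < d (i + 1))}"

text \<open>The intermediate stage u = y d between an involution and its representative d: here the
  periods of the images are sorted, not the images themselves.\<close>

definition sorted_invols :: "(int \<Rightarrow> int) set" where
  "sorted_invols = {u \<in> aperm. u \<circ> u = id \<and> (\<forall>i\<in>J. win (u i) \<le> win (u (i + 1)))}"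

definition coset_reps :: "int set \<Rightarrow> (int \<Rightarrow> int) set" where
  "coset_reps K = {x \<in> parab J. \<forall>i\<in>K. x i < x (i + 1)}"

lemma stab_J: "stab u \<subseteq> J"
  by (auto simp: stab_def)

lemma drepsD:
  assumes "d \<in> invol_reps"
  shows "d \<in> aperm" "d \<circ> d = id" "d (d x) = x" "i \<in> J \<Longrightarrow> d i < d (i + 1)"
  using assms involution_simp[of d] by (auto simp: invol_reps_def)

lemma invol_reps_less: assumes "d \<in> invol_reps" "x < y" "win x = win y" shows "d x < d y"
  using assms win_eq_J[OF assms(3)] by (intro chain_less[of x y d]) (auto simp: drepsD)

lemma sorted_invols_le: assumes "u \<in> sorted_invols" "x \<le> y" "win x = win y" shows "win (u x) \<le> win (u y)"
  using assms(2) win_eq_J[OF assms(3)] assms(1)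
  by (intro chain_le[of x y "\<lambda>i. win (u i)"]) (auto simp: sorted_invols_def)

lemma periodic_stab: assumes "u \<in> aperm" shows "periodic (stab u)"
proof -
  have "win (u (i + N)) = win (u i) + 1" for i
    using win_aperm_shift[OF assms, of i 1] by simp
  from this[of "_ + 1"] this show ?thesis
    using periodic_J by (simp add: periodic_def stab_def algebra_simps)
qed

text \<open>A point strictly between d i and d (i + 1) would lie in their common period, and d,
  increasing on that period, would map it strictly between i and i + 1.\<close>

lemma adm_stab: assumes d: "d \<in> invol_reps" shows "adm (stab d) d"
proof -
  note dD = drepsD[OF d]
  have "d (i + 1) = d i + 1 \<and> d i \<in> stab d" if i: "i \<in> stab d" for i
  proof
    have iJ: "i \<in> J" and w: "win (d i) = win (d (i + 1))" using i by (auto simp: stab_def)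
    show e: "d (i + 1) = d i + 1"
    proof (rule ccontr)
      assume "d (i + 1) \<noteq> d i + 1"
      then have l: "d i < d i + 1" "d i + 1 < d (i + 1)" using dD(4)[OF iJ] by auto
      have "win (d i) \<le> win (d i + 1)" "win (d i + 1) \<le> win (d (i + 1))"
        using l by (auto intro: win_mono)
      then have "d (d i) < d (d i + 1)" "d (d i + 1) < d (d (i + 1))"
        using w by (auto intro!: invol_reps_less[OF d] l)
      then show False by (simp add: dD(3))
    qed
    have "d i \<in> J" unfolding win_J using w e by simp
    moreover have "win (d (d i)) = win (d (d i + 1))"
      using iJ unfolding e[symmetric] dD(3) win_J by simp
    ultimately show "d i \<in> stab d" by (simp add: stab_def)
  qed
  then show ?thesis using dD periodic_stab by (simp add: adm_def)
qed

text \<open>If d s_j d = s_i, then s_i exchanges d j and d (j + 1). As d j < d (j + 1), these are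
  consecutive and congruent to i and i + 1.\<close>

lemma stab_generators:
  assumes d: "d \<in> invol_reps"
  shows "refl ` J \<inter> (\<lambda>x. d \<circ> x \<circ> d) ` (refl ` J) = refl ` stab d"
proof
  note dD = drepsD[OF d]
  show "refl ` J \<inter> (\<lambda>x. d \<circ> x \<circ> d) ` (refl ` J) \<subseteq> refl ` stab d"
  proof
    fix s assume "s \<in> refl ` J \<inter> (\<lambda>x. d \<circ> x \<circ> d) ` (refl ` J)"
    then obtain i j where ij: "s = refl i" "s = d \<circ> refl j \<circ> d" "i \<in> J" "j \<in> J" by blast
    have e: "refl i (d j) = d (j + 1)"
    proof -
      have "refl i (d j) = (d \<circ> refl j \<circ> d) (d j)" using ij by simp
      also have "\<dots> = d (j + 1)" by (simp add: dD(3))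
      finally show ?thesis .
    qed
    moreover have "d j < d (j + 1)" using dD(4) ij by simp
    ultimately have dv: "N dvd d j - i" and dj: "d (j + 1) = d j + 1"
      by (auto simp: refl_def split: if_splits)
    have "d j \<in> J" using periodicD[OF periodic_J dv] ij by simp
    then have "win (d j) = win (d (j + 1))" unfolding dj win_J by simp
    then have "j \<in> stab d" using ij by (simp add: stab_def)
    then have "d j \<in> stab d" using adm_stab[OF d] by (simp add: adm_def)
    then show "s \<in> refl ` stab d" using refl_mod_cong[OF dv] ij(1) by (intro image_eqI[of _ _ "d j"]) auto
  qed
  show "refl ` stab d \<subseteq> refl ` J \<inter> (\<lambda>x. d \<circ> x \<circ> d) ` (refl ` J)"
  proof
    fix s assume "s \<in> refl ` stab d"
    then obtain i where i: "s = refl i" "i \<in> stab d" by auto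
    note a = adm_simps[OF adm_stab[OF d]]
    have "d i \<in> stab d" using i a by simp
    moreover have "d \<circ> refl (d i) \<circ> d = refl i"
      using adm_conj[OF adm_stab[OF d] a(5)[OF i(2)]] a(6) by simp
    ultimately show "s \<in> refl ` J \<inter> (\<lambda>x. d \<circ> x \<circ> d) ` (refl ` J)"
      using i stab_J by (auto intro!: rev_image_eqI[of "refl (d i)"])
  qed
qed

lemma involutions_min_coset_reps:
  "twisted_invols (affine_sym n) (\<lambda>x. x) \<inter> min_coset_reps (affine_sym n) (affine_gens n) (finite_gens n) = invol_reps"
proof -
  have len: "cox_length (affine_sym n) (affine_gens n) w = alen w" if "w \<in> aperm" for w
    unfolding affine_gens_eq
    by (rule cox_length_parab[of _ UNIV]) (use that in \<open>simp_all add: parab_UNIV periodic_UNIV\<close>)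
  have up: "alen w < alen (w \<circ> refl i) \<longleftrightarrow> w i < w (i + 1)" if "w \<in> aperm" for w i
    using aperm_cases[OF that, of i] alen_comp_refl_up[OF that, of i] alen_comp_refl_down[OF that, of i] by auto
  have "min_coset_reps (affine_sym n) (affine_gens n) (finite_gens n) = {w \<in> aperm. \<forall>i\<in>J. w i < w (i + 1)}"
    by (auto simp: min_coset_reps_def finite_gens_eq carrier_affine_sym len comp_aperm up)
  moreover have "twisted_invols (affine_sym n) (\<lambda>x. x) = {w \<in> aperm. w \<circ> w = id}"
    by (auto simp: twisted_invols_def carrier_affine_sym m_inv_affine involution_finv fun_eq_iff)
      (metis inv_aperm_simps(2))
  ultimately show ?thesis by (auto simp: invol_reps_def)
qed

section \<open>Decomposition of involutions along the double cosets\<close>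

lemma win_comp_refl:
  assumes u: "u \<in> aperm" and i: "win (u i) = win (u (i + 1))"
  shows "win (u (refl i x)) = win (u x)"
proof -
  have "win (u (x + 1)) = win (u x)" if "N dvd x - i"
  proof -
    obtain k where "x = i + N * k" using \<open>N dvd x - i\<close> by (rule dvd_shiftE)
    then show ?thesis using win_aperm_shift[OF u, of i k] win_aperm_shift[OF u, of "i + 1" k] i
      by (simp add: algebra_simps)
  qed
  moreover have "win (u (x - 1)) = win (u x)" if "N dvd x - i - 1"
  proof -
    have "N dvd x - (i + 1)" using that by (simp add: algebra_simps)
    then obtain k where "x = i + 1 + N * k" by (rule dvd_shiftE)
    then show ?thesis using win_aperm_shift[OF u, of i k] win_aperm_shift[OF u, of "i + 1" k] i
      by (simp add: algebra_simps)
  qed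
  ultimately show ?thesis by (simp add: refl_def)
qed

lemma win_refl: "i \<in> J \<Longrightarrow> win (refl i x) = win x"
  using win_comp_refl[of id i x] by (simp add: win_J)

text \<open>At a descent i in J of a sorted involution both images lie in one period. Removing it,
  by multiplication if u swaps i and i + 1 and by conjugation otherwise, preserves the period of
  every image; the removed generators accumulate in y.\<close>

lemma sorted_invols_decomp:
  assumes "u \<in> sorted_invols"
  shows "\<exists>d\<in>invol_reps. \<exists>y\<in>twisted (stab d) d. u = y \<circ> d \<and> (\<forall>i. win (d i) = win (u i))"
  using assms
proof (induction "alen u" arbitrary: u rule: less_induct)
  case less
  have u: "u \<in> aperm" "u \<circ> u = id" using less.prems by (auto simp: sorted_invols_def)
  show "\<exists>d\<in>invol_reps. \<exists>y\<in>twisted (stab d) d. u = y \<circ> d \<and> (\<forall>i. win (d i) = win (u i))"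
  proof (cases "\<forall>i\<in>J. u i < u (i + 1)")
    case True
    then have "u \<in> invol_reps" using u by (simp add: invol_reps_def)
    moreover have "id \<in> twisted (stab u) u" using id_twisted[OF adm_stab] calculation by blast
    ultimately show ?thesis by (intro bexI[of _ u] bexI[of _ id]) auto
  next
    case False
    then obtain i where i: "i \<in> J" "u (i + 1) < u i" using aperm_cases[OF u(1)] by blast
    have w: "win (u i) = win (u (i + 1))"
      using less.prems i win_mono[of "u (i + 1)" "u i"] by (force simp: sorted_invols_def)
    \<comment> \<open>Treats both removals at once: g = id for multiplication, g =
      \<open>refl i\<close> for conjugation.\<close>
    have extend: "\<exists>d\<in>invol_reps. \<exists>y\<in>twisted (stab d) d. u = y \<circ> d \<and> (\<forall>i. win (d i) = win (u i))"
      if u': "u' \<in> aperm" "u' \<circ> u' = id" "\<And>x. win (u' x) = win (u x)" "alen u' < alen u"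
        and r: "u = g \<circ> u' \<circ> refl i" "g = id \<or> g = refl i" for u' g
    proof -
      have "u' \<in> sorted_invols" using u' less.prems by (simp add: sorted_invols_def)
      then obtain d y where dy: "d \<in> invol_reps" "y \<in> twisted (stab d) d" "u' = y \<circ> d" "\<forall>i. win (d i) = win (u' i)"
        using less.hyps u'(4) by blast
      have iK: "i \<in> stab d" using dy u' w i by (simp add: stab_def)
      note a = adm_stab[OF dy(1)]
      have e: "u = (g \<circ> y \<circ> refl (d i)) \<circ> d"
        unfolding r dy(3) using adm_conj'(2)[OF a iK] by (simp add: comp_assoc)
      have "g \<in> parab (stab d)" using r(2) parab_refl iK adm_simps(1)[OF a] by auto
      then have "g \<circ> y \<circ> refl (d i) \<in> parab (stab d)"
        using iK dy(2) by (intro parab_comp parab_refl) (simp_all add: adm_simps[OF a] twisted_parab[OF a])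
      then have "g \<circ> y \<circ> refl (d i) \<in> twisted (stab d) d" using u(2) e by (simp add: twisted_def)
      then show ?thesis using dy(1,4) e u'(3) by (intro bexI[of _ d] bexI[of _ "g \<circ> y \<circ> refl (d i)"]) auto
    qed
    show ?thesis
    proof (cases "u i = i + 1")
      case True
      show ?thesis
      proof (rule extend[where u' = "u \<circ> refl i" and g = id])
        show "win ((u \<circ> refl i) x) = win (u x)" for x using win_comp_refl[OF u(1) w] by simp
        show "alen (u \<circ> refl i) < alen u" using alen_comp_refl_down[OF u(1) i(2)] by simp
        show "(u \<circ> refl i) \<circ> (u \<circ> refl i) = id" by (rule commute_refl_swapped[OF u True])
      qed (simp_all add: comp_aperm u comp_assoc)
    next
      case False
      show ?thesis
      proof (rule extend[where u' = "refl i \<circ> u \<circ> refl i" and g = "refl i"])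
        show "win ((refl i \<circ> u \<circ> refl i) x) = win (u x)" for x
          using win_comp_refl[OF u(1) w] by (simp add: win_refl i)
        show "alen (refl i \<circ> u \<circ> refl i) < alen u" using alen_conj_down[OF u i(2) False] by simp
        show "(refl i \<circ> u \<circ> refl i) \<circ> (refl i \<circ> u \<circ> refl i) = id" by (rule conj_involution[OF u(2)])
      qed (simp_all add: comp_aperm u fun_eq_iff)
    qed
  qed
qed

lemma invol_reps_twisted_sorted_invols:
  assumes d: "d \<in> invol_reps" and y: "y \<in> twisted (stab d) d"
  shows "y \<circ> d \<in> sorted_invols" "win (y (d i)) = win (d i)"
proof -
  have "y \<in> parab J" using y parab_mono[OF stab_J] by (auto simp: twisted_def)
  then show w: "win (y (d i)) = win (d i)" for i by (simp add: parab_J)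
  have "y \<in> aperm" using twisted_aperm[OF adm_stab[OF d] y] .
  moreover have "win (d i) \<le> win (d (i + 1))" if "i \<in> J" for i
    by (rule win_mono) (use drepsD(4)[OF d that] in simp)
  ultimately show "y \<circ> d \<in> sorted_invols"
    using drepsD[OF d] y by (auto simp: sorted_invols_def w comp_aperm twisted_def)
qed

text \<open>\<open>d' \<circ> d\<close> preserves periods, and as d and d' increase on each period
  it has no descent in J, so it is the identity.\<close>

lemma invol_reps_unique:
  assumes d: "d \<in> invol_reps" and d': "d' \<in> invol_reps" and w: "\<And>i. win (d i) = win (d' i)"
  shows "d = d'"
proof -
  note dD = drepsD[OF d] and dD' = drepsD[OF d']
  define g where "g = d' \<circ> d"
  have wg: "win (g i) = win i" for i using w[of "d i"] by (simp add: g_def dD)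
  have g: "g \<in> parab J" using wg by (simp add: parab_J g_def comp_aperm dD dD')
  have "g = id"
  proof (rule parab_no_descent[OF g])
    fix i assume i: "i \<in> J"
    have l: "d' (g i) < d' (g (i + 1))" using dD(4)[OF i] by (simp add: g_def dD')
    have wi: "win (g i) = win (g (i + 1))" using i by (simp add: wg win_J)
    show "g i < g (i + 1)"
    proof (rule ccontr)
      assume "\<not> g i < g (i + 1)"
      then have "g (i + 1) = g i \<or> g (i + 1) < g i" by linarith
      then show False using l invol_reps_less[OF d', of "g (i + 1)" "g i"] wi by auto
    qed
  qed
  then have "d' (d x) = x" for x by (metis g_def comp_apply id_apply)
  then have "d x = d' x" for x using dD'(3) by metis
  then show ?thesis by auto
qed

lemma coset_reps_parab: "x \<in> coset_reps K \<Longrightarrow> x \<in> parab J"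
  by (simp add: coset_reps_def)

lemma coset_reps_chain:
  assumes "x \<in> coset_reps K" "a < b" "{a..<b} \<subseteq> K" shows "x a < x b"
  using assms by (intro chain_less[of a b x]) (auto simp: coset_reps_def)

text \<open>An index i in J where the period of the image drops is removed by conjugation, which
  shortens w by two. The conjugating generator is put in front of x and lengthens it by one, while x
  stays increasing on \<open>stab u\<close>.\<close>

lemma involution_decomp:
  assumes "w \<in> aperm" "w \<circ> w = id"
  shows "\<exists>u\<in>sorted_invols. \<exists>x\<in>coset_reps (stab u). w = x \<circ> u \<circ> finv x \<and> alen w = alen u + 2 * alen x"
  using assms
proof (induction "alen w" arbitrary: w rule: less_induct)
  case less
  have w: "w \<in> aperm" "w \<circ> w = id" by (fact less.prems)+
  show "\<exists>u\<in>sorted_invols. \<exists>x\<in>coset_reps (stab u). w = x \<circ> u \<circ> finv x \<and> alen w = alen u + 2 * alen x"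
  proof (cases "w \<in> sorted_invols")
    case True
    then show ?thesis by (intro bexI[of _ w] bexI[of _ id]) (auto simp: coset_reps_def)
  next
    case False
    then obtain i where i: "i \<in> J" "win (w (i + 1)) < win (w i)" using w by (auto simp: sorted_invols_def not_le)
    have d: "w (i + 1) < w i" using i win_mono[of "w i" "w (i + 1)"] by linarith
    \<comment> \<open>Swapping i and i + 1 would put both images into the same period.\<close>
    have ne: "w i \<noteq> i + 1"
    proof
      assume h: "w i = i + 1"
      then have "w (i + 1) = i" using involution_simp[OF w(2), of i] by simp
      with h i show False by (simp add: win_J)
    qed
    define w' where "w' = refl i \<circ> w \<circ> refl i"
    have l: "alen w = alen w' + 2" unfolding w'_def by (rule alen_conj_down[OF w d ne])
    have w': "w' \<in> aperm" "w' \<circ> w' = id"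
      using w by (auto simp: w'_def comp_aperm conj_involution)
    obtain u x where ux: "u \<in> sorted_invols" "x \<in> coset_reps (stab u)" "w' = x \<circ> u \<circ> finv x" "alen w' = alen u + 2 * alen x"
      using less.hyps[OF _ w'] l by auto
    have xJ: "x \<in> parab J" using ux by (simp add: coset_reps_parab)
    have xa: "x \<in> aperm" using xJ by (rule parab_aperm)
    have ua: "u \<in> aperm" using ux by (simp add: sorted_invols_def)
    have wx: "win (x j) = win j" for j using xJ by (simp add: parab_J)
    have wfx: "win (finv x j) = win j" for j using wx[of "finv x j"] xa by simp
    have "win (w' j) = win (u (finv x j))" for j unfolding ux(3) by (simp add: wx)
    moreover have "win (w' i) = win (w (i + 1))" "win (w' (i + 1)) = win (w i)"
      by (simp_all add: w'_def win_refl i)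
    ultimately have lt: "win (u (finv x i)) < win (u (finv x (i + 1)))" using i by simp
    have we: "win (finv x i) = win (finv x (i + 1))" using i by (simp add: wfx win_J)
    have xi: "finv x i < finv x (i + 1)"
      using lt sorted_invols_le[OF ux(1), of "finv x (i + 1)" "finv x i"] we by force
    have al: "alen (refl i \<circ> x) = alen x + 1" by (rule alen_refl_comp_up[OF xa xi])
    have "refl i \<circ> x \<in> coset_reps (stab u)"
    proof -
      have "refl i (x j) < refl i (x (j + 1))" if j: "j \<in> stab u" for j
      proof (rule refl_less)
        show "x j < x (j + 1)" using ux(2) j by (simp add: coset_reps_def)
        show "\<not> (x (j + 1) = x j + 1 \<and> N dvd x j - i)"
        proof
          \<comment> \<open>Up to a translation, x would map j, j + 1 to i, i + 1. As j lies in
            \<open>stab u\<close>, the preimages of i and i + 1 would then have their images under u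
            in one period, against \<open>lt\<close>.\<close>
          assume h: "x (j + 1) = x j + 1 \<and> N dvd x j - i"
          then obtain k where k: "x j = i + N * k" using dvd_shiftE by blast
          have "x (j + N * (- k)) = i" using k aperm_shift_mult[OF xa, of j "- k"] by simp
          moreover have "x (j + 1 + N * (- k)) = i + 1" using h k aperm_shift_mult[OF xa, of "j + 1" "- k"] by simp
          ultimately have "finv x i = j + N * (- k)" "finv x (i + 1) = j + 1 + N * (- k)"
            using inv_aperm_simps(1)[OF xa] by metis+
          then have "win (u (finv x i)) = win (u (finv x (i + 1)))"
            using j by (simp only: win_aperm_shift[OF ua]) (simp add: stab_def)
          with lt show False by simp
        qed
      qed
      moreover have "refl i \<circ> x \<in> parab J" using i xJ by (simp add: parab_comp parab_refl periodic_J)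
      ultimately show ?thesis by (simp add: coset_reps_def)
    qed
    moreover have "w = (refl i \<circ> x) \<circ> u \<circ> finv (refl i \<circ> x)"
    proof -
      have "w = refl i \<circ> w' \<circ> refl i" by (simp add: w'_def fun_eq_iff)
      then show ?thesis using xa by (simp add: ux(3) inv_comp comp_assoc)
    qed
    ultimately show ?thesis using ux(1) l ux(4) al
      by (intro bexI[of _ u] bexI[of _ "refl i \<circ> x"]) auto
  qed
qed

text \<open>With g = x'^-1 x one has g u = u' g. At a descent i of g in J, sortedness of u and u'
  forces i into \<open>stab u\<close> and the indices from g (i + 1) to below g i into
  \<open>stab u'\<close>. There x and x' increase, which is incompatible with x = x' g and the
  descent.\<close>

lemma involution_decomp_unique:
  assumes u: "u \<in> sorted_invols" "u' \<in> sorted_invols" and x: "x \<in> coset_reps (stab u)" "x' \<in> coset_reps (stab u')"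
    and eq: "x \<circ> u \<circ> finv x = x' \<circ> u' \<circ> finv x'"
  shows "x = x'" "u = u'"
proof -
  have xJ: "x \<in> parab J" "x' \<in> parab J" using x by (auto simp: coset_reps_parab)
  then have xa: "x \<in> aperm" "x' \<in> aperm" by (auto simp: parab_aperm)
  define g where "g = finv x' \<circ> x"
  have g: "g \<in> parab J" using xJ by (simp add: g_def parab_comp parab_finv)
  have x'g: "x' (g i) = x i" for i using xa by (simp add: g_def)
  have gu: "g (u i) = u' (g i)" for i
  proof -
    have "(x \<circ> u \<circ> finv x) (x i) = (x' \<circ> u' \<circ> finv x') (x i)" by (simp only: eq)
    then have "x (u i) = x' (u' (g i))" using xa by (simp add: g_def)
    then show ?thesis using xa by (simp add: g_def)
  qed
  have wg: "win (g i) = win i" for i using g by (simp add: parab_J)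
  have wu: "win (u i) = win (u' (g i))" for i using wg[of "u i"] gu by simp
  have "g = id"
  proof (rule parab_no_descent[OF g], rule ccontr)
    fix i assume i: "i \<in> J" and "\<not> g i < g (i + 1)"
    then have d: "g (i + 1) < g i" using aperm_cases[OF parab_aperm[OF g], of i] by blast
    have wi: "win (g (i + 1)) = win (g i)" using i by (simp add: wg win_J)
    have "win (u (i + 1)) \<le> win (u i)" using sorted_invols_le[OF u(2) less_imp_le[OF d] wi] by (simp add: wu)
    moreover have "win (u i) \<le> win (u (i + 1))" using u(1) i by (simp add: sorted_invols_def)
    ultimately have e: "win (u i) = win (u (i + 1))" by simp
    then have "x i < x (i + 1)" using x(1) i by (simp add: coset_reps_def stab_def)
    moreover have "x' (g (i + 1)) < x' (g i)"
    proof (rule coset_reps_chain[OF x(2) d], rule subsetI)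
      fix m assume m: "m \<in> {g (i + 1)..<g i}"
      then have mJ: "m \<in> J" using win_eq_J[OF wi] by blast
      have "win (g (i + 1)) \<le> win m" "win m \<le> win (m + 1)" "win (m + 1) \<le> win (g i)"
        using m by (auto intro: win_mono)
      then have "win (u' (g (i + 1))) \<le> win (u' m)" "win (u' m) \<le> win (u' (m + 1))"
          "win (u' (m + 1)) \<le> win (u' (g i))"
        using m wi by (auto intro!: sorted_invols_le[OF u(2)])
      then show "m \<in> stab u'" using mJ e by (simp add: stab_def wu)
    qed
    ultimately show False by (simp add: x'g)
  qed
  then have "x' i = x i" for i using x'g[of i] by simp
  then show "x = x'" by auto
  show "u = u'" using gu \<open>g = id\<close> by (simp add: fun_eq_iff)
qed

text \<open>Descents of w in K are stripped off on the right and collected in v.\<close>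

lemma coset_decomp:
  assumes K: "periodic K" "K \<subseteq> J" and w: "w \<in> parab J"
  shows "\<exists>x\<in>coset_reps K. \<exists>v\<in>parab K. w = x \<circ> v \<and> alen w = alen x + alen v"
  using w
proof (induction "alen w" arbitrary: w rule: less_induct)
  case less
  show "\<exists>x\<in>coset_reps K. \<exists>v\<in>parab K. w = x \<circ> v \<and> alen w = alen x + alen v"
  proof (cases "\<forall>i\<in>K. w i < w (i + 1)")
    case True
    then show ?thesis using less.prems by (intro bexI[of _ w] bexI[of _ id]) (auto simp: coset_reps_def)
  next
    case False
    have wa: "w \<in> aperm" using less.prems by (rule parab_aperm)
    from False obtain i where i: "i \<in> K" "w (i + 1) < w i" using aperm_cases[OF wa] by blast
    have l: "alen w = alen (w \<circ> refl i) + 1" by (rule alen_comp_refl_down[OF wa i(2)])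
    have "w \<circ> refl i \<in> parab J" using less.prems i K by (auto intro!: parab_comp parab_refl periodic_J)
    then obtain x v where xv: "x \<in> coset_reps K" "v \<in> parab K" "w \<circ> refl i = x \<circ> v" "alen (w \<circ> refl i) = alen x + alen v"
      using less.hyps l by (metis less_add_one)
    have "v i < v (i + 1)"
    proof (rule ccontr)
      assume "\<not> v i < v (i + 1)"
      then have d: "v (i + 1) < v i" using aperm_cases[OF parab_aperm[OF xv(2)], of i] by blast
      have "x (v (i + 1)) < x (v i)" by (rule coset_reps_chain[OF xv(1) d parab_block(2)[OF xv(2) i(1)]])
      moreover have "x (v i) = w (i + 1)" "x (v (i + 1)) = w i"
        using fun_cong[OF xv(3), of i] fun_cong[OF xv(3), of "i + 1"] by simp_all
      ultimately show False using i by simp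
    qed
    then have "alen (v \<circ> refl i) = alen v + 1" using xv by (intro alen_comp_refl_up) (auto simp: parab_aperm)
    moreover have "v \<circ> refl i \<in> parab K" using xv i K by (simp add: parab_comp parab_refl)
    moreover have "w = x \<circ> (v \<circ> refl i)"
    proof -
      have "w = (w \<circ> refl i) \<circ> refl i" by (simp add: comp_assoc)
      then show ?thesis by (simp only: xv(3) comp_assoc)
    qed
    ultimately show ?thesis using xv(1,4) l by (intro bexI[of _ x] bexI[of _ "v \<circ> refl i"]) auto
  qed
qed

lemma coset_decomp_unique:
  assumes x: "x \<in> coset_reps K" "x' \<in> coset_reps K" and v: "v \<in> parab K" "v' \<in> parab K" and eq: "x \<circ> v = x' \<circ> v'"
  shows "x = x'" "v = v'"
proof -
  have va: "v \<in> aperm" "v' \<in> aperm" and xa: "x' \<in> aperm"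
    using v coset_reps_parab[OF x(2)] by (auto simp: parab_aperm)
  define g where "g = v' \<circ> finv v"
  have g: "g \<in> parab K" using v by (simp add: g_def parab_comp parab_finv)
  have xg: "x i = x' (g i)" for i
    using fun_cong[OF eq, of "finv v i"] va by (simp add: g_def)
  have "g = id"
  proof (rule parab_no_descent[OF g], rule ccontr)
    fix i assume i: "i \<in> K" and "\<not> g i < g (i + 1)"
    then have d: "g (i + 1) < g i" using aperm_cases[OF parab_aperm[OF g], of i] by blast
    have "x' (g (i + 1)) < x' (g i)" by (rule coset_reps_chain[OF x(2) d parab_block(2)[OF g i]])
    moreover have "x i < x (i + 1)" using x(1) i by (simp add: coset_reps_def)
    ultimately show False by (simp add: xg)
  qed
  then show xx: "x = x'" using xg by (simp add: fun_eq_iff)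
  have "v j = v' j" for j
    using fun_cong[OF eq, of j] xa by (simp add: xx aperm_inj)
  then show "v = v'" by auto
qed

subsection \<open>Generating functions of parabolic subgroups\<close>

definition length_gf :: "int set \<Rightarrow> 'a::comm_ring_1 \<Rightarrow> 'a" where
  "length_gf K q = (\<Sum>w\<in>parab K. q ^ alen w)"

text \<open>At z = (q - 1) / (q + 1) this is the series L of (W_K, K) twisted by d
  (\<open>L_series_WG\<close>).\<close>

definition twisted_gf :: "int set \<Rightarrow> (int \<Rightarrow> int) \<Rightarrow> 'a::comm_ring_1 \<Rightarrow> 'a \<Rightarrow> 'a" where
  "twisted_gf K d q z = (\<Sum>y\<in>twisted K d. q ^ alen y * z ^ (cyc (y \<circ> d) - cyc d))"

text \<open>The truncation that makes sums over the affine group finite. It constrains periods only,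
  so conjugation by \<open>parab J\<close> preserves it.\<close>

definition bounded_shift :: "nat \<Rightarrow> (int \<Rightarrow> int) set" where
  "bounded_shift h = {w. \<forall>i. \<bar>win (w i) - win i\<bar> \<le> int h}"

lemma window_repr: obtains r k where "i = r + N * k" "r \<in> {1..N}" "k = win i"
proof
  show "i = (i - N * win i) + N * win i" by simp
  show "i - N * win i \<in> {1..N}"
    unfolding win_1N[symmetric] using win_shift[of i "- win i"] by simp
qed simp

lemma aperm_eqI:
  assumes "v \<in> aperm" "w \<in> aperm" "\<And>i. i \<in> {1..N} \<Longrightarrow> v i = w i"
  shows "v = w"
proof
  fix i
  obtain r k where "i = r + N * k" "r \<in> {1..N}" by (rule window_repr)
  then show "v i = w i" using assms by (simp add: aperm_shift_mult)
qed

lemma finite_bounded_shift: "finite (aperm \<inter> bounded_shift h)"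
proof -
  define B where "B = {- N * int h..N * (int h + 1)}"
  have "(\<lambda>w. restrict w {1..N}) ` (aperm \<inter> bounded_shift h) \<subseteq> {1..N} \<rightarrow>\<^sub>E B"
  proof safe
    fix w i assume w: "w \<in> bounded_shift h" and i: "i \<in> {1..N}"
    have "\<bar>win (w i) - win i\<bar> \<le> int h" using w by (simp add: bounded_shift_def)
    then have "win (w i) \<le> int h" "\<not> win (w i) \<le> - int h - 1"
      using i win_1N[of i] by auto
    then have "w i \<le> N * (int h + 1)" "\<not> w i \<le> N * (- int h)"
      using win_le[of "w i" "int h"] win_le[of "w i" "- int h - 1"] by simp_all
    then show "restrict w {1..N} i \<in> B" using i by (simp add: B_def)
  qed auto
  then have "finite ((\<lambda>w. restrict w {1..N}) ` (aperm \<inter> bounded_shift h))"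
    by (rule finite_subset) (simp add: finite_PiE B_def)
  moreover have "inj_on (\<lambda>w. restrict w {1..N}) (aperm \<inter> bounded_shift h)"
    by (rule inj_onI, rule aperm_eqI) (auto dest: fun_cong simp: restrict_def, metis)
  ultimately show ?thesis by (rule finite_imageD)
qed

lemma parab_J_bounded: "K \<subseteq> J \<Longrightarrow> parab K \<subseteq> aperm \<inter> bounded_shift h"
  using parab_mono[of K J] by (auto simp: bounded_shift_def parab_J)

lemma finite_parab: "K \<subseteq> J \<Longrightarrow> finite (parab K)"
  using finite_subset[OF parab_J_bounded finite_bounded_shift] .

lemma finite_twisted: "K \<subseteq> J \<Longrightarrow> finite (twisted K d)"
  by (rule finite_subset[OF _ finite_parab[of K]]) (auto simp: twisted_def)

lemma finite_coset_reps: "finite (coset_reps K)"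
  by (rule finite_subset[OF _ finite_parab[of J]]) (auto simp: coset_reps_def)

text \<open>\<open>involution_decomp\<close> gives the length formula for some factorization, and by
  uniqueness that factorization is the given one.\<close>

lemma alen_conj_coset_reps:
  assumes u: "u \<in> sorted_invols" and x: "x \<in> coset_reps (stab u)"
  shows "alen (x \<circ> u \<circ> finv x) = alen u + 2 * alen x"
proof -
  define w where "w = x \<circ> u \<circ> finv x"
  have xa: "x \<in> aperm" by (rule parab_aperm[OF coset_reps_parab[OF x]])
  have ua: "u \<in> aperm" "u \<circ> u = id" using u by (auto simp: sorted_invols_def)
  have "w \<in> aperm" "w \<circ> w = id"
    using xa ua involution_simp[OF ua(2)] by (auto simp: w_def comp_aperm inv_aperm fun_eq_iff)
  then obtain u' x' where w': "u' \<in> sorted_invols" "x' \<in> coset_reps (stab u')" "w = x' \<circ> u' \<circ> finv x'" "alen w = alen u' + 2 * alen x'"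
    using involution_decomp by blast
  have "x = x'" "u = u'" using involution_decomp_unique[OF u w'(1) x w'(2)] w'(3) by (simp_all add: w_def)
  then show ?thesis using w'(4) by (simp add: w_def)
qed

lemma stab_cong: "(\<And>i. win (u i) = win (v i)) \<Longrightarrow> stab u = stab v"
  by (simp add: stab_def)

text \<open>Both stages combined. The factors x and y preserve periods, so the same bound h
  truncates both sides.\<close>

lemma involution_bij:
  "bij_betw (\<lambda>(d, y, x). x \<circ> (y \<circ> d) \<circ> finv x)
    (SIGMA d:invol_reps \<inter> bounded_shift h. twisted (stab d) d \<times> coset_reps (stab d))
    {w \<in> aperm. w \<circ> w = id \<and> w \<in> bounded_shift h}"
  (is "bij_betw ?f ?A ?B")
proof (rule bij_betwI')
  have Kyd: "stab (y \<circ> d) = stab d" if "d \<in> invol_reps" "y \<in> twisted (stab d) d" for d y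
    using invol_reps_twisted_sorted_invols(2)[OF that] by (intro stab_cong) simp
  show "?f p = ?f p' \<longleftrightarrow> p = p'" if p: "p \<in> ?A" "p' \<in> ?A" for p p'
  proof
    assume eq: "?f p = ?f p'"
    obtain d y x where p1: "p = (d, y, x)" by (cases p)
    obtain d' y' x' where p2: "p' = (d', y', x')" by (cases p')
    have m: "d \<in> invol_reps" "y \<in> twisted (stab d) d" "x \<in> coset_reps (stab d)" "d' \<in> invol_reps" "y' \<in> twisted (stab d') d'" "x' \<in> coset_reps (stab d')"
      using p by (auto simp: p1 p2)
    have xu: "x = x'" "y \<circ> d = y' \<circ> d'"
      using involution_decomp_unique[of "y \<circ> d" "y' \<circ> d'" x x'] m eq
      by (simp_all add: p1 p2 invol_reps_twisted_sorted_invols Kyd)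
    have "d = d'"
    proof (rule invol_reps_unique[OF m(1,4)])
      show "win (d i) = win (d' i)" for i
        using invol_reps_twisted_sorted_invols(2)[OF m(1,2), of i] invol_reps_twisted_sorted_invols(2)[OF m(4,5), of i]
          fun_cong[OF xu(2), of i] by simp
    qed
    moreover have "y i = y' i" for i
      using fun_cong[OF xu(2), of "d i"] \<open>d = d'\<close> drepsD(3)[OF m(1)] by simp
    ultimately show "p = p'" using xu(1) by (auto simp: p1 p2)
  qed simp
  show "?f p \<in> ?B" if p: "p \<in> ?A" for p
  proof -
    obtain d y x where p1: "p = (d, y, x)" by (cases p)
    have m: "d \<in> invol_reps" "d \<in> bounded_shift h" "y \<in> twisted (stab d) d" "x \<in> coset_reps (stab d)" using p by (auto simp: p1)
    have xJ: "x \<in> parab J" using m(4) by (rule coset_reps_parab)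
    have xa: "x \<in> aperm" using xJ by (rule parab_aperm)
    note u = twisted_involution[OF adm_stab[OF m(1)] m(3)]
    have wx: "win (x j) = win j" for j using xJ by (simp add: parab_J)
    have wfx: "win (finv x j) = win j" for j using wx[of "finv x j"] xa by simp
    have "\<bar>win (x (y (d (finv x i)))) - win i\<bar> \<le> int h" for i
      using m(2) wfx[of i] unfolding bounded_shift_def
      by (simp add: wx invol_reps_twisted_sorted_invols(2)[OF m(1,3)]) (metis wfx)
    moreover have "(x \<circ> (y \<circ> d) \<circ> finv x) \<circ> (x \<circ> (y \<circ> d) \<circ> finv x) = id"
      using xa involution_simp[OF u(2)] by (simp add: fun_eq_iff)
    ultimately show ?thesis using xa u by (simp add: p1 bounded_shift_def comp_aperm inv_aperm)
  qed
  show "\<exists>p\<in>?A. w = ?f p" if w: "w \<in> ?B" for w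
  proof -
    obtain u x where ux: "u \<in> sorted_invols" "x \<in> coset_reps (stab u)" "w = x \<circ> u \<circ> finv x"
      using involution_decomp w by blast
    obtain d y where dy: "d \<in> invol_reps" "y \<in> twisted (stab d) d" "u = y \<circ> d" "\<And>i. win (d i) = win (u i)"
      using sorted_invols_decomp[OF ux(1)] by blast
    have xJ: "x \<in> parab J" using ux(2) by (rule coset_reps_parab)
    have xa: "x \<in> aperm" using xJ by (rule parab_aperm)
    have wx: "win (x j) = win j" for j using xJ by (simp add: parab_J)
    have "\<bar>win (d i) - win i\<bar> \<le> int h" for i
    proof -
      have "win (d i) = win (w (x i))" unfolding ux(3) dy(4) using xa by (simp add: wx)
      moreover have "\<bar>win (w (x i)) - win (x i)\<bar> \<le> int h" using w by (simp add: bounded_shift_def)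
      ultimately show ?thesis by (simp add: wx)
    qed
    moreover have "stab u = stab d" using dy(4) by (intro stab_cong) simp
    ultimately show ?thesis using dy ux by (intro bexI[of _ "(d, y, x)"]) (auto simp: bounded_shift_def)
  qed
qed

text \<open>\<open>alen\<close> and \<open>cyc\<close> split along the bijection; conjugation by x
  costs twice its length, hence the sum over x at q^2.\<close>

lemma involution_sum:
  fixes q z :: "'a::comm_ring_1"
  shows "(\<Sum>w | w \<in> aperm \<and> w \<circ> w = id \<and> w \<in> bounded_shift h. q ^ alen w * z ^ cyc w) =
    (\<Sum>d\<in>invol_reps \<inter> bounded_shift h. q ^ alen d * z ^ cyc d * twisted_gf (stab d) d q z * (\<Sum>x\<in>coset_reps (stab d). (q\<^sup>2) ^ alen x))"
proof -
  have fin: "finite (invol_reps \<inter> bounded_shift h)"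
    by (rule finite_subset[OF _ finite_bounded_shift[of h]]) (auto simp: invol_reps_def)
  have w: "q ^ alen (x \<circ> (y \<circ> d) \<circ> finv x) * z ^ cyc (x \<circ> (y \<circ> d) \<circ> finv x) =
     (q ^ alen d * z ^ cyc d) * ((q ^ alen y * z ^ (cyc (y \<circ> d) - cyc d)) * (q\<^sup>2) ^ alen x)"
    if m: "d \<in> invol_reps" "y \<in> twisted (stab d) d" "x \<in> coset_reps (stab d)" for d y x
  proof -
    note a = adm_stab[OF m(1)]
    have "stab (y \<circ> d) = stab d" using invol_reps_twisted_sorted_invols(2)[OF m(1,2)] by (intro stab_cong) simp
    then have l: "alen (x \<circ> (y \<circ> d) \<circ> finv x) = alen y + alen d + 2 * alen x"
      using alen_conj_coset_reps[OF invol_reps_twisted_sorted_invols(1)[OF m(1,2)]] m twisted_alen[OF a m(2)] by simp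
    have xa: "x \<in> aperm" by (rule parab_aperm[OF coset_reps_parab[OF m(3)]])
    have "cyc (x \<circ> (y \<circ> d) \<circ> finv x) = cyc (y \<circ> d)"
      by (rule cyc_conj[OF xa twisted_involution(1)[OF a m(2)]])
    also have "\<dots> = cyc d + (cyc (y \<circ> d) - cyc d)" using twisted_cyc[OF a m(2)] by simp
    finally have c: "z ^ cyc (x \<circ> (y \<circ> d) \<circ> finv x) = z ^ cyc d * z ^ (cyc (y \<circ> d) - cyc d)"
      by (simp add: power_add)
    show ?thesis unfolding c l by (simp add: power_add power_mult)
  qed
  have "(\<Sum>w | w \<in> aperm \<and> w \<circ> w = id \<and> w \<in> bounded_shift h. q ^ alen w * z ^ cyc w) =
     (\<Sum>p\<in>(SIGMA d:invol_reps \<inter> bounded_shift h. twisted (stab d) d \<times> coset_reps (stab d)).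
        case p of (d, y, x) \<Rightarrow> q ^ alen (x \<circ> (y \<circ> d) \<circ> finv x) * z ^ cyc (x \<circ> (y \<circ> d) \<circ> finv x))"
    by (subst sum.reindex_bij_betw[OF involution_bij[of h], symmetric]) (simp add: case_prod_unfold)
  also have "\<dots> = (\<Sum>p\<in>(SIGMA d:invol_reps \<inter> bounded_shift h. twisted (stab d) d \<times> coset_reps (stab d)).
        case p of (d, y, x) \<Rightarrow> (q ^ alen d * z ^ cyc d) * ((q ^ alen y * z ^ (cyc (y \<circ> d) - cyc d)) * (q\<^sup>2) ^ alen x))"
    by (rule sum.cong[OF refl]) (use w in fastforce)
  also have "\<dots> = (\<Sum>d\<in>invol_reps \<inter> bounded_shift h. \<Sum>p\<in>twisted (stab d) d \<times> coset_reps (stab d).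
        case p of (y, x) \<Rightarrow> (q ^ alen d * z ^ cyc d) * ((q ^ alen y * z ^ (cyc (y \<circ> d) - cyc d)) * (q\<^sup>2) ^ alen x))"
    by (subst sum.Sigma) (use fin finite_twisted[OF stab_J] finite_coset_reps in \<open>auto simp: case_prod_unfold\<close>)
  also have "\<dots> = (\<Sum>d\<in>invol_reps \<inter> bounded_shift h. q ^ alen d * z ^ cyc d * (twisted_gf (stab d) d q z * (\<Sum>x\<in>coset_reps (stab d). (q\<^sup>2) ^ alen x)))"
    unfolding twisted_gf_def sum_product sum.cartesian_product
    by (simp add: sum_distrib_left case_prod_unfold)
  finally show ?thesis by (simp add: mult.assoc)
qed

lemma length_gf_coset:
  fixes q :: "'a::comm_ring_1"
  assumes K: "periodic K" "K \<subseteq> J"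
  shows "length_gf J q = (\<Sum>x\<in>coset_reps K. q ^ alen x) * length_gf K q"
proof -
  have bij: "bij_betw (\<lambda>(x, v). x \<circ> v) (coset_reps K \<times> parab K) (parab J)" (is "bij_betw ?f _ _")
  proof (rule bij_betwI')
    show "?f p = ?f p' \<longleftrightarrow> p = p'" if "p \<in> coset_reps K \<times> parab K" "p' \<in> coset_reps K \<times> parab K" for p p'
      using that coset_decomp_unique[of "fst p" K "fst p'" "snd p" "snd p'"]
      by (auto simp: case_prod_unfold prod_eq_iff)
    show "?f p \<in> parab J" if "p \<in> coset_reps K \<times> parab K" for p
      using that parab_mono[OF K(2)] by (auto intro!: parab_comp simp: coset_reps_parab)
    show "\<exists>p\<in>coset_reps K \<times> parab K. w = ?f p" if "w \<in> parab J" for w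
      using coset_decomp[OF K that] by force
  qed
  \<comment> \<open>Additivity is known for the factorization that \<open>coset_decomp\<close>
    produces; uniqueness transfers it to the given one.\<close>
  have l: "alen (x \<circ> v) = alen x + alen v" if m: "x \<in> coset_reps K" "v \<in> parab K" for x v
  proof -
    have "x \<circ> v \<in> parab J" using m parab_mono[OF K(2)] by (auto intro!: parab_comp simp: coset_reps_parab)
    then obtain x' v' where m': "x' \<in> coset_reps K" "v' \<in> parab K" "x \<circ> v = x' \<circ> v'" "alen (x \<circ> v) = alen x' + alen v'"
      using coset_decomp[OF K] by blast
    then show ?thesis using coset_decomp_unique[OF m(1) m'(1) m(2) m'(2,3)] by simp
  qed
  have "length_gf J q = (\<Sum>p\<in>coset_reps K \<times> parab K. q ^ alen (?f p))"
    unfolding length_gf_def by (rule sum.reindex_bij_betw[OF bij, symmetric])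
  also have "\<dots> = (\<Sum>(x, v)\<in>coset_reps K \<times> parab K. q ^ alen x * q ^ alen v)"
    by (rule sum.cong[OF refl]) (auto simp: l power_add)
  also have "\<dots> = (\<Sum>x\<in>coset_reps K. q ^ alen x) * length_gf K q"
    by (simp add: length_gf_def sum_product sum.cartesian_product)
  finally show ?thesis .
qed

section \<open>Recursions for runs of type A\<close>

definition del :: "int set \<Rightarrow> int \<Rightarrow> int set" where
  "del K i = {j \<in> K. \<not> N dvd j - i}"

lemma del_subset: "del K i \<subseteq> K"
  by (auto simp: del_def)

lemma self_notin_del: "i \<notin> del K i"
  by (simp add: del_def)

lemma periodic_del: assumes "periodic K" shows "periodic (del K i)"
proof -
  have "N dvd j + N - i \<longleftrightarrow> N dvd j - i" for j
    using dvd_add_triv_right_iff[of N "j - i"] by (simp add: algebra_simps)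
  then show ?thesis using assms by (simp add: periodic_def del_def)
qed

lemma parab_del:
  assumes "w \<in> parab K" "i + 1 \<notin> K" "w (i + 1) = i + 1"
  shows "w \<in> parab (del K i)"
proof -
  have wa: "w \<in> aperm" using assms(1) by (rule parab_aperm)
  have base: "w j \<le> i \<longleftrightarrow> j \<le> i" for j
    using parab_le[OF assms(1,2), of j] assms(3) aperm_inj[OF wa, of j "i + 1"] by (cases "j = i + 1") auto
  have "w j \<le> m \<longleftrightarrow> j \<le> m" if m: "m \<notin> del K i" for m j
  proof (cases "m \<in> K")
    case True
    then have "N dvd m - i" using m by (simp add: del_def)
    then obtain k where k: "m = i + N * k" by (rule dvd_shiftE)
    have "w j \<le> m \<longleftrightarrow> w (j + N * (- k)) \<le> i" using aperm_shift_mult[OF wa, of j "- k"] k by auto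
    also have "\<dots> \<longleftrightarrow> j \<le> m" unfolding base using k by auto
    finally show ?thesis .
  qed (simp add: parab_le[OF assms(1)])
  then show ?thesis using wa by (simp add: parab_def)
qed

lemma parab_fix: assumes "w \<in> parab K" "i \<notin> K" "i + 1 \<notin> K" shows "w (i + 1) = i + 1"
  using parab_le[OF assms(1,2), of "i + 1"] parab_le[OF assms(1,3), of "i + 1"] by simp

text \<open>Deleting the last index i of a run amounts to fixing the point i + 1, as in passing from
  S_(r+1) to S_r.\<close>

lemma parab_del_iff:
  assumes "i + 1 \<notin> K" shows "w \<in> parab (del K i) \<longleftrightarrow> w \<in> parab K \<and> w (i + 1) = i + 1"
proof (intro iffI conjI)
  assume w: "w \<in> parab (del K i)"
  then show "w \<in> parab K" using parab_mono[OF del_subset] by blast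
  show "w (i + 1) = i + 1"
    using w self_notin_del[of i K] assms del_subset[of K i] by (intro parab_fix[of w "del K i"]) auto
next
  assume "w \<in> parab K \<and> w (i + 1) = i + 1"
  then show "w \<in> parab (del K i)" using parab_del[OF _ assms] by blast
qed

text \<open>For r > 0 the indices i - r + 1, ..., i form a connected component of type A_r in the
  Dynkin diagram of K, with i as last node; r = 0 is allowed.\<close>

definition run :: "int set \<Rightarrow> int \<Rightarrow> nat \<Rightarrow> bool" where
  "run K i r \<longleftrightarrow> i + 1 \<notin> K \<and> {i - int r<..i} \<subseteq> K \<and> i - int r \<notin> K"

lemma run_range:
  assumes "run K i r" "w \<in> parab K" shows "w (i + 1) \<in> {i - int r<..i + 1}"
  using assms parab_le[OF assms(2), of "i + 1" "i + 1"] parab_le[OF assms(2), of "i - int r" "i + 1"]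
  by (auto simp: run_def)

lemma sum_run:
  fixes f :: "(int \<Rightarrow> int) \<Rightarrow> 'a::comm_ring_1"
  assumes "finite A" "\<And>w. w \<in> A \<Longrightarrow> w t \<in> {t - int r - 1<..t}"
  shows "sum f A = (\<Sum>p\<le>r. \<Sum>w | w \<in> A \<and> w t = t - int p. f w)"
proof -
  have A: "A = (\<Union>p\<le>r. {w \<in> A. w t = t - int p})"
  proof safe
    fix w assume w: "w \<in> A"
    then have "w t = t - int (nat (t - w t))" "nat (t - w t) \<le> r" using assms(2)[OF w] by auto
    with w show "w \<in> (\<Union>p\<le>r. {w \<in> A. w t = t - int p})" by blast
  qed
  show ?thesis by (subst A, rule sum.UNION_disjoint) (use assms(1) in auto)
qed

text \<open>Elements are sorted by the image of the top point i + 1, which takes r + 1 values.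
  Lowering the image from m + 1 to m is left multiplication by \<open>refl m\<close> and costs one
  power of q.\<close>

lemma length_gf_run:
  fixes q :: "'a::comm_ring_1"
  assumes K: "periodic K" "K \<subseteq> J" and r: "run K i r"
  shows "length_gf K q = qn q (r + 1) * length_gf (del K i) q"
proof -
  define t where "t = i + 1"
  define S where "S m = (\<Sum>w | w \<in> parab K \<and> w t = m. q ^ alen w)" for m
  have tK: "t \<notin> K" using r by (simp add: run_def t_def)
  have S0: "S t = length_gf (del K i) q"
    unfolding S_def length_gf_def using parab_del_iff[of i K] tK by (intro sum.cong) (auto simp: t_def)
  have step: "S m = q * S (m + 1)" if m: "m \<in> K" "m < t" for m
  proof -
    have up: "refl m \<circ> w \<in> parab K" if "w \<in> parab K" for w using that m K by (simp add: parab_comp parab_refl)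
    have "S m = (\<Sum>w | w \<in> parab K \<and> w t = m + 1. q ^ alen (refl m \<circ> w))"
      unfolding S_def
      by (rule sum.reindex_bij_witness[where i = "\<lambda>w. refl m \<circ> w" and j = "\<lambda>w. refl m \<circ> w"])
        (simp_all add: up comp_assoc[symmetric])
    also have "\<dots> = (\<Sum>w | w \<in> parab K \<and> w t = m + 1. q * q ^ alen w)"
    proof (rule sum.cong[OF refl])
      fix w assume "w \<in> {w \<in> parab K. w t = m + 1}"
      then have w: "w \<in> parab K" "w t = m + 1" by auto
      have wa: "w \<in> aperm" using w(1) by (rule parab_aperm)
      have f: "finv w (m + 1) = t" using inv_aperm_simps(1)[OF wa, of t] w(2) by simp
      have "finv w m \<le> t" using parab_le[OF parab_finv[OF w(1)] tK, of m] m by simp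
      moreover have "finv w m \<noteq> t" using f aperm_inj[OF inv_aperm[OF wa], of m "m + 1"] by simp
      ultimately show "q ^ alen (refl m \<circ> w) = q * q ^ alen w" using alen_refl_comp_up[OF wa, of m] f by simp
    qed
    finally show ?thesis by (simp add: S_def sum_distrib_left)
  qed
  have Sp: "S (t - int p) = q ^ p * S t" if "p \<le> r" for p
    using that
  proof (induction p)
    case (Suc p)
    have "t - int (Suc p) \<in> K" using r Suc.prems by (auto simp: run_def t_def)
    then have "S (t - int (Suc p)) = q * S (t - int (Suc p) + 1)" by (intro step) auto
    also have "t - int (Suc p) + 1 = t - int p" by simp
    finally show ?case using Suc by (simp add: mult.assoc)
  qed simp
  have "length_gf K q = (\<Sum>p\<le>r. S (t - int p))"
    unfolding length_gf_def S_def
    by (rule sum_run) (use run_range[OF r] finite_parab[OF K(2)] in \<open>auto simp: t_def\<close>)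
  also have "\<dots> = (\<Sum>p\<le>r. q ^ p) * S t" by (simp add: Sp sum_distrib_right)
  also have "{..r} = {..<r + 1}" by auto
  finally show ?thesis by (simp add: S0 qn_def)
qed

context
  fixes K d i r and q z :: "'a::comm_ring_1"
  assumes adm: "adm K d" and KJ: "K \<subseteq> J" and r: "run K i r" and iK: "i \<in> K"
begin

definition Lpart :: "int \<Rightarrow> 'a" where
  "Lpart m = (\<Sum>y | y \<in> twisted K d \<and> y (i + 1) = m. q ^ alen y * z ^ (cyc (y \<circ> d) - cyc d))"

lemma twisted_gf_Lpart: "twisted_gf K d q z = (\<Sum>p\<le>r. Lpart (i + 1 - int p))"
  unfolding twisted_gf_def Lpart_def
  by (rule sum_run)
    (use run_range[OF r twisted_parab[OF adm]] finite_twisted[OF KJ] in \<open>auto simp: algebra_simps\<close>)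

lemma top_notin: "i + 1 \<notin> K"
  using r by (simp add: run_def)

text \<open>Twisted conjugation lowers the image of the top point from m + 1 to m at the cost of q^2
  and leaves \<open>cyc\<close> unchanged. The two divisibility conditions keep
  \<open>refl (d m)\<close> from moving the top point, and d (i + 1) \<noteq> m + 1 excludes the
  swap case.\<close>

lemma Lpart_step:
  assumes m: "m \<in> K" "m \<le> i" and nd: "\<not> N dvd i + 1 - d m" "\<not> N dvd i - d m" and ne: "d (i + 1) \<noteq> m + 1"
  shows "Lpart m = q\<^sup>2 * Lpart (m + 1)"
proof -
  note a = adm_simps[OF adm]
  define t where "t = i + 1"
  have dm: "d m \<in> K" using a m by simp
  have st: "refl (d m) t = t" using nd by (simp add: refl_def t_def algebra_simps)
  define g where "g y = refl m \<circ> y \<circ> refl (d m)" for y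
  have gT: "g y \<in> twisted K d" if "y \<in> twisted K d" for y
    using twisted_conj(1)[OF adm that dm] by (simp add: g_def a)
  have gg: "g (g y) = y" for y by (simp add: g_def fun_eq_iff)
  have gt: "y t = m \<Longrightarrow> g y t = m + 1" "y t = m + 1 \<Longrightarrow> g y t = m" for y
    by (simp_all add: g_def st)
  have "Lpart m = (\<Sum>y | y \<in> twisted K d \<and> y t = m + 1. q ^ alen (g y) * z ^ (cyc (g y \<circ> d) - cyc d))"
    unfolding Lpart_def t_def[symmetric]
    by (rule sum.reindex_bij_witness[where i = g and j = g]) (simp_all add: gT gg gt)
  also have "\<dots> = (\<Sum>y | y \<in> twisted K d \<and> y t = m + 1. q\<^sup>2 * (q ^ alen y * z ^ (cyc (y \<circ> d) - cyc d)))"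
  proof (rule sum.cong[OF refl])
    fix y' assume "y' \<in> {y \<in> twisted K d. y t = m + 1}"
    then have y': "y' \<in> twisted K d" "y' t = m + 1" by auto
    define y where "y = g y'"
    have y: "y \<in> twisted K d" using gT y' by (simp add: y_def)
    have yt: "y t = m" using y' by (simp add: y_def g_def st)
    have y'g: "y' = g y" by (simp add: y_def gg)
    have ya: "y \<in> aperm" by (rule twisted_aperm[OF adm y])
    have fy: "finv y m = t" using inv_aperm_simps(1)[OF ya, of t] yt by simp
    have fyW: "finv y \<in> parab K" by (rule parab_finv[OF twisted_parab[OF adm y]])
    have "finv y (m + 1) \<le> t" using parab_le[OF fyW, of t] top_notin m by (simp add: t_def)
    moreover have "finv y (m + 1) \<noteq> t" using fy aperm_inj[OF inv_aperm[OF ya], of m "m + 1"] by simp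
    ultimately have lt: "finv y (m + 1) < finv y m" using fy by simp
    have fe: "finv y x = d (y (d x))" for x using finv_twisted[OF adm y] by simp
    have e1: "d (finv y m) = y (d m)" "d (finv y (m + 1)) = y (d m + 1)"
      by (simp_all add: fe a m)
    have "y (d m + 1) < y (d m)" using adm_diff[OF adm fyW m(1)] lt e1 by simp
    moreover have "y (d m) \<noteq> d (d m) + 1" using e1(1) fy ne by (simp add: a t_def)
    ultimately have red: "alen y = alen y' + 2" "cyc (y \<circ> d) = cyc (y' \<circ> d)"
      using twisted_reduce_conj[OF adm y dm] unfolding y'g g_def by (simp_all add: a)
    show "q ^ alen (g y') * z ^ (cyc (g y' \<circ> d) - cyc d) = q\<^sup>2 * (q ^ alen y' * z ^ (cyc (y' \<circ> d) - cyc d))"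
      unfolding y_def[symmetric] red by (simp add: power_add power2_eq_square)
  qed
  finally show ?thesis by (simp add: Lpart_def sum_distrib_left t_def)
qed

lemma d_top: "d (i + 1) = d i + 1" "d (i + 1) \<notin> K"
proof -
  note a = adm_simps[OF adm]
  show "d (i + 1) = d i + 1" using a iK by simp
  show "d (i + 1) \<notin> K" using a(5)[of "d (i + 1)"] a(6) top_notin by auto
qed

text \<open>Here d sends the run to a different one modulo N. All images of the top point are then
  linked by twisted conjugation, and if y fixes i + 1 it also fixes d (i + 1), so both runs lose
  their last index.\<close>

lemma twisted_gf_run_side:
  assumes side: "\<not> N dvd d i - i"
  shows "twisted_gf K d q z = qn (q\<^sup>2) (r + 1) * twisted_gf (del (del K i) (d i)) d q z"
proof -
  note a = adm_simps[OF adm]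
  have step: "Lpart m = q\<^sup>2 * Lpart (m + 1)" if m: "m \<in> K" "m \<le> i" "{m..i} \<subseteq> K" for m
  proof (rule Lpart_step[OF m(1,2)])
    show "\<not> N dvd i + 1 - d m" using periodicD[OF a(1), of "i + 1" "d m"] top_notin a(5)[OF m(1)] by blast
    show nd: "\<not> N dvd i - d m"
    proof
      assume h: "N dvd i - d m"
      have "m \<noteq> i" using h side by (metis dvd_minus_iff minus_diff_eq)
      then have "m + 1 \<in> K" using m by auto
      then have "d m + 1 \<in> K" using a(4,5) m(1) by metis
      moreover have "N dvd (i + 1) - (d m + 1)" using h by simp
      ultimately show False using periodicD[OF a(1), of "i + 1" "d m + 1"] top_notin by blast
    qed
    show "d (i + 1) \<noteq> m + 1"
    proof
      assume "d (i + 1) = m + 1"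
      then have "d i = m" using d_top by simp
      then have "d m = i" using a(6) by metis
      with nd show False by simp
    qed
  qed
  have "Lpart (i + 1 - int p) = (q\<^sup>2) ^ p * Lpart (i + 1)" if "p \<le> r" for p
    using that
  proof (induction p)
    case (Suc p)
    have "{i + 1 - int (Suc p)..i} \<subseteq> K" using r Suc.prems by (auto simp: run_def)
    then have "Lpart (i + 1 - int (Suc p)) = q\<^sup>2 * Lpart (i + 1 - int (Suc p) + 1)"
      by (intro step) auto
    also have "i + 1 - int (Suc p) + 1 = i + 1 - int p" by simp
    finally show ?case using Suc by (simp add: mult.assoc)
  qed simp
  then have "twisted_gf K d q z = (\<Sum>p\<le>r. (q\<^sup>2) ^ p) * Lpart (i + 1)"
    unfolding twisted_gf_Lpart by (simp add: sum_distrib_right)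
  moreover have "Lpart (i + 1) = twisted_gf (del (del K i) (d i)) d q z"
  proof -
    have dt: "d i + 1 \<notin> del K i" using d_top del_subset by auto
    have "y (d (i + 1)) = d (i + 1)" if "y \<in> twisted K d" "y (i + 1) = i + 1" for y
    proof -
      have "finv y (i + 1) = i + 1" using inv_aperm_simps(1)[OF twisted_aperm[OF adm that(1)], of "i + 1"] that by simp
      then have "d (y (d (i + 1))) = i + 1" using finv_twisted[OF adm that(1)] by simp
      then show ?thesis using a(6) by metis
    qed
    then have "{y \<in> twisted K d. y (i + 1) = i + 1} = twisted (del (del K i) (d i)) d"
      using parab_del_iff[OF dt] parab_del_iff[OF top_notin] d_top(1) by (auto simp: twisted_def)
    then show ?thesis unfolding Lpart_def twisted_gf_def by simp
  qed
  moreover have "{..r} = {..<r + 1}" by auto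
  ultimately show ?thesis by (simp add: qn_def)
qed

text \<open>A weighted form of the recurrence I(r+1) = I(r) + r I(r-1) for involutions of r + 1
  points: the top point is fixed or swapped with one of r others. All swaps are conjugate to the one
  with i, which costs q z and removes two points.\<close>

lemma twisted_gf_run_fixed:
  assumes fix_i: "d i = i"
  shows "twisted_gf K d q z = twisted_gf (del K i) d q z + q * z * qn (q\<^sup>2) r * twisted_gf (del (del K i) (i - 1)) d q z"
proof -
  note a = adm_simps[OF adm]
  have dfix: "d m = m" if "m \<le> i" "{m..<i} \<subseteq> K" for m
    using adm_translation[OF adm that] fix_i by simp
  have dt: "d (i + 1) = i + 1" using d_top fix_i by simp
  have step: "Lpart m = q\<^sup>2 * Lpart (m + 1)" if m: "m \<in> K" "m < i" "{m..i} \<subseteq> K" for m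
  proof (rule Lpart_step[OF m(1)])
    have dm: "d m = m" using m by (intro dfix) auto
    show "m \<le> i" using m by simp
    show "\<not> N dvd i + 1 - d m"
      using periodicD[OF a(1), of "i + 1" m] top_notin m(1) dm by auto
    show "\<not> N dvd i - d m"
    proof
      assume "N dvd i - d m"
      then have "N dvd (i + 1) - (m + 1)" by (simp add: dm)
      moreover have "m + 1 \<in> K" using m by auto
      ultimately show False using periodicD[OF a(1), of "i + 1" "m + 1"] top_notin by blast
    qed
    show "d (i + 1) \<noteq> m + 1" using dt m by simp
  qed
  have it: "Lpart (i - int p) = (q\<^sup>2) ^ p * Lpart i" if "p < r" for p
    using that
  proof (induction p)
    case (Suc p)
    have "{i - int (Suc p)..i} \<subseteq> K" using r Suc.prems by (auto simp: run_def)
    then have "Lpart (i - int (Suc p)) = q\<^sup>2 * Lpart (i - int (Suc p) + 1)"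
      by (intro step) auto
    also have "i - int (Suc p) + 1 = i - int p" by simp
    finally show ?case using Suc by (simp add: mult.assoc)
  qed simp
  \<comment> \<open>The image i + 1 is split off, because passing from it to the image i is a
    multiplication and not a conjugation.\<close>
  have "twisted_gf K d q z = Lpart (i + 1) + (\<Sum>p<r. Lpart (i - int p))"
    unfolding twisted_gf_Lpart by (subst sum.atMost_shift) (simp add: algebra_simps)
  also have "(\<Sum>p<r. Lpart (i - int p)) = qn (q\<^sup>2) r * Lpart i"
    unfolding qn_def sum_distrib_right by (rule sum.cong) (auto simp: it)
  also have "Lpart (i + 1) = twisted_gf (del K i) d q z"
  proof -
    have "{y \<in> twisted K d. y (i + 1) = i + 1} = twisted (del K i) d"
      using parab_del_iff[OF top_notin] by (auto simp: twisted_def)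
    then show ?thesis unfolding Lpart_def twisted_gf_def by simp
  qed
  also have "Lpart i = q * z * twisted_gf (del (del K i) (i - 1)) d q z"
  proof -
    have ni: "i - 1 + 1 \<notin> del K i" using self_notin_del by simp
    define K2 where "K2 = del (del K i) (i - 1)"
    have K2: "y \<in> parab K2 \<longleftrightarrow> y \<in> parab K \<and> y (i + 1) = i + 1 \<and> y i = i" for y
      unfolding K2_def parab_del_iff[OF ni] parab_del_iff[OF top_notin] by auto
    have bwd: "y \<circ> refl i \<in> twisted K d" if "y \<in> twisted K2 d" for y
    proof -
      have y: "y \<in> twisted K d" "y (i + 1) = i + 1" "y i = i" using that K2 by (auto simp: twisted_def)
      define u where "u = y \<circ> d"
      have u: "u \<in> aperm" "u \<circ> u = id" using twisted_involution[OF adm y(1)] by (simp_all add: u_def)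
      have ui: "u i = i" "u (i + 1) = i + 1" using y fix_i dt by (simp_all add: u_def)
      have e: "(y \<circ> refl i) \<circ> d = u \<circ> refl i" using comp_refl_d[OF adm iK] by (simp add: u_def fix_i)
      have "u \<circ> refl i \<circ> u = refl i" using conj_refl[OF u, of i] ui by simp
      then have "(u \<circ> refl i) \<circ> (u \<circ> refl i) = id" by (metis comp_assoc refl_comp_refl)
      moreover have "y \<circ> refl i \<in> parab K" using twisted_parab[OF adm y(1)] iK a by (simp add: parab_comp parab_refl)
      ultimately show ?thesis unfolding twisted_def e[symmetric] by simp
    qed
    have fwd: "y (d i) = d i + 1 \<and> y \<circ> refl i \<in> twisted K2 d" if y: "y \<in> twisted K d" "y (i + 1) = i" for y
    proof -
      note inv = twisted_involution[OF adm y(1)]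
      have "y (d (y (d (i + 1)))) = i + 1" using involution_simp[OF inv(2), of "i + 1"] by simp
      then have yi: "y i = i + 1" by (simp add: dt y fix_i)
      then have "y \<circ> refl i \<in> twisted K d" using twisted_reduce_swap(1)[OF adm y(1) iK] fix_i by simp
      then have "y \<circ> refl i \<in> twisted K2 d" using yi y K2[of "y \<circ> refl i"] by (simp add: twisted_def)
      then show ?thesis using yi fix_i by simp
    qed
    have "Lpart i = (\<Sum>y\<in>twisted K2 d. q ^ alen (y \<circ> refl i) * z ^ (cyc (y \<circ> refl i \<circ> d) - cyc d))"
      unfolding Lpart_def
      by (rule sum.reindex_bij_witness[where i = "\<lambda>y. y \<circ> refl i" and j = "\<lambda>y. y \<circ> refl i"])
        (use fwd bwd K2 in \<open>auto simp: comp_assoc twisted_def\<close>)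
    also have "\<dots> = (\<Sum>y\<in>twisted K2 d. q * z * (q ^ alen y * z ^ (cyc (y \<circ> d) - cyc d)))"
    proof (rule sum.cong[OF refl])
      fix y assume y: "y \<in> twisted K2 d"
      define y1 where "y1 = y \<circ> refl i"
      have yy: "y = y1 \<circ> refl i" by (simp add: y1_def comp_assoc)
      have y1: "y1 \<in> twisted K d" using bwd[OF y] by (simp add: y1_def)
      have "y1 i = d i + 1" using y K2[of y] by (simp add: twisted_def y1_def fix_i)
      note red = twisted_reduce_swap[OF adm y1 iK this, folded yy]
      have "cyc d \<le> cyc (y \<circ> d)" by (rule twisted_cyc[OF adm red(1)])
      then have "cyc (y1 \<circ> d) - cyc d = Suc (cyc (y \<circ> d) - cyc d)" using red(4) by simp
      then show "q ^ alen (y \<circ> refl i) * z ^ (cyc (y \<circ> refl i \<circ> d) - cyc d) =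
          q * z * (q ^ alen y * z ^ (cyc (y \<circ> d) - cyc d))"
        unfolding y1_def[symmetric] using red(2) by simp
    qed
    finally show ?thesis by (simp add: twisted_gf_def K2_def sum_distrib_left)
  qed
  finally show ?thesis by (simp add: algebra_simps)
qed

end

section \<open>Product formulas for parabolic subgroups\<close>

definition run_length :: "int set \<Rightarrow> int \<Rightarrow> nat" where
  "run_length K i = (LEAST r. i - int r \<notin> K)"

lemma run_length_props: assumes "K \<subseteq> J" shows "{i - int (run_length K i)<..i} \<subseteq> K" "i - int (run_length K i) \<notin> K"
proof -
  \<comment> \<open>The largest multiple of N up to i lies outside K, so the minimum in
    \<open>run_length\<close> exists.\<close>
  have "i - int (nat (i mod N)) = N * (i div N)"
    by (simp add: minus_mod_eq_mult_div)
  then have "i - int (nat (i mod N)) \<notin> K" using assms by (auto simp: J_def)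
  then show "i - int (run_length K i) \<notin> K" unfolding run_length_def by (rule LeastI)
  show "{i - int (run_length K i)<..i} \<subseteq> K"
  proof
    fix m assume m: "m \<in> {i - int (run_length K i)<..i}"
    then have "nat (i - m) < run_length K i" by auto
    from not_less_Least[OF this[unfolded run_length_def]] m show "m \<in> K" by simp
  qed
qed

lemma run_length_eqI: assumes "{i - int r<..i} \<subseteq> K" "i - int r \<notin> K" shows "run_length K i = r"
  unfolding run_length_def
proof (rule Least_equality)
  show "r \<le> y" if "i - int y \<notin> K" for y
  proof (rule ccontr)
    assume "\<not> r \<le> y"
    then have "i - int y \<in> {i - int r<..i}" by simp
    with assms(1) that show False by blast
  qed
qed (rule assms(2))

lemma run_run_length: "K \<subseteq> J \<Longrightarrow> i + 1 \<notin> K \<Longrightarrow> run K i (run_length K i)"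
  using run_length_props by (simp add: run_def)

lemma run_length_cong:
  assumes "periodic K" "K \<subseteq> J" "N dvd i - j" shows "run_length K i = run_length K j"
proof (rule run_length_eqI)
  have e: "m - j + i \<in> K \<longleftrightarrow> m \<in> K" for m
    by (rule periodicD[OF assms(1)]) (use assms(3) in simp)
  show "i - int (run_length K j) \<notin> K" using run_length_props(2)[OF assms(2), of j] e[of "j - int (run_length K j)"] by simp
  show "{i - int (run_length K j)<..i} \<subseteq> K"
  proof
    fix m assume "m \<in> {i - int (run_length K j)<..i}"
    then have "m - i + j \<in> K" using run_length_props(1)[OF assms(2), of j] by auto
    then show "m \<in> K" using e[of "m - i + j"] by simp
  qed
qed

lemma run_length_del:
  assumes K: "periodic K" "K \<subseteq> J" and i: "i + 1 \<notin> K" and j: "j \<in> del K i"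
  shows "run_length (del K i) j = run_length K j"
proof (rule run_length_eqI)
  show "j - int (run_length K j) \<notin> del K i" using run_length_props(2)[OF K(2)] del_subset by blast
  show "{j - int (run_length K j)<..j} \<subseteq> del K i"
  proof
    fix m assume m: "m \<in> {j - int (run_length K j)<..j}"
    then have mK: "m \<in> K" using run_length_props(1)[OF K(2)] by blast
    show "m \<in> del K i"
    proof (cases "m = j")
      case False
      then have "m + 1 \<in> K" using m run_length_props(1)[OF K(2), of j] by auto
      then have "\<not> N dvd (m + 1) - (i + 1)" using periodicD[OF K(1)] i by blast
      then show ?thesis using mK by (simp add: del_def)
    qed (use j in simp)
  qed
qed

lemma run_length_pos: assumes "K \<subseteq> J" "i \<in> K" shows "run_length K i > 0"
  using run_length_props(2)[OF assms(1), of i] assms(2) by (cases "run_length K i") auto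

lemma run_length_adm:
  assumes adm: "adm K d" and K: "K \<subseteq> J" and i: "i \<in> K"
  shows "run_length K (d i) = run_length K i"
proof (rule run_length_eqI)
  note a = adm_simps[OF adm]
  define r where "r = run_length K i"
  note p = run_length_props[OF K, of i, folded r_def]
  have r: "r > 0" using run_length_pos[OF K i] by (simp add: r_def)
  have tr: "d m = d i - (i - m)" if "m \<in> {i - int r<..i}" for m
  proof -
    have "{m..<i} \<subseteq> K" using p(1) that by auto
    then show ?thesis using adm_translation[OF adm, of m i] that by simp
  qed
  show "{d i - int (run_length K i)<..d i} \<subseteq> K"
  proof
    fix m assume m: "m \<in> {d i - int (run_length K i)<..d i}"
    then have e: "i - (d i - m) \<in> {i - int r<..i}" by (auto simp: r_def)
    have "d (i - (d i - m)) = m" using tr[OF e] by simp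
    moreover have "i - (d i - m) \<in> K" using e p(1) by blast
    ultimately show "m \<in> K" using a(5) by metis
  qed
  show "d i - int (run_length K i) \<notin> K"
  proof
    assume h: "d i - int (run_length K i) \<in> K"
    have "d (i - int r + 1) = d i - int r + 1" using tr[of "i - int r + 1"] r by simp
    then have "d (d i - int r + 1) = i - int r + 1" using a(6) by metis
    then have "d (d i - int r) = i - int r" using a(4)[OF h] by (simp add: r_def)
    then have "i - int r \<in> K" using a(5)[OF h] by (simp add: r_def)
    with p(2) show False by simp
  qed
qed

text \<open>Along a run of length r the factors are [2], ..., [r + 1], so a component of type A_r
  contributes the q-factorial of r + 1.\<close>

definition Pprod :: "int set \<Rightarrow> 'a::comm_ring_1 \<Rightarrow> 'a" where
  "Pprod K q = (\<Prod>i\<in>K \<inter> {1..N}. qn q (run_length K i + 1))"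

text \<open>Factors of the denominator in Lusztig's evaluation. A run fixed by d contributes
  q-integers in q; of two runs exchanged by d modulo N, the condition i < d i lets exactly one
  contribute, in q^2.\<close>

definition Cfac :: "int set \<Rightarrow> (int \<Rightarrow> int) \<Rightarrow> 'a::comm_ring_1 \<Rightarrow> int \<Rightarrow> 'a" where
  "Cfac K d q i = (if d i = i then qn q (run_length K i + 1) else if i < d i then qn (q\<^sup>2) (run_length K i + 1) else 1)"

definition Cprod :: "int set \<Rightarrow> (int \<Rightarrow> int) \<Rightarrow> 'a::comm_ring_1 \<Rightarrow> 'a" where
  "Cprod K d q = (\<Prod>i\<in>K \<inter> {1..N}. Cfac K d q i)"

lemma del_window: assumes "i \<in> {1..N}" shows "del K i \<inter> {1..N} = K \<inter> {1..N} - {i}"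
proof -
  have "\<not> N dvd j - i" if "j \<in> {1..N}" "j \<noteq> i" for j
    using that assms zdvd_imp_le[of N "j - i"] zdvd_imp_le[of N "i - j"]
    by (cases "i < j") (auto simp: dvd_diff_commute)
  then show ?thesis by (auto simp: del_def)
qed

lemma top_remove:
  fixes q :: "'a::comm_ring_1"
  assumes K: "periodic K" "K \<subseteq> J" and i: "i \<in> K" "i \<in> {1..N}" "i + 1 \<notin> K"
  shows "Pprod K q = qn q (run_length K i + 1) * Pprod (del K i) q"
    "Cprod K d q = Cfac K d q i * Cprod (del K i) d q"
proof -
  have fin: "finite (K \<inter> {1..N})" "i \<in> K \<inter> {1..N}" using i by auto
  have e: "run_length (del K i) j = run_length K j" if "j \<in> K \<inter> {1..N} - {i}" for j
  proof (rule run_length_del[OF K i(3)])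
    show "j \<in> del K i" using that del_window[OF i(2), of K] by blast
  qed
  then have e': "Cfac (del K i) d q j = Cfac K d q j" if "j \<in> K \<inter> {1..N} - {i}" for j
    using that by (simp add: Cfac_def)
  show "Pprod K q = qn q (run_length K i + 1) * Pprod (del K i) q"
    unfolding Pprod_def del_window[OF i(2)] by (subst prod.remove[OF fin]) (simp add: e)
  show "Cprod K d q = Cfac K d q i * Cprod (del K i) d q"
    unfolding Cprod_def del_window[OF i(2)] by (subst prod.remove[OF fin]) (simp add: e')
qed

lemma rep_window: obtains j where "j \<in> {1..N}" "N dvd i - j"
proof (rule window_repr[of i])
  fix r k assume "i = r + N * k" "r \<in> {1..N}"
  then show ?thesis using that[of r] by simp
qed

lemma window_empty: assumes "periodic K" "K \<inter> {1..N} = {}" shows "K = {}"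
proof (rule ccontr)
  assume "K \<noteq> {}"
  then obtain i where "i \<in> K" by blast
  moreover obtain j where j: "j \<in> {1..N}" "N dvd i - j" by (rule rep_window)
  ultimately have "j \<in> K" using periodicD[OF assms(1) j(2)] by simp
  with j assms(2) show False by blast
qed

lemma top_exists:
  assumes K: "periodic K" "K \<subseteq> J" "K \<inter> {1..N} \<noteq> {}"
  obtains i where "i \<in> K" "i \<in> {1..N}" "i + 1 \<notin> K"
proof -
  define i where "i = Max (K \<inter> {1..N})"
  have i: "i \<in> K \<inter> {1..N}" unfolding i_def by (rule Max_in) (use K in auto)
  have "i + 1 \<notin> K"
  proof
    assume h: "i + 1 \<in> K"
    have "i \<noteq> N" using i K(2) by (auto simp: J_def)
    then have "i + 1 \<in> K \<inter> {1..N}" using i h by auto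
    then have "i + 1 \<le> i" unfolding i_def by (intro Max_ge) auto
    then show False by simp
  qed
  with i that show ?thesis by blast
qed

lemma parab_empty: "parab {} = {id}"
  using parab_no_descent[of _ "{}"] by auto

lemma twisted_empty: assumes "d \<circ> d = id" shows "twisted {} d = {id}"
  using assms by (auto simp: twisted_def parab_empty)

lemma del_card:
  assumes "i \<in> K" "i \<in> {1..N}" shows "card (del K i \<inter> {1..N}) < card (K \<inter> {1..N})"
  unfolding del_window[OF assms(2)] by (rule card_Diff1_less) (use assms in simp_all)

lemma length_gf_Pprod:
  fixes q :: "'a::comm_ring_1"
  assumes "periodic K" "K \<subseteq> J" shows "length_gf K q = Pprod K q"
  using assms
proof (induction "card (K \<inter> {1..N})" arbitrary: K rule: less_induct)
  case less
  show "length_gf K q = Pprod K q"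
  proof (cases "K \<inter> {1..N} = {}")
    case True
    then have "K = {}" using window_empty less.prems by blast
    then show ?thesis by (simp add: length_gf_def Pprod_def parab_empty)
  next
    case False
    then obtain i where i: "i \<in> K" "i \<in> {1..N}" "i + 1 \<notin> K"
      using top_exists[OF less.prems False] by metis
    have "length_gf (del K i) q = Pprod (del K i) q"
    proof (rule less.hyps[OF del_card[OF i(1,2)] periodic_del[OF less.prems(1)]])
      show "del K i \<subseteq> J" using less.prems(2) del_subset[of K i] by (rule subset_trans[rotated])
    qed
    then show ?thesis
      unfolding length_gf_run[OF less.prems run_run_length[OF less.prems(2) i(3)], of q]
        top_remove(1)[OF less.prems i, of q] by (simp only:)
  qed
qed

lemma del_cong: "N dvd i - j \<Longrightarrow> del K i = del K j"
proof -
  assume d: "N dvd i - j"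
  have "N dvd m - i \<longleftrightarrow> N dvd m - j" for m
    using dvd_add_right_iff[OF d, of "m - i"] by simp
  then show ?thesis by (simp add: del_def)
qed

lemma adm_del:
  assumes adm: "adm K d" shows "N dvd d i - i \<Longrightarrow> adm (del K i) d" "adm (del (del K i) (d i)) d"
proof -
  note a = adm_simps[OF adm]
  have e: "N dvd d j - i \<longleftrightarrow> N dvd j - d i" for i j using aperm_dvd_diff[OF a(2), of j "d i"] by (simp add: a(6))
  show "adm (del K i) d" if "N dvd d i - i"
  proof -
    have "N dvd j - d i \<longleftrightarrow> N dvd j - i" for j
      using dvd_add_right_iff[OF that, of "j - d i"] by simp
    then show ?thesis using adm periodic_del e by (auto simp: adm_def del_def)
  qed
  show "adm (del (del K i) (d i)) d"
    using adm periodic_del[OF periodic_del] e a(6) by (auto simp: adm_def del_def)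
qed

text \<open>Lusztig's evaluation of the weighted sum over twisted involutions for parabolic subgroups
  of type A.\<close>

lemma twisted_gf_Cprod:
  fixes q z :: "'a::idom"
  assumes z: "z * (1 + q) = q - 1" "1 + q \<noteq> 0"
    and "adm K d" "K \<subseteq> J"
  shows "twisted_gf K d q z * Cprod K d q = Pprod K (q\<^sup>2)"
  using assms(3,4)
proof (induction "card (K \<inter> {1..N})" arbitrary: K rule: less_induct)
  case less
  note adm = less.prems(1) and KJ = less.prems(2)
  note a = adm_simps[OF adm]
  show "twisted_gf K d q z * Cprod K d q = Pprod K (q\<^sup>2)"
  proof (cases "K \<inter> {1..N} = {}")
    case True
    then have "K = {}" using window_empty a by blast
    then show ?thesis by (simp add: twisted_gf_def Pprod_def Cprod_def twisted_empty a(3))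
  next
    case False
    then obtain i where i: "i \<in> K" "i \<in> {1..N}" "i + 1 \<notin> K"
      using top_exists[OF a(1) KJ False] by metis
    define r where "r = run_length K i"
    define K1 where "K1 = del K i"
    have run: "run K i r" using run_run_length[OF KJ i(3)] by (simp add: r_def)
    note rem = top_remove[OF a(1) KJ i, folded r_def K1_def]
    have K1: "K1 \<subseteq> J" "periodic K1" using KJ del_subset periodic_del[OF a(1)] by (auto simp: K1_def)
    have cK1: "card (K1 \<inter> {1..N}) < card (K \<inter> {1..N})" unfolding K1_def by (rule del_card[OF i(1,2)])
    have dJ: "del K1 j \<subseteq> J" for j using del_subset[of K1 j] K1(1) by blast
    have cdel: "card (del K1 j \<inter> {1..N}) < card (K \<inter> {1..N})" for j
      by (rule le_less_trans[OF card_mono cK1]) (use del_subset in auto)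
    show ?thesis
    proof (cases "N dvd d i - i")
      case True
      then have di: "d i = i" using involution_fix[OF a(2,3)] by simp
      define K2 where "K2 = del K1 (i - 1)"
      have adm1: "adm K1 d" unfolding K1_def by (rule adm_del(1)[OF adm True])
      \<comment> \<open>A run of length one has no second index to delete; then K2 = K1 and the
        formulas hold because the factors for r = 1 are 1.\<close>
      have CP: "Cprod K1 d q = qn q r * Cprod K2 d q \<and> Pprod K1 (q\<^sup>2) = qn (q\<^sup>2) r * Pprod K2 (q\<^sup>2) \<and> adm K2 d"
      proof (cases "i - 1 \<in> K")
        case True
        have "i - 1 \<noteq> 0" using True KJ by (auto simp: J_def)
        then have i1: "i - 1 \<in> {1..N}" using i by auto
        have in1: "i - 1 \<in> K1" using True by (simp add: K1_def del_def)
        have "i - 1 + 1 \<notin> K1" using self_notin_del by (simp add: K1_def)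
        note rem1 = top_remove[OF K1(2,1) in1 i1 this, folded K2_def]
        have r2: "r > 1"
          using run_length_props(2)[OF KJ, of i] True run_length_pos[OF KJ i(1)] by (cases "r = 1") (auto simp: r_def)
        have "run_length K1 (i - 1) = r - 1"
        proof -
          have "run_length K1 (i - 1) = run_length K (i - 1)"
            using run_length_del[OF a(1) KJ i(3)] in1 by (simp add: K1_def)
          also have "run_length K (i - 1) = r - 1"
            using run_length_props[OF KJ, of i] r2 by (intro run_length_eqI) (auto simp: r_def of_nat_diff)
          finally show ?thesis .
        qed
        then have e: "run_length K1 (i - 1) + 1 = r" using r2 by simp
        have d1: "d (i - 1) = i - 1" using a(4)[OF True] di by simp
        then have "adm K2 d" unfolding K2_def by (intro adm_del(1)[OF adm1]) simp
        then show ?thesis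
          using rem1(1)[of "q\<^sup>2"] rem1(2)[of d q] e d1 by (simp add: Cfac_def)
      next
        case False
        have "{i - 1<..i} = {i}" by auto
        then have "r = 1" unfolding r_def by (intro run_length_eqI) (use False i in auto)
        moreover have "\<not> N dvd j - (i - 1)" if "j \<in> K1" for j
          using periodicD[OF a(1), of j "i - 1"] that False del_subset by (auto simp: K1_def)
        then have "K2 = K1" by (auto simp: K2_def del_def)
        ultimately show ?thesis using adm1 by simp
      qed
      have IH1: "twisted_gf K1 d q z * Cprod K1 d q = Pprod K1 (q\<^sup>2)" by (rule less.hyps[OF cK1 adm1 K1(1)])
      have IH2: "twisted_gf K2 d q z * Cprod K2 d q = Pprod K2 (q\<^sup>2)"
        by (rule less.hyps) (use cdel CP dJ in \<open>auto simp: K2_def\<close>)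
      have L: "twisted_gf K d q z = twisted_gf K1 d q z + q * z * qn (q\<^sup>2) r * twisted_gf K2 d q z"
        using twisted_gf_run_fixed[OF adm KJ run i(1) di] by (simp add: K1_def K2_def)
      have "twisted_gf K d q z * Cprod K d q =
          qn q (Suc r) * (twisted_gf K1 d q z * Cprod K1 d q + q * z * qn (q\<^sup>2) r * (twisted_gf K2 d q z * Cprod K1 d q))"
        unfolding L rem by (simp add: Cfac_def di r_def[symmetric] algebra_simps)
      also have "twisted_gf K2 d q z * Cprod K1 d q = qn q r * Pprod K2 (q\<^sup>2)"
        using CP IH2 by (simp add: algebra_simps)
      also have "twisted_gf K1 d q z * Cprod K1 d q = qn (q\<^sup>2) r * Pprod K2 (q\<^sup>2)"
        using CP IH1 by simp
      also have "qn q (Suc r) * (qn (q\<^sup>2) r * Pprod K2 (q\<^sup>2) + q * z * qn (q\<^sup>2) r * (qn q r * Pprod K2 (q\<^sup>2))) =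
          (qn q (Suc r) * (1 + q * z * qn q r)) * (qn (q\<^sup>2) r * Pprod K2 (q\<^sup>2))"
        by (simp add: algebra_simps)
      \<comment> \<open>\<open>qn_absorb\<close> joins the contributions of fixed and swapped top
        points, using z = (q - 1) / (q + 1).\<close>
      also have "\<dots> = qn (q\<^sup>2) (Suc r) * Pprod K1 (q\<^sup>2)" unfolding qn_absorb[OF z] using CP by simp
      also have "\<dots> = Pprod K (q\<^sup>2)" unfolding rem by simp
      finally show ?thesis .
    next
      case side: False
      obtain j where j: "j \<in> {1..N}" "N dvd d i - j" by (rule rep_window)
      obtain k where k: "d i = j + N * k" using j(2) by (rule dvd_shiftE)
      have dj: "d j = i - N * k"
        using aperm_shift_mult[OF a(2), of j k] a(6)[of i] by (simp flip: k)
      define K2 where "K2 = del K1 j"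
      have K2: "K2 = del (del K i) (d i)" using del_cong[OF j(2)] by (simp add: K2_def K1_def)
      have jK: "j \<in> K" using periodicD[OF a(1) j(2)] a(5)[OF i(1)] by simp
      have nji: "\<not> N dvd j - i"
      proof
        assume "N dvd j - i"
        then have "N dvd (d i - j) + (j - i)" using j(2) by (rule dvd_add[rotated])
        with side show False by simp
      qed
      then have j1: "j \<in> K1" using jK by (simp add: K1_def del_def)
      have "d i + 1 \<notin> K" using d_top[OF adm KJ run i(1)] by simp
      moreover have "N dvd (d i + 1) - (j + 1)" using j(2) by simp
      ultimately have "j + 1 \<notin> K" using periodicD[OF a(1)] by blast
      then have jt: "j + 1 \<notin> K1" using del_subset by (auto simp: K1_def)
      note rem1 = top_remove[OF K1(2,1) j1 j(1) jt, folded K2_def]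
      have rj: "run_length K1 j = r"
      proof -
        have "run_length K1 j = run_length K j" using run_length_del[OF a(1) KJ i(3)] j1 by (simp add: K1_def)
        also have "\<dots> = run_length K (d i)" using run_length_cong[OF a(1) KJ j(2)] by simp
        also have "\<dots> = r" using run_length_adm[OF adm KJ i(1)] by (simp add: r_def)
        finally show ?thesis .
      qed
      have ne: "d i \<noteq> i" using side by auto
      \<comment> \<open>With d i = j + N k and d j = i - N k for i, j in the window, exactly one of
        i < d i and j < d j holds.\<close>
      have C: "Cfac K d q i * Cfac K1 d q j = qn (q\<^sup>2) (r + 1)"
        using ne k dj by (auto simp: Cfac_def rj r_def[symmetric])
      have adm2: "adm K2 d" unfolding K2 by (rule adm_del(2)[OF adm])
      have IH: "twisted_gf K2 d q z * Cprod K2 d q = Pprod K2 (q\<^sup>2)"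
        by (rule less.hyps[OF _ adm2]) (use cdel dJ in \<open>auto simp: K2_def\<close>)
      have "twisted_gf K d q z * Cprod K d q =
          qn (q\<^sup>2) (r + 1) * twisted_gf K2 d q z * (Cfac K d q i * Cfac K1 d q j * Cprod K2 d q)"
        unfolding rem rem1 twisted_gf_run_side[OF adm KJ run i(1) side] K2[symmetric] by (simp add: algebra_simps)
      also have "\<dots> = qn (q\<^sup>2) (r + 1) * (qn (q\<^sup>2) (r + 1) * (twisted_gf K2 d q z * Cprod K2 d q))"
        unfolding C by (simp add: algebra_simps)
      also have "\<dots> = Pprod K (q\<^sup>2)" unfolding rem rem1 rj IH by simp
      finally show ?thesis .
    qed
  qed
qed

end

subsection \<open>Basic hypergeometric identities\<close>

definition qfact :: "'a::comm_ring_1 \<Rightarrow> nat \<Rightarrow> 'a" where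
  "qfact q m = (\<Prod>p<m. qn q (p + 1))"

definition qpoch :: "'a::comm_ring_1 \<Rightarrow> 'a \<Rightarrow> nat \<Rightarrow> 'a" where
  "qpoch y q m = (\<Prod>p<m. 1 - y * q ^ p)"

lemma qfact_0 [simp]: "qfact q 0 = 1" and qfact_Suc: "qfact q (Suc m) = qfact q m * qn q (Suc m)"
  by (simp_all add: qfact_def)

lemma qpoch_0 [simp]: "qpoch y q 0 = 1" and qpoch_Suc: "qpoch y q (Suc m) = qpoch y q m * (1 - y * q ^ m)"
  by (simp_all add: qpoch_def)

lemma qpoch_add: "qpoch y q (a + b) = qpoch y q a * qpoch (y * q ^ a) q b"
  by (induction b) (simp_all add: qpoch_Suc power_add algebra_simps)

lemma qfact_qpoch: "qfact q m * (1 - q) ^ m = (qpoch q q m :: 'a::comm_ring_1)"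
proof (induction m)
  case (Suc m)
  have "qn q (Suc m) * (1 - q) = 1 - q * q ^ m"
    using qn_geometric[of q "Suc m"] by (simp add: algebra_simps)
  moreover have "qfact q (Suc m) * (1 - q) ^ Suc m = (qfact q m * (1 - q) ^ m) * (qn q (Suc m) * (1 - q))"
    by (simp only: qfact_Suc power_Suc mult_ac)
  ultimately have "qfact q (Suc m) * (1 - q) ^ Suc m = (qfact q m * (1 - q) ^ m) * (1 - q * q ^ m)"
    by (simp only:)
  then show ?case by (simp add: Suc qpoch_Suc)
qed simp

lemma qn_add: "qn q (a + b) = qn q a + q ^ a * (qn q b :: 'a::comm_ring_1)"
  by (induction b) (simp_all add: qn_Suc power_add algebra_simps)

text \<open>With \<open>g m\<close> playing the role of the inverse of \<open>qfact q m\<close>, this is the identity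
  \<open>\<Sum>x\<le>m. [m choose x] y\<^bsup>m-x\<^esup> (y; q)\<^sub>x = 1\<close>.\<close>

lemma qbinomial_sum:
  fixes g :: "nat \<Rightarrow> 'a::idom"
  assumes g: "\<And>m. g m = qn q (Suc m) * g (Suc m)" and nz: "\<And>m. qn q (Suc m) \<noteq> 0" and g0: "g 0 = 1"
  shows "(\<Sum>x\<le>m. y ^ (m - x) * qpoch y q x * g x * g (m - x)) = g m"
proof (induction m)
  case (Suc m)
  define F where "F x = y ^ (Suc m - x) * qpoch y q x * g x * g (Suc m - x)" for x
  \<comment> \<open>The q-Pascal rule [m+1] = [x] + q^x [m+1-x]; its two parts become sums for m
    with the weights 1 - y q^x and y q^x, which add up to 1.\<close>
  have split: "qn q (Suc m) * F x = qn q x * F x + q ^ x * qn q (Suc m - x) * F x" if "x \<le> Suc m" for x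
    using qn_add[of q x "Suc m - x"] that by (simp add: algebra_simps)
  have 1: "(\<Sum>x\<le>Suc m. qn q x * F x) = (\<Sum>x\<le>m. y ^ (m - x) * qpoch y q x * g x * g (m - x) * (1 - y * q ^ x))"
  proof -
    have "qn q (Suc x) * F (Suc x) = y ^ (m - x) * qpoch y q x * g x * g (m - x) * (1 - y * q ^ x)" for x
    proof -
      have "qn q (Suc x) * F (Suc x) =
          y ^ (m - x) * (qpoch y q x * (1 - y * q ^ x)) * (qn q (Suc x) * g (Suc x)) * g (m - x)"
        by (simp only: F_def qpoch_Suc diff_Suc_Suc mult_ac)
      then show ?thesis unfolding g[of x, symmetric] by (simp only: mult_ac)
    qed
    then show ?thesis by (simp only: sum.atMost_Suc_shift qn_0 mult_zero_left add_0)
  qed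
  have 2: "(\<Sum>x\<le>Suc m. q ^ x * qn q (Suc m - x) * F x) = (\<Sum>x\<le>m. y ^ (m - x) * qpoch y q x * g x * g (m - x) * (y * q ^ x))"
  proof -
    have "(\<Sum>x\<le>Suc m. q ^ x * qn q (Suc m - x) * F x) = (\<Sum>x\<le>m. q ^ x * qn q (Suc m - x) * F x)" by simp
    also have "\<dots> = (\<Sum>x\<le>m. y ^ (m - x) * qpoch y q x * g x * g (m - x) * (y * q ^ x))"
    proof (rule sum.cong[OF refl])
      fix x assume "x \<in> {..m}"
      then have e: "Suc m - x = Suc (m - x)" by (simp add: Suc_diff_le)
      have "q ^ x * qn q (Suc m - x) * F x =
          q ^ x * (y * y ^ (m - x)) * qpoch y q x * g x * (qn q (Suc (m - x)) * g (Suc (m - x)))"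
        by (simp only: F_def e power_Suc mult_ac)
      then show "q ^ x * qn q (Suc m - x) * F x =
          y ^ (m - x) * qpoch y q x * g x * g (m - x) * (y * q ^ x)"
        unfolding g[of "m - x", symmetric] by (simp only: mult_ac)
    qed
    finally show ?thesis .
  qed
  have "qn q (Suc m) * (\<Sum>x\<le>Suc m. F x) = (\<Sum>x\<le>Suc m. qn q x * F x + q ^ x * qn q (Suc m - x) * F x)"
    unfolding sum_distrib_left by (rule sum.cong[OF refl]) (rule split, simp)
  also have "\<dots> = (\<Sum>x\<le>m. y ^ (m - x) * qpoch y q x * g x * g (m - x) * (1 - y * q ^ x)) +
      (\<Sum>x\<le>m. y ^ (m - x) * qpoch y q x * g x * g (m - x) * (y * q ^ x))"
    unfolding sum.distrib 1 2 ..
  also have "\<dots> = (\<Sum>x\<le>m. y ^ (m - x) * qpoch y q x * g x * g (m - x))"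
    unfolding sum.distrib[symmetric] by (rule sum.cong[OF refl]) (simp add: algebra_simps)
  also have "\<dots> = qn q (Suc m) * g (Suc m)" using Suc g[of m] by simp
  finally show ?case using nz by (simp add: F_def)
qed (simp add: g0)

section \<open>Sums over lists of multiplicities\<close>

fun wt :: "nat list \<Rightarrow> nat" where
  "wt [] = 0"
| "wt (x # b) = wt b + sum_list b"

text \<open>\<open>wt b\<close> is \<Sum> i * b ! i with i counted from 0, and \<open>en b\<close>
  is the sum of (|i - j| - 1) b_i b_j over i \<noteq> j (\<open>wt_sum\<close>,
  \<open>en_sum\<close>). Both enter the length of the representative with multiplicities b; the
  recursive form suits splitting off the head.\<close>

fun en :: "nat list \<Rightarrow> nat" where
  "en [] = 0"
| "en (x # b) = en b + 2 * x * wt b"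

definition clists :: "nat \<Rightarrow> nat \<Rightarrow> nat list set" where
  "clists h m = {b. length b = h \<and> sum_list b = m}"

lemma clists_0: "clists 0 m = (if m = 0 then {[]} else {})"
  by (auto simp: clists_def)

lemma clists_Suc: "clists (Suc h) m = (\<Union>x\<le>m. (#) x ` clists h (m - x))"
proof safe
  fix b assume b: "b \<in> clists (Suc h) m"
  then obtain x c where "b = x # c" by (cases b) (auto simp: clists_def)
  with b show "b \<in> (\<Union>x\<le>m. (#) x ` clists h (m - x))"
    by (intro UN_I[of x] image_eqI[of _ _ c]) (auto simp: clists_def)
qed (auto simp: clists_def)

lemma finite_clists: "finite (clists h m)"
  by (induction h arbitrary: m) (auto simp: clists_0 clists_Suc)

lemma clists_zero: "clists h 0 = {replicate h 0}"
proof -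
  have "b = replicate (length b) 0" if "sum_list b = 0" for b :: "nat list"
    using that by (induction b) auto
  then show ?thesis by (force simp: clists_def sum_list_replicate)
qed

lemma wt_replicate_0 [simp]: "wt (replicate h 0) = 0" "en (replicate h 0) = 0"
  by (induction h) (simp_all add: sum_list_replicate)

abbreviation qX :: "'a::field fps" where "qX \<equiv> fps_X"

definition inv_qfact :: "'a::field fps \<Rightarrow> nat \<Rightarrow> 'a fps" where
  "inv_qfact q m = inverse (qfact q m)"

lemma fps_nth_0_qn: "q $ 0 = 0 \<Longrightarrow> qn q (Suc m) $ 0 = (1 :: 'a::field)"
  by (simp add: qn_def fps_sum_nth fps_nth_power_0 power_0_left lessThan_Suc_eq_insert_0 sum.reindex)

lemma fps_nth_0_qfact: "q $ 0 = 0 \<Longrightarrow> qfact q m $ 0 = (1 :: 'a::field)"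
  by (induction m) (simp_all add: qfact_Suc fps_nth_0_qn)

lemma fps_nth_0_qpoch: "y $ 0 = 0 \<Longrightarrow> qpoch y q m $ 0 = (1 :: 'a::field)"
  by (induction m) (simp_all add: qpoch_Suc)

lemma fps_mult_inverse: "f $ 0 \<noteq> 0 \<Longrightarrow> f * inverse f = (1 :: 'a::field fps)"
  by (simp add: inverse_mult_eq_1')

lemma inv_qfact_mult: "q $ 0 = 0 \<Longrightarrow> qfact q m * inv_qfact q m = 1"
  unfolding inv_qfact_def by (rule fps_mult_inverse) (simp add: fps_nth_0_qfact)

lemma inv_qfact_Suc: assumes "q $ 0 = 0" shows "inv_qfact q m = qn q (Suc m) * inv_qfact q (Suc m)"
proof -
  have "inv_qfact q m = inv_qfact q m * (qfact q (Suc m) * inv_qfact q (Suc m))" using inv_qfact_mult[OF assms] by simp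
  also have "\<dots> = (qfact q m * inv_qfact q m) * (qn q (Suc m) * inv_qfact q (Suc m))" by (simp add: qfact_Suc algebra_simps)
  finally show ?thesis using inv_qfact_mult[OF assms] by simp
qed

lemma fps_nz: "f $ 0 \<noteq> 0 \<Longrightarrow> f \<noteq> 0" for f :: "'a::field fps"
  by auto

text \<open>The parameter j is free in order to absorb the cross terms with a removed head.\<close>

definition Aser :: "nat \<Rightarrow> nat \<Rightarrow> nat \<Rightarrow> 'a::field fps" where
  "Aser h m j = (\<Sum>b\<in>clists h m. qX ^ (en b + j * wt b) * inverse (\<Prod>x\<leftarrow>b. qfact (qX\<^sup>2) x))"

text \<open>The limit of \<open>Aser h m j\<close> as h grows, for j > 0 (\<open>Aser_Bser\<close>):
  with Q = q^2, the reciprocal of [m]_Q! (q^j; Q)_m.\<close>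

definition Bser :: "nat \<Rightarrow> nat \<Rightarrow> 'a::field fps" where
  "Bser m j = inv_qfact (qX\<^sup>2) m * inverse (qpoch (qX ^ j) (qX\<^sup>2) m)"

text \<open>Removing the head x lowers every other index by one, hence \<open>wt\<close> by m - x,
  and the cross term 2 x wt b of \<open>en\<close> turns j into j + 2 x.\<close>

lemma Aser_Suc: "(Aser (Suc h) m j :: 'a::field fps) = (\<Sum>x\<le>m. inv_qfact (qX\<^sup>2) x * qX ^ (j * (m - x)) * Aser h (m - x) (j + 2 * x))"
proof -
  have "(Aser (Suc h) m j :: 'a fps) = (\<Sum>x\<le>m. \<Sum>b\<in>(#) x ` clists h (m - x). qX ^ (en b + j * wt b) * inverse (\<Prod>x\<leftarrow>b. qfact (qX\<^sup>2) x))"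
    unfolding Aser_def clists_Suc by (rule sum.UNION_disjoint) (auto simp: finite_clists)
  also have "\<dots> = (\<Sum>x\<le>m. \<Sum>b\<in>clists h (m - x). qX ^ (en (x # b) + j * wt (x # b)) * inverse (\<Prod>x\<leftarrow>x # b. qfact (qX\<^sup>2) x))"
    by (rule sum.cong[OF refl], subst sum.reindex) (auto simp: inj_on_def)
  also have "\<dots> = (\<Sum>x\<le>m. inv_qfact (qX\<^sup>2) x * qX ^ (j * (m - x)) * Aser h (m - x) (j + 2 * x))"
  proof (rule sum.cong[OF refl])
    fix x
    have eq: "qX ^ (en (x # b) + j * wt (x # b)) * inverse (\<Prod>x\<leftarrow>x # b. qfact (qX\<^sup>2) x) =
        inv_qfact (qX\<^sup>2) x * qX ^ (j * (m - x)) * (qX ^ (en b + (j + 2 * x) * wt b) * inverse (\<Prod>x\<leftarrow>b. qfact (qX\<^sup>2) x) :: 'a fps)"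
      if b: "b \<in> clists h (m - x)" for b
    proof -
      have "sum_list b = m - x" using b by (simp add: clists_def)
      then have e: "en (x # b) + j * wt (x # b) = j * (m - x) + (en b + (j + 2 * x) * wt b)"
        by (simp add: algebra_simps)
      show ?thesis unfolding e power_add by (simp add: inv_qfact_def fps_inverse_mult algebra_simps)
    qed
    show "(\<Sum>b\<in>clists h (m - x). qX ^ (en (x # b) + j * wt (x # b)) * inverse (\<Prod>x\<leftarrow>x # b. qfact (qX\<^sup>2) x)) =
        inv_qfact (qX\<^sup>2) x * qX ^ (j * (m - x)) * (Aser h (m - x) (j + 2 * x) :: 'a fps)"
      unfolding Aser_def sum_distrib_left by (rule sum.cong[OF refl eq])
  qed
  finally show ?thesis .
qed

lemma Aser_zero: "Aser h 0 j = (1 :: 'a::field fps)"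
  by (simp add: Aser_def clists_zero map_replicate_const prod_list_replicate)

lemma Bser_zero: "Bser 0 j = (1 :: 'a::field fps)"
  by (simp add: Bser_def inv_qfact_def)

text \<open>The identity of \<open>qbinomial_sum\<close> in base q^2 with y = q^j, divided by (y;
  q^2)_m: the symbol starting at y q^(2x) is a tail of (y; q^2)_m.\<close>

lemma Bser_rec:
  assumes j: "j > 0"
  shows "(Bser m j :: 'a::field fps) = (\<Sum>x\<le>m. inv_qfact (qX\<^sup>2) x * qX ^ (j * (m - x)) * Bser (m - x) (j + 2 * x))"
proof -
  define Q :: "'a fps" where "Q = qX\<^sup>2"
  define y :: "'a fps" where "y = qX ^ j"
  have Q0: "Q $ 0 = 0" by (simp add: Q_def)
  have y0: "y $ 0 = 0" using j by (simp add: y_def fps_nth_power_0)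
  have P: "qpoch y Q x * inverse (qpoch y Q x) = 1" for x
    by (rule fps_mult_inverse) (simp add: fps_nth_0_qpoch y0)
  have B: "Bser (m - x) (j + 2 * x) = inv_qfact Q (m - x) * (qpoch y Q x * inverse (qpoch y Q m))" if "x \<le> m" for x
  proof -
    have y0': "(y * Q ^ x) $ 0 = 0" using y0 by simp
    have e: "qX ^ (j + 2 * x) = y * Q ^ x" by (simp add: y_def Q_def power_add power_mult)
    have "qpoch y Q m = qpoch y Q x * qpoch (y * Q ^ x) Q (m - x)" using qpoch_add[of y Q x "m - x"] that by simp
    then have "inverse (qpoch y Q m) = inverse (qpoch y Q x) * inverse (qpoch (y * Q ^ x) Q (m - x))"
      by (simp add: fps_inverse_mult)
    then have "inverse (qpoch (y * Q ^ x) Q (m - x)) = qpoch y Q x * inverse (qpoch y Q m)"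
      using P[of x] by (simp flip: mult.assoc)
    then show ?thesis by (simp add: Bser_def e Q_def[symmetric])
  qed
  have "(\<Sum>x\<le>m. y ^ (m - x) * qpoch y Q x * inv_qfact Q x * inv_qfact Q (m - x)) = inv_qfact Q m"
  proof (rule qbinomial_sum)
    show "inv_qfact Q k = qn Q (Suc k) * inv_qfact Q (Suc k)" for k by (rule inv_qfact_Suc[OF Q0])
    show "qn Q (Suc k) \<noteq> 0" for k by (rule fps_nz) (simp add: fps_nth_0_qn[OF Q0])
  qed (simp add: inv_qfact_def)
  then have "Bser m j = (\<Sum>x\<le>m. y ^ (m - x) * qpoch y Q x * inv_qfact Q x * inv_qfact Q (m - x)) * inverse (qpoch y Q m)"
    by (simp add: Bser_def y_def Q_def)
  also have "\<dots> = (\<Sum>x\<le>m. inv_qfact Q x * qX ^ (j * (m - x)) * Bser (m - x) (j + 2 * x))"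
    unfolding sum_distrib_right
  proof (rule sum.cong[OF refl])
    fix x assume "x \<in> {..m}"
    then have x': "x \<le> m" by simp
    have e: "qX ^ (j * (m - x)) = y ^ (m - x)" by (simp add: y_def power_mult)
    show "y ^ (m - x) * qpoch y Q x * inv_qfact Q x * inv_qfact Q (m - x) * inverse (qpoch y Q m) =
        inv_qfact Q x * qX ^ (j * (m - x)) * Bser (m - x) (j + 2 * x)"
      unfolding e B[OF x'] by (simp only: mult_ac)
  qed
  finally show ?thesis by (simp add: Q_def)
qed

text \<open>Both satisfy the same recursion. The terms x = m agree exactly, and all others carry a
  positive power of q because j > 0, so each further list entry gains one order of accuracy.\<close>

lemma Aser_Bser: "j > 0 \<Longrightarrow> qX ^ h dvd (Aser h m j - Bser m j :: 'a::field fps)"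
proof (induction h arbitrary: m j)
  case (Suc h)
  have "Aser (Suc h) m j - Bser m j =
    (\<Sum>x\<le>m. inv_qfact (qX\<^sup>2) x * qX ^ (j * (m - x)) * (Aser h (m - x) (j + 2 * x) - Bser (m - x) (j + 2 * x)) :: 'a fps)"
    unfolding Aser_Suc Bser_rec[OF Suc.prems] by (simp add: sum_subtractf right_diff_distrib)
  also have "qX ^ Suc h dvd \<dots>"
  proof (rule dvd_sum)
    fix x assume x: "x \<in> {..m}"
    show "qX ^ Suc h dvd inv_qfact (qX\<^sup>2) x * qX ^ (j * (m - x)) * (Aser h (m - x) (j + 2 * x) - Bser (m - x) (j + 2 * x) :: 'a fps)"
    proof (cases "x = m")
      case False
      then have "j * (m - x) > 0" using x Suc.prems by simp
      then have "(qX :: 'a fps) dvd qX ^ (j * (m - x))" by (intro dvd_power) simp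
      moreover have "(qX ^ h :: 'a fps) dvd Aser h (m - x) (j + 2 * x) - Bser (m - x) (j + 2 * x)"
        using Suc.prems by (intro Suc.IH) simp
      ultimately have "(qX * qX ^ h :: 'a fps) dvd qX ^ (j * (m - x)) * (Aser h (m - x) (j + 2 * x) - Bser (m - x) (j + 2 * x))"
        by (rule mult_dvd_mono)
      then show ?thesis by (simp add: mult.assoc)
    qed (simp add: Aser_zero Bser_zero)
  qed
  finally show ?case .
qed simp

text \<open>k is the number of 2-cycles of d. The exponent k^2 and the parameter 2 (n - k) come from
  \<open>alen_invol_reps\<close>, the q-factorial of n - 2 k from the points that d fixes.\<close>

definition Hser :: "nat \<Rightarrow> 'a::field fps \<Rightarrow> 'a fps" where
  "Hser n z = (\<Sum>k\<le>n div 2. z ^ k * qX ^ (k * k) * inv_qfact qX (n - 2 * k) * Bser k (2 * (n - k)))"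

text \<open>The factor free of s that turns \<open>Hser n (s * wX)\<close> into the q-Chebyshev
  polynomial.\<close>

definition Gser :: "nat \<Rightarrow> 'a::field fps" where
  "Gser n = qfact qX n * (\<Prod>i\<in>{1..<n}. 1 + qX ^ i)"

definition wX :: "'a::field fps" where
  "wX = (1 - qX) / (1 + qX)"

lemma wX_mult: "wX * (1 + qX) = (1 - qX :: 'a::field fps)"
proof -
  have e: "wX = (1 - qX) * inverse (1 + qX :: 'a fps)" unfolding wX_def by (rule fps_divide_unit) simp
  have "wX * (1 + qX) = (1 - qX) * ((1 + qX) * inverse (1 + qX :: 'a fps))"
    unfolding e by (simp only: mult_ac)
  also have "(1 + qX) * inverse (1 + qX :: 'a fps) = 1" by (rule fps_mult_inverse) simp
  finally show ?thesis by simp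
qed

text \<open>For n > 0 the coefficient of s^k in T_n(1, s, q) (\<open>qcheb_sum\<close>). The case
  distinction guards the truncated subtraction n - 2 k.\<close>

definition tcoef :: "nat \<Rightarrow> nat \<Rightarrow> 'a::field fps" where
  "tcoef n k = (if 2 * k \<le> n then Gser n * (wX ^ k * qX ^ (k * k) * inv_qfact qX (n - 2 * k) * Bser k (2 * (n - k))) else 0)"

lemma Gser_Hser: "Gser n * Hser n (s * wX) = (\<Sum>k\<le>n. s ^ k * tcoef n k :: 'a::field fps)"
proof -
  have "Gser n * Hser n (s * wX) = (\<Sum>k\<le>n div 2. s ^ k * tcoef n k)"
    unfolding Hser_def sum_distrib_left
    by (rule sum.cong[OF refl]) (simp add: tcoef_def power_mult_distrib algebra_simps)
  also have "\<dots> = (\<Sum>k\<le>n. s ^ k * tcoef n k)"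
    by (rule sum.mono_neutral_left) (auto simp: tcoef_def)
  finally show ?thesis .
qed

section \<open>Closed form and recurrence of the coefficients\<close>

abbreviation p1 :: "nat \<Rightarrow> 'a::field fps" where "p1 m \<equiv> qpoch qX qX m"
abbreviation p2 :: "nat \<Rightarrow> 'a::field fps" where "p2 m \<equiv> qpoch (qX\<^sup>2) (qX\<^sup>2) m"

lemma square_power: "q\<^sup>2 * (q\<^sup>2) ^ a = (q :: 'a::comm_ring_1) ^ (2 * Suc a)"
  by (simp only: power_Suc[symmetric] power_mult)

lemma qpoch_prod:
  fixes q :: "'a::comm_ring_1"
  shows "qpoch q q m * (\<Prod>i\<in>{1..<Suc m}. 1 + q ^ i) = qpoch (q\<^sup>2) (q\<^sup>2) m"
proof (induction m)
  case (Suc m)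
  have "{1..<Suc (Suc m)} = insert (Suc m) {1..<Suc m}" by auto
  then have "(\<Prod>i\<in>{1..<Suc (Suc m)}. 1 + q ^ i) = (1 + q ^ Suc m) * (\<Prod>i\<in>{1..<Suc m}. 1 + q ^ i)"
    by (simp only: prod.insert finite_atLeastLessThan atLeastLessThan_iff less_irrefl simp_thms)
  then have "qpoch q q (Suc m) * (\<Prod>i\<in>{1..<Suc (Suc m)}. 1 + q ^ i) =
      (qpoch q q m * (\<Prod>i\<in>{1..<Suc m}. 1 + q ^ i)) * ((1 - q * q ^ m) * (1 + q ^ Suc m))"
    by (simp only: qpoch_Suc mult_ac)
  also have "(1 - q * q ^ m) * (1 + q ^ Suc m) = 1 - q\<^sup>2 * (q\<^sup>2) ^ m"
    by (simp add: algebra_simps power2_eq_square power_mult_distrib)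
  finally show ?case by (simp only: Suc qpoch_Suc)
qed simp

text \<open>All factors become q-Pochhammer symbols: the product of the 1 + q^i turns (q; q) into
  (q^2; q^2), and w^k (1 - q^2)^k = (1 - q)^(2k) absorbs the powers of w = (1 - q) / (1 +
  q).\<close>

lemma tcoef_closed:
  assumes n: "n > 0" and k: "2 * k \<le> n"
  shows "tcoef n k * (p1 (n - 2 * k) * p2 k) = (1 - qX ^ n) * qX ^ (k * k) * (p2 (n - k - 1) :: 'a::field fps)"
proof -
  define q :: "'a fps" where "q = qX"
  obtain n' where n': "n = Suc n'" using n by (cases n) auto
  have q0: "q $ 0 = 0" "(q\<^sup>2) $ 0 = 0" by (simp_all add: q_def)
  define E where "E = (\<Prod>i\<in>{1..<n}. 1 + q ^ i)"
  define V where "V = qpoch (q ^ (2 * (n - k))) (q\<^sup>2) k"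
  have V: "V * inverse V = 1" unfolding V_def
    by (rule fps_mult_inverse) (use k n in \<open>simp add: fps_nth_0_qpoch q_def fps_nth_power_0\<close>)
  \<comment> \<open>The symbol in \<open>Bser\<close> is the tail of (q^2; q^2)_(n-1) after its
    first n - k - 1 factors.\<close>
  have pV: "p2 n' = p2 (n - k - 1) * V"
  proof -
    have "n' = (n - k - 1) + k" using k n by (simp add: n')
    moreover have "q\<^sup>2 * (q\<^sup>2) ^ (n - k - 1) = q ^ (2 * (n - k))"
      unfolding square_power using k n by (intro arg_cong[of _ _ "(^) q"]) presburger
    ultimately show ?thesis
      using qpoch_add[of "q\<^sup>2" "q\<^sup>2" "n - k - 1" k] unfolding V_def q_def by (simp only:)
  qed
  have f1: "qfact q m * inv_qfact q m = 1" "qfact (q\<^sup>2) m * inv_qfact (q\<^sup>2) m = 1" for m using inv_qfact_mult q0 by blast+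
  have w: "wX ^ k * (1 - q\<^sup>2) ^ k = (1 - q) ^ (2 * k)"
  proof -
    have "wX * (1 - q\<^sup>2) = (1 - q) * (wX * (1 + q))" by (simp add: power2_eq_square algebra_simps)
    also have "\<dots> = (1 - q)\<^sup>2" using wX_mult[where 'a = 'a] by (simp add: q_def power2_eq_square)
    finally show ?thesis by (simp flip: power_mult_distrib power_mult)
  qed
  have "tcoef n k * (p1 (n - 2 * k) * p2 k) =
     qfact q n * E * (wX ^ k * q ^ (k * k) * inv_qfact q (n - 2 * k) * (inv_qfact (q\<^sup>2) k * inverse V)) *
     ((qfact q (n - 2 * k) * (1 - q) ^ (n - 2 * k)) * (qfact (q\<^sup>2) k * (1 - q\<^sup>2) ^ k))"
    using k by (simp add: tcoef_def Gser_def Bser_def q_def[symmetric] E_def V_def qfact_qpoch)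
  also have "\<dots> = (qfact q (n - 2 * k) * inv_qfact q (n - 2 * k)) * (qfact (q\<^sup>2) k * inv_qfact (q\<^sup>2) k) *
     (qfact q n * E * q ^ (k * k) * inverse V * ((wX ^ k * (1 - q\<^sup>2) ^ k) * (1 - q) ^ (n - 2 * k)))"
    by (simp add: algebra_simps)
  also have "\<dots> = qfact q n * E * q ^ (k * k) * inverse V * (1 - q) ^ n"
    unfolding f1 w using k by (simp flip: power_add)
  also have "\<dots> = (qfact q n * (1 - q) ^ n) * E * q ^ (k * k) * inverse V" by (simp add: algebra_simps)
  also have "\<dots> = (1 - q ^ n) * (qpoch q q n' * E) * q ^ (k * k) * inverse V"
    unfolding qfact_qpoch n' qpoch_Suc by (simp add: algebra_simps)
  also have "qpoch q q n' * E = p2 n'" unfolding E_def n' q_def by (rule qpoch_prod)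
  also have "(1 - q ^ n) * p2 n' * q ^ (k * k) * inverse V = (1 - q ^ n) * q ^ (k * k) * p2 (n - k - 1) * (V * inverse V)"
    unfolding pV by (simp add: algebra_simps)
  finally show ?thesis by (simp add: V q_def)
qed

lemma p_nz: "(p1 m :: 'a::field fps) \<noteq> 0" "(p2 m :: 'a fps) \<noteq> 0"
  by (auto intro!: fps_nz simp: fps_nth_0_qpoch)

text \<open>Multiplied by the common denominator D, all three terms contain q^(k^2) R, and the
  recurrence reduces to the polynomial identity \<open>key\<close>.\<close>

lemma tcoef_rec:
  assumes n: "n > 0"
  shows "(tcoef (n + 2) k :: 'a::field fps) =
    (1 + qX ^ (n + 1)) * tcoef (n + 1) k + (if k = 0 then 0 else qX ^ (n + 1) * tcoef n (k - 1))"
proof (cases "2 * k \<le> n + 2")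
  case True
  define q :: "'a fps" where "q = qX"
  define D where "D = p1 (n + 2 - 2 * k) * (p2 k :: 'a fps)"
  define R where "R = (p2 (n - k) :: 'a fps)"
  define m where "m = n + 2 - 2 * k"
  have nm: "n + 2 = m + 2 * k" using True by (simp add: m_def)
  have kn: "k \<le> n" using True n by linarith
  have sR: "p2 (n + 2 - k - 1) = R * (1 - q ^ (2 * (n + 1 - k)))"
  proof -
    have "n + 2 - k - 1 = Suc (n - k)" using kn by simp
    moreover have "q\<^sup>2 * (q\<^sup>2) ^ (n - k) = q ^ (2 * (n + 1 - k))"
      unfolding square_power using kn by (intro arg_cong[of _ _ "(^) q"]) presburger
    ultimately show ?thesis by (simp add: R_def q_def qpoch_Suc)
  qed
  have t0: "tcoef (n + 2) k * D = (1 - q ^ (n + 2)) * q ^ (k * k) * (R * (1 - q ^ (2 * (n + 1 - k))))"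
    using tcoef_closed[of "n + 2" k, where 'a = 'a] True unfolding sR by (simp add: D_def q_def)
  \<comment> \<open>If 2 k = n + 2, both sides vanish: \<open>tcoef\<close> by definition, the right
    side because m = 0.\<close>
  have t1: "tcoef (n + 1) k * D = (1 - q ^ (n + 1)) * q ^ (k * k) * R * (1 - q ^ m)"
  proof (cases "2 * k \<le> n + 1")
    case True
    have e: "n + 2 - 2 * k = Suc (n + 1 - 2 * k)" using True by simp
    have "tcoef (n + 1) k * D = tcoef (n + 1) k * (p1 (n + 1 - 2 * k) * p2 k) * (1 - q ^ m)"
      unfolding D_def e qpoch_Suc m_def by (simp add: q_def algebra_simps)
    also have "\<dots> = (1 - q ^ (n + 1)) * q ^ (k * k) * R * (1 - q ^ m)"
      using tcoef_closed[of "n + 1" k, where 'a = 'a] True by (simp add: q_def R_def)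
    finally show ?thesis .
  next
    case False
    then have "m = 0" by (simp add: m_def)
    with False show ?thesis by (simp add: tcoef_def)
  qed
  have t2: "(if k = 0 then 0 else q ^ (n + 1) * tcoef n (k - 1)) * D =
     q ^ m * q ^ (k * k) * (1 - q ^ n) * R * (1 - q ^ (2 * k))"
  proof (cases k)
    case (Suc l)
    have l: "2 * l \<le> n" using True Suc by simp
    have e: "n + 2 - 2 * k = n - 2 * l" "n - l - 1 = n - k" by (simp_all add: Suc)
    have "q\<^sup>2 * (q\<^sup>2) ^ l = q ^ (2 * k)" by (simp add: Suc flip: power_mult power_add)
    then have "tcoef n l * D = tcoef n l * (p1 (n - 2 * l) * p2 l) * (1 - q ^ (2 * k))"
      unfolding D_def e by (simp add: Suc qpoch_Suc q_def algebra_simps)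
    also have "tcoef n l * (p1 (n - 2 * l) * p2 l) = (1 - q ^ n) * q ^ (l * l) * R"
      unfolding R_def q_def e(2)[symmetric] by (rule tcoef_closed[OF n l])
    finally have h: "tcoef n l * D = (1 - q ^ n) * q ^ (l * l) * R * (1 - q ^ (2 * k))" .
    have "q ^ (n + 1) * tcoef n l * D = q ^ (n + 1) * (tcoef n l * D)" by (simp only: mult_ac)
    also have "\<dots> = (q ^ (n + 1) * q ^ (l * l)) * (1 - q ^ n) * R * (1 - q ^ (2 * k))"
      unfolding h by (simp only: mult_ac)
    also have "q ^ (n + 1) * q ^ (l * l) = q ^ m * q ^ (k * k)"
    proof -
      have "n + 1 + l * l = m + k * k" using nm by (simp add: Suc)
      then show ?thesis by (simp only: power_add[symmetric])
    qed
    finally show ?thesis by (simp add: Suc)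
  qed simp
  have key: "(1 - q ^ (n + 2)) * (1 - q ^ (2 * (n + 1 - k))) =
     (1 + q ^ (n + 1)) * (1 - q ^ (n + 1)) * (1 - q ^ m) + q ^ m * (1 - q ^ n) * (1 - q ^ (2 * k))"
  proof -
    have e: "2 * (n + 1 - k) = m + n" using nm kn by simp
    have e2: "q ^ (n + 2) = q ^ m * q ^ (2 * k)" unfolding nm by (simp add: power_add)
    have e3: "q ^ (n + 1) * q ^ (n + 1) = q ^ n * q ^ (n + 2)" by (simp flip: power_add)
    have "(1 + x) * (1 - x) = 1 - x * x" for x :: "'a fps" by (simp add: algebra_simps)
    note f = this[of "q ^ (n + 1)", unfolded e3 e2]
    show ?thesis unfolding e f e2 power_add[of q m n] by (simp add: algebra_simps)
  qed
  have "tcoef (n + 2) k * D = ((1 + q ^ (n + 1)) * tcoef (n + 1) k + (if k = 0 then 0 else q ^ (n + 1) * tcoef n (k - 1))) * D"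
  proof -
    have gen: "a * ((1 - b) * u * r * (1 - c)) + c * u * (1 - d) * r * (1 - e) =
        u * r * (a * (1 - b) * (1 - c) + c * (1 - d) * (1 - e))" for a b c d e u r :: "'a fps"
      by (simp add: algebra_simps)
    have "((1 + q ^ (n + 1)) * tcoef (n + 1) k + (if k = 0 then 0 else q ^ (n + 1) * tcoef n (k - 1))) * D =
       (1 + q ^ (n + 1)) * (tcoef (n + 1) k * D) + (if k = 0 then 0 else q ^ (n + 1) * tcoef n (k - 1)) * D"
      by (simp only: distrib_right mult.assoc)
    also have "\<dots> = q ^ (k * k) * R * ((1 + q ^ (n + 1)) * (1 - q ^ (n + 1)) * (1 - q ^ m) + q ^ m * (1 - q ^ n) * (1 - q ^ (2 * k)))"
      unfolding t1 t2 by (rule gen)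
    also have "\<dots> = tcoef (n + 2) k * D"
      unfolding t0 key[symmetric] by (simp only: mult_ac)
    finally show ?thesis by (rule sym)
  qed
  moreover have nz: "D \<noteq> 0" by (simp add: D_def p_nz)
  ultimately show ?thesis unfolding q_def mult_right_cancel[OF nz] by blast
next
  case False
  then show ?thesis by (simp add: tcoef_def)
qed

text \<open>The closed form breaks down at n = 0, where 1 - q^n vanishes; so
  \<open>tcoef_rec\<close> assumes n > 0, and n = 2 is a base case as well.\<close>

lemma tcoef_base: "tcoef 1 0 = (1 :: 'a::field fps)" "tcoef 2 0 = (1 + qX :: 'a fps)" "tcoef 2 1 = (qX :: 'a fps)"
proof -
  define q :: "'a fps" where "q = qX"
  have nz: "1 - q \<noteq> 0" "1 - q\<^sup>2 \<noteq> 0" by (rule fps_nz, simp add: q_def)+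
  show "tcoef 1 0 = (1 :: 'a fps)"
    using tcoef_closed[of 1 0, where 'a = 'a, folded q_def] nz by (simp add: qpoch_def)
  have "tcoef 2 0 * ((1 - q) * (1 - q\<^sup>2)) = (1 + q) * ((1 - q) * (1 - q\<^sup>2))"
    using tcoef_closed[of 2 0, where 'a = 'a, folded q_def]
    by (simp add: qpoch_def numeral_2_eq_2 algebra_simps)
  then show "tcoef 2 0 = (1 + qX :: 'a fps)" using nz by (simp add: q_def[symmetric])
  have "tcoef 2 1 * (1 - q\<^sup>2) = q * (1 - q\<^sup>2)"
    using tcoef_closed[of 2 1, where 'a = 'a, folded q_def] by (simp add: qpoch_def algebra_simps)
  then show "tcoef 2 1 = (qX :: 'a fps)" using nz by (simp add: q_def[symmetric])
qed

lemma tcoef_big: "n < 2 * k \<Longrightarrow> tcoef n k = 0"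
  by (simp add: tcoef_def)

lemma qcheb_sum:
  assumes "n > 0" shows "qcheb_T n 1 s qX = (\<Sum>k\<le>n. s ^ k * tcoef n k :: 'a::field fps)"
  using assms
proof (induction n rule: less_induct)
  case (less n)
  consider "n = 1" | "n = 2" | m where "n = m + 2" "m > 0"
    using less.prems by (metis One_nat_def Suc_1 add_2_eq_Suc' gr0_conv_Suc neq0_conv)
  then show ?case
  proof cases
    case 1
    then show ?thesis using tcoef_base(1)[where 'a = 'a] by (simp add: tcoef_big)
  next
    case 2
    then show ?thesis
      using tcoef_base[where 'a = 'a] by (simp add: numeral_2_eq_2 tcoef_big)
  next
    case (3 m)
    define U where "U n = (\<Sum>k\<le>n. s ^ k * tcoef n k :: 'a fps)" for n
    have ext: "(\<Sum>k\<le>n + j. s ^ k * tcoef n k) = U n" for n j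
      unfolding U_def by (rule sum.mono_neutral_right) (auto simp: tcoef_big)
    have "U (m + 2) = (\<Sum>k\<le>m + 2. s ^ k * ((1 + qX ^ (m + 1)) * tcoef (m + 1) k) +
        s ^ k * (if k = 0 then 0 else qX ^ (m + 1) * tcoef m (k - 1)))"
      unfolding U_def tcoef_rec[OF 3(2)] by (simp only: distrib_left)
    also have "\<dots> = (1 + qX ^ (m + 1)) * (\<Sum>k\<le>m + 1 + 1. s ^ k * tcoef (m + 1) k) +
        (\<Sum>k\<le>Suc (m + 1). s ^ k * (if k = 0 then 0 else qX ^ (m + 1) * tcoef m (k - 1)))"
      by (simp only: sum.distrib sum_distrib_left) (simp add: algebra_simps)
    also have "(\<Sum>k\<le>Suc (m + 1). s ^ k * (if k = 0 then 0 else qX ^ (m + 1) * tcoef m (k - 1))) =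
        qX ^ (m + 1) * s * (\<Sum>k\<le>m + 1. s ^ k * tcoef m k)"
      by (subst sum.atMost_Suc_shift) (simp add: sum_distrib_left algebra_simps)
    finally have "U (m + 2) = (1 + qX ^ (m + 1)) * U (m + 1) + qX ^ (m + 1) * s * U m"
      unfolding ext .
    moreover have "U (m + 1) = qcheb_T (m + 1) 1 s qX" "U m = qcheb_T m 1 s qX"
      using less.IH[of "m + 1"] less.IH[of m] 3 by (simp_all add: U_def)
    ultimately show ?thesis using 3 by (simp add: U_def numeral_2_eq_2)
  qed
qed

text \<open>At x = 1, s = -1 the recurrence has the coefficients 1 + q^(n-1) and -q^(n-1), which add
  up to 1.\<close>

lemma qcheb_minus_one: "qcheb_T n 1 (- 1) q = (1 :: 'a::comm_ring_1)"
  by (induction n rule: induct_nat_012) simp_all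

text \<open>By the case s = -1, \<open>Gser n\<close> is the inverse of
  \<open>Hser n (- wX)\<close>.\<close>

lemma Hser_qcheb:
  assumes "n > 0"
  shows "Hser n (s * wX) = qcheb_T n 1 s qX * (Hser n (- wX) :: 'a::field fps)"
    "Hser n (- wX) \<noteq> (0 :: 'a fps)"
proof -
  have G: "Gser n * Hser n (s * wX) = qcheb_T n 1 s qX" for s :: "'a fps"
    unfolding Gser_Hser qcheb_sum[OF assms] ..
  from G[of "- 1"] have G1: "Gser n * Hser n (- wX) = (1 :: 'a fps)" by (simp add: qcheb_minus_one)
  then show "Hser n (- wX) \<noteq> (0 :: 'a fps)" by auto
  have "Hser n (s * wX) = (Gser n * Hser n (- wX)) * Hser n (s * wX)" by (simp add: G1)
  also have "\<dots> = Gser n * Hser n (s * wX) * Hser n (- wX)" by (simp only: mult_ac)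
  finally show "Hser n (s * wX) = qcheb_T n 1 s qX * Hser n (- wX)" unfolding G .
qed

subsection \<open>Minimal involutive double coset representatives\<close>

context affine
begin

definition shift_count :: "(int \<Rightarrow> int) \<Rightarrow> int \<Rightarrow> nat" where
  "shift_count d k = card {i \<in> {1..N}. win (d i) = k}"

text \<open>A minimal representative d increases on the window, so the points sent to period k form
  an interval: it begins right after \<open>block_start d k\<close> and has length
  \<open>shift_count d k\<close>.\<close>

definition block_start :: "(int \<Rightarrow> int) \<Rightarrow> int \<Rightarrow> int" where
  "block_start d k = int (card {i \<in> {1..N}. win (d i) < k})"

lemma finite_window: "finite {i \<in> {1..N}. P i}"
  by (rule finite_subset[of _ "{1..N}"]) auto

lemma win_window: "i \<in> {1..N} \<Longrightarrow> win i = 0"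
  using win_1N by blast

lemma down_closed_card:
  assumes "S \<subseteq> {1..N}" "\<And>i j. i \<in> S \<Longrightarrow> 1 \<le> j \<Longrightarrow> j \<le> i \<Longrightarrow> j \<in> S"
  shows "S = {1..int (card S)}"
proof (cases "S = {}")
  case False
  have fin: "finite S" using assms(1) finite_subset by blast
  have "Max S \<in> S" using fin False by simp
  then have S: "S = {1..Max S}" using assms Max_ge[OF fin] by fastforce
  have "Max S \<ge> 1" using \<open>Max S \<in> S\<close> assms(1) by auto
  then have "int (card {1..Max S}) = Max S" by simp
  then have "int (card S) = Max S" using S by simp
  then show ?thesis using S by simp
qed simp

lemma invol_reps_win_less:
  assumes d: "d \<in> invol_reps" shows "{i \<in> {1..N}. win (d i) < k} = {1..block_start d k}"
  unfolding block_start_def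
proof (rule down_closed_card)
  fix i j assume i: "i \<in> {i \<in> {1..N}. win (d i) < k}" and j: "1 \<le> j" "j \<le> i"
  then have "i \<in> {1..N}" "j \<in> {1..N}" by auto
  then have "win j = win i" by (simp only: win_window)
  then have "win (d j) \<le> win (d i)"
    using invol_reps_less[OF d, of j i] j by (intro win_mono) (cases "j = i"; simp)
  with i j show "j \<in> {i \<in> {1..N}. win (d i) < k}" by auto
qed auto

lemma block_start_Suc: "block_start d (k + 1) = block_start d k + int (shift_count d k)"
proof -
  have "{i \<in> {1..N}. win (d i) < k + 1} = {i \<in> {1..N}. win (d i) < k} \<union> {i \<in> {1..N}. win (d i) = k}" by auto
  moreover have "card \<dots> = card {i \<in> {1..N}. win (d i) < k} + card {i \<in> {1..N}. win (d i) = k}"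
    by (rule card_Un_disjoint[OF finite_window finite_window]) blast
  ultimately show ?thesis by (simp add: block_start_def shift_count_def)
qed

lemma block_start_range: "0 \<le> block_start d k" "block_start d k \<le> N"
proof -
  have "card {i \<in> {1..N}. win (d i) < k} \<le> card {1..N}" by (rule card_mono) auto
  then show "block_start d k \<le> N" by (simp add: block_start_def)
qed (simp add: block_start_def)

lemma invol_reps_block:
  assumes d: "d \<in> invol_reps"
  shows "{i \<in> {1..N}. win (d i) = k} = {block_start d k<..block_start d k + int (shift_count d k)}"
proof -
  have eq: "{i \<in> {1..N}. win (d i) = k} = {i \<in> {1..N}. win (d i) < k + 1} - {i \<in> {1..N}. win (d i) < k}" by auto
  have "{1..block_start d k + int (shift_count d k)} - {1..block_start d k} = {block_start d k<..block_start d k + int (shift_count d k)}"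
    using block_start_range(1)[of d k] by auto
  then show ?thesis unfolding eq invol_reps_win_less[OF d] block_start_Suc .
qed

lemma block_iff:
  assumes d: "d \<in> invol_reps"
  shows "i \<in> {1..N} \<and> win (d i) = k \<longleftrightarrow> block_start d k < i \<and> i \<le> block_start d k + int (shift_count d k)"
  using invol_reps_block[OF d, of k] by (simp add: set_eq_iff)

text \<open>A nonempty block of b points gives a run of b - 1 indices of \<open>stab d\<close>: only
  the step out of its last point leaves the block.\<close>

lemma stab_block:
  assumes d: "d \<in> invol_reps"
  shows "{i \<in> stab d \<inter> {1..N}. win (d i) = k} = {block_start d k<..<block_start d k + int (shift_count d k)}"
    "block_start d k < i \<Longrightarrow> i < block_start d k + int (shift_count d k) \<Longrightarrow> run_length (stab d) i = nat (i - block_start d k)"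
proof -
  note B = block_iff[OF d, of _ k]
  have in_J: "i \<in> J" if "i \<in> {1..N}" "i + 1 \<in> {1..N}" for i
  proof -
    have "win i = 0" "win (i + 1) = 0" using that unfolding win_1N by auto
    then show ?thesis unfolding win_J by simp
  qed
  show eq: "{i \<in> stab d \<inter> {1..N}. win (d i) = k} = {block_start d k<..<block_start d k + int (shift_count d k)}"
  proof safe
    fix i assume i: "i \<in> stab d" "i \<in> {1..N}" "k = win (d i)"
    have "win (i + 1) = win i" using i(1) win_J by (simp add: stab_def)
    then have "i + 1 \<in> {1..N}" using i(2) win_1N by metis
    moreover have "win (d (i + 1)) = k" using i by (simp add: stab_def)
    ultimately show "i \<in> {block_start d (win (d i))<..<block_start d (win (d i)) + int (shift_count d (win (d i)))}"
      using B[of i] B[of "i + 1"] i by auto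
  next
    fix i assume "i \<in> {block_start d k<..<block_start d k + int (shift_count d k)}"
    then have "i \<in> {1..N} \<and> win (d i) = k" "i + 1 \<in> {1..N} \<and> win (d (i + 1)) = k"
      using B[of i] B[of "i + 1"] by auto
    then show "i \<in> stab d" "i \<in> {1..N}" "win (d i) = k" using in_J by (auto simp: stab_def)
  qed
  show "run_length (stab d) i = nat (i - block_start d k)" if i: "block_start d k < i" "i < block_start d k + int (shift_count d k)"
  proof (rule run_length_eqI)
    have e: "i - int (nat (i - block_start d k)) = block_start d k" using i by simp
    show "{i - int (nat (i - block_start d k))<..i} \<subseteq> stab d" unfolding e
    proof
      fix m assume "m \<in> {block_start d k<..i}"
      then have "m \<in> {block_start d k<..<block_start d k + int (shift_count d k)}" using i by simp
      then show "m \<in> stab d" unfolding eq[symmetric] by blast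
    qed
    show "i - int (nat (i - block_start d k)) \<notin> stab d" unfolding e
    proof
      assume h: "block_start d k \<in> stab d"
      have s1: "block_start d k + 1 \<in> {1..N} \<and> win (d (block_start d k + 1)) = k" using B[of "block_start d k + 1"] i by auto
      have "win (block_start d k + 1) = win (block_start d k)" using h win_J by (simp add: stab_def)
      then have "block_start d k \<in> {1..N}" using s1 win_1N by metis
      moreover have "win (d (block_start d k)) = k" using h s1 by (simp add: stab_def)
      ultimately show False using B[of "block_start d k"] by auto
    qed
  qed
qed

lemma prod_interval_shift: "(\<Prod>i\<in>{m<..<m + int (Suc a)}. f (nat (i - m))) = (\<Prod>p<a. f (Suc p))"
proof (induction a)
  case (Suc a)
  have "{m<..<m + int (Suc (Suc a))} = insert (m + 1 + int a) {m<..<m + int (Suc a)}" by auto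
  moreover have "nat (m + 1 + int a - m) = Suc a" by simp
  ultimately show ?case using Suc by (simp add: mult.commute)
next
  case 0
  have "{m<..<m + int (Suc 0)} = {}" by auto
  then show ?case by simp
qed

text \<open>A block of b points carries a symmetric group S_b, whose Poincare polynomial is the
  q-factorial of b.\<close>

lemma prod_block:
  fixes q :: "'a::comm_ring_1"
  assumes d: "d \<in> invol_reps"
  shows "(\<Prod>i\<in>{i \<in> stab d \<inter> {1..N}. win (d i) = k}. qn q (run_length (stab d) i + 1)) = qfact q (shift_count d k)"
proof (cases "shift_count d k")
  case 0
  then show ?thesis unfolding stab_block(1)[OF d] by simp
next
  case (Suc a)
  have "(\<Prod>i\<in>{i \<in> stab d \<inter> {1..N}. win (d i) = k}. qn q (run_length (stab d) i + 1)) =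
      (\<Prod>i\<in>{block_start d k<..<block_start d k + int (Suc a)}. qn q (nat (i - block_start d k) + 1))"
    unfolding stab_block(1)[OF d] Suc[symmetric] by (rule prod.cong[OF refl]) (simp add: stab_block(2)[OF d, of k])
  also have "\<dots> = (\<Prod>p<a. qn q (Suc p + 1))" by (rule prod_interval_shift)
  also have "\<dots> = qfact q (shift_count d k)"
    unfolding qfact_def Suc by (subst prod.lessThan_Suc_shift) simp
  finally show ?thesis .
qed

text \<open>If d i stayed in the period of i but differed from i, monotonicity on that period would
  contradict d (d i) = i.\<close>

lemma invol_reps_fixed:
  assumes d: "d \<in> invol_reps" and i: "i \<in> {1..N}"
  shows "d i = i \<longleftrightarrow> win (d i) = 0" "d i \<noteq> i \<Longrightarrow> i < d i \<longleftrightarrow> 0 < win (d i)"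
proof -
  have wi: "win i = 0" using i win_1N by blast
  show e: "d i = i \<longleftrightarrow> win (d i) = 0"
  proof
    assume w: "win (d i) = 0"
    have "d (d i) = i" by (rule drepsD(3)[OF d])
    then show "d i = i" using invol_reps_less[OF d, of i "d i"] invol_reps_less[OF d, of "d i" i] w wi by force
  qed (simp add: wi)
  show "i < d i \<longleftrightarrow> 0 < win (d i)" if "d i \<noteq> i"
    using win_mono[of i "d i"] win_mono[of "d i" i] e that wi by linarith
qed

lemma window_bounded:
  assumes "d \<in> bounded_shift h" "i \<in> {1..N}" shows "win (d i) \<in> {- int h..int h}"
proof -
  have "\<bar>win (d i) - win i\<bar> \<le> int h" using assms(1) by (simp add: bounded_shift_def)
  moreover have "win i = 0" using assms(2) win_1N by blast
  ultimately show ?thesis by auto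
qed

lemma symmetric_range:
  "{- int h..int h} = {0} \<union> ((\<lambda>i. int i + 1) ` {..<h} \<union> (\<lambda>i. - (int i + 1)) ` {..<h})" (is "?A = ?B")
proof (rule equalityI)
  show "?A \<subseteq> ?B"
  proof
    fix k assume k: "k \<in> ?A"
    consider "k = 0" | "k > 0" | "k < 0" by linarith
    then show "k \<in> ?B"
    proof cases
      case 2
      then have "k = int (nat (k - 1)) + 1" "nat (k - 1) \<in> {..<h}" using k by auto
      then show ?thesis by blast
    next
      case 3
      then have "k = - (int (nat (- k - 1)) + 1)" "nat (- k - 1) \<in> {..<h}" using k by auto
      then show ?thesis by blast
    qed simp
  qed
  show "?B \<subseteq> ?A" by auto
qed

lemma prod_symmetric_range:
  fixes F :: "int \<Rightarrow> 'b::comm_monoid_mult"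
  shows "(\<Prod>k\<in>{- int h..int h}. F k) = F 0 * ((\<Prod>i<h. F (int i + 1)) * (\<Prod>i<h. F (- (int i + 1))))"
  unfolding symmetric_range
  by (subst prod.union_disjoint, simp, simp, force, subst prod.union_disjoint, simp, simp, force)
    (simp add: prod.reindex inj_on_def)

lemma sum_symmetric_range:
  fixes F :: "int \<Rightarrow> 'b::comm_monoid_add"
  shows "(\<Sum>k\<in>{- int h..int h}. F k) = F 0 + ((\<Sum>i<h. F (int i + 1)) + (\<Sum>i<h. F (- (int i + 1))))"
  unfolding symmetric_range
  by (subst sum.union_disjoint, simp, simp, force, subst sum.union_disjoint, simp, simp, force)
    (simp add: sum.reindex inj_on_def)

text \<open>Block 0 consists of fixed points and contributes in q. Of the blocks k and -k, which d
  exchanges modulo N, the positive one contributes in q^2 and the negative one nothing.\<close>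

lemma Cprod_invol_reps:
  fixes q :: "'a::comm_ring_1"
  assumes d: "d \<in> invol_reps" "d \<in> bounded_shift h"
  shows "Cprod (stab d) d q = qfact q (shift_count d 0) * (\<Prod>i<h. qfact (q\<^sup>2) (shift_count d (int i + 1)))"
proof -
  define F where "F k = (\<Prod>i\<in>{i \<in> stab d \<inter> {1..N}. win (d i) = k}. Cfac (stab d) d q i)" for k
  have "(\<Prod>k\<in>{- int h..int h}. F k) = Cprod (stab d) d q"
    unfolding F_def Cprod_def
    by (rule prod.group) (use window_bounded[OF d(2)] in auto)
  moreover have F0: "F 0 = qfact q (shift_count d 0)"
    unfolding F_def prod_block[OF d(1), symmetric]
    by (rule prod.cong) (auto simp: Cfac_def invol_reps_fixed[OF d(1)])
  moreover have "F k = qfact (q\<^sup>2) (shift_count d k)" if "k > 0" for k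
    unfolding F_def prod_block[OF d(1), symmetric]
    by (rule prod.cong) (use that invol_reps_fixed[OF d(1)] in \<open>auto simp: Cfac_def\<close>)
  moreover have "F k = 1" if "k < 0" for k
    unfolding F_def
    by (rule prod.neutral) (use that invol_reps_fixed[OF d(1)] in \<open>auto simp: Cfac_def\<close>)
  ultimately show ?thesis using prod_symmetric_range[of F h] by simp
qed

text \<open>The point d i - N k is the partner of i moved back into the window; d sends it to period
  -k.\<close>

lemma shift_count_minus: assumes "d \<in> aperm" "d \<circ> d = id" shows "shift_count d (- k) = shift_count d k"
proof -
  note dd = involution_simp[OF assms(2)]
  have le: "shift_count d k \<le> shift_count d (- k)" for k
    unfolding shift_count_def
  proof (rule card_inj_on_le[of "\<lambda>i. d i - N * k"])
    show "inj_on (\<lambda>i. d i - N * k) {i \<in> {1..N}. win (d i) = k}"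
      by (rule inj_onI) (simp add: aperm_inj[OF assms(1)])
    show "finite {i \<in> {1..N}. win (d i) = - k}" by (rule finite_window)
    show "(\<lambda>i. d i - N * k) ` {i \<in> {1..N}. win (d i) = k} \<subseteq> {i \<in> {1..N}. win (d i) = - k}"
    proof safe
      fix i assume i: "i \<in> {1..N}" "k = win (d i)"
      have "win (d i - N * k) = 0" using win_shift[of "d i" "- k"] i(2) by simp
      then show "d i - N * win (d i) \<in> {1..N}" using win_1N i(2) by blast
      have "d (d i - N * k) = i + N * (- k)"
        using aperm_shift_mult[OF assms(1), of "d i" "- k"] dd by simp
      then have "win (d (d i - N * k)) = win i - k" using win_shift[of i "- k"] by simp
      then show "win (d (d i - N * win (d i))) = - win (d i)" using win_window[OF i(1)] i(2) by simp
    qed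
  qed
  show ?thesis using le[of k] le[of "- k"] by simp
qed

lemma sum_by_window:
  fixes f :: "int \<Rightarrow> 'b::comm_semiring_1"
  assumes "d \<in> bounded_shift h"
  shows "(\<Sum>i=1..N. f (win (d i))) = (\<Sum>k\<in>{- int h..int h}. of_nat (shift_count d k) * f k)"
proof -
  have "(\<Sum>i=1..N. f (win (d i))) = (\<Sum>k\<in>{- int h..int h}. \<Sum>i\<in>{i \<in> {1..N}. win (d i) = k}. f (win (d i)))"
    by (rule sum.group[symmetric]) (use window_bounded[OF assms] in auto)
  also have "\<dots> = (\<Sum>k\<in>{- int h..int h}. of_nat (shift_count d k) * f k)"
    by (rule sum.cong[OF refl]) (simp add: shift_count_def)
  finally show ?thesis .
qed

text \<open>The parameters b_1, ..., b_h of a representative. Downward shifts occur equally often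
  and fixed points fill up the total n, so within the truncation h the list determines all
  counts.\<close>

definition blist :: "nat \<Rightarrow> (int \<Rightarrow> int) \<Rightarrow> nat list" where
  "blist h d = map (\<lambda>i. shift_count d (int i + 1)) [0..<h]"

lemma length_blist [simp]: "length (blist h d) = h"
  by (simp add: blist_def)

lemma nth_blist: "i < h \<Longrightarrow> blist h d ! i = shift_count d (int i + 1)"
  by (simp add: blist_def)

lemma sum_list_blist: "sum_list (blist h d) = (\<Sum>i<h. shift_count d (int i + 1))"
  by (simp add: blist_def sum_list_sum_nth atLeast0LessThan)

lemma shift_count_total:
  assumes "d \<in> aperm" "d \<circ> d = id" "d \<in> bounded_shift h"
  shows "shift_count d 0 + 2 * sum_list (blist h d) = n"
proof -
  have "n = (\<Sum>i=1..N. 1)" by simp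
  also have "\<dots> = (\<Sum>k\<in>{- int h..int h}. shift_count d k)" using sum_by_window[OF assms(3), of "\<lambda>_. 1::nat"] by simp
  also have "\<dots> = shift_count d 0 + 2 * sum_list (blist h d)"
    unfolding sum_symmetric_range shift_count_minus[OF assms(1,2)] sum_list_blist by simp
  finally show ?thesis by simp
qed

lemma cyc_invol_reps:
  assumes d: "d \<in> invol_reps" "d \<in> bounded_shift h" shows "cyc d = sum_list (blist h d)"
proof -
  note dD = drepsD[OF d(1)]
  have "moved d = (\<Sum>i=1..N. of_bool (win (d i) \<noteq> 0))"
    unfolding moved_def by (rule sum.cong[OF refl]) (simp add: invol_reps_fixed[OF d(1)])
  also have "\<dots> = (\<Sum>k\<in>{- int h..int h}. of_nat (shift_count d k) * of_bool (k \<noteq> 0))"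
    by (rule sum_by_window[OF d(2)])
  also have "\<dots> = 2 * sum_list (blist h d)"
    unfolding sum_symmetric_range shift_count_minus[OF dD(1,2)] sum_list_blist by simp
  finally show ?thesis by (simp add: cyc_def)
qed

text \<open>The number of inversions between two residue classes that a minimal representative
  shifts by k and by l periods (\<open>class_inv_invol_reps\<close>).\<close>

definition gap :: "int \<Rightarrow> int \<Rightarrow> int" where
  "gap k l = (if k = l then 0 else \<bar>k - l\<bar> - 1)"

text \<open>Let d i = r + N k and d j = r' + N l. If k < l, then d sends r' to an earlier period
  than r, so r' < r and the quotient loses one: it is l - k - 1.\<close>

lemma class_inv_invol_reps_less:
  assumes d: "d \<in> invol_reps" and ij: "i \<in> {1..N}" "j \<in> {1..N}" "i < j"
  shows "(d j - d i) div N = gap (win (d i)) (win (d j))"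
proof -
  note dD = drepsD[OF d]
  obtain r k where r: "d i = r + N * k" "r \<in> {1..N}" "k = win (d i)" by (rule window_repr)
  obtain r' l where r': "d j = r' + N * l" "r' \<in> {1..N}" "l = win (d j)" by (rule window_repr)
  have wij: "win i = 0" "win j = 0" using ij win_1N by blast+
  have lt: "d i < d j" by (rule invol_reps_less[OF d ij(3)]) (simp add: wij)
  then have kl: "k \<le> l" unfolding r(3) r'(3) by (intro win_mono) simp
  have "d r = i + N * (- k)" "d r' = j + N * (- l)"
    using aperm_shift_mult[OF dD(1), of r k] aperm_shift_mult[OF dD(1), of r' l] dD(3)[of i] dD(3)[of j]
    by (simp_all add: r(1)[symmetric] r'(1)[symmetric])
  then have wr: "win (d r) = - k" "win (d r') = - l" by (simp_all only: win_shift wij)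
  have w0: "win r = win r'" using r(2) r'(2) win_1N by metis
  have e: "d j - d i = (r' - r) + (l - k) * N" using r r' by (simp add: algebra_simps)
  have q: "(d j - d i) div N = (r' - r) div N + (l - k)"
    unfolding e by (subst div_mult_self1) (simp_all only: of_nat_eq_0_iff n_simps not_False_eq_True add.commute)
  show ?thesis
  proof (cases "k = l")
    case True
    then have "r < r'" using lt unfolding r(1) r'(1) by simp
    then have "(r' - r) div N = 0" using r(2) r'(2) by (intro div_pos_pos_trivial) auto
    with True q show ?thesis unfolding r(3)[symmetric] r'(3)[symmetric] by (simp add: gap_def)
  next
    case False
    have "r' < r"
    proof (rule ccontr)
      assume "\<not> r' < r"
      moreover have "r \<noteq> r'" using wr False by auto
      ultimately have "d r < d r'" using w0 by (intro invol_reps_less[OF d]) auto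
      then have "win (d r) \<le> win (d r')" by (intro win_mono) simp
      then show False using wr kl False by simp
    qed
    then have "(r' - r + N) div N = 0" using r(2) r'(2) by (intro div_pos_pos_trivial) auto
    then have "(r' - r) div N = - 1" unfolding div_shift(1) by linarith
    with False kl q show ?thesis unfolding r(3)[symmetric] r'(3)[symmetric] by (simp add: gap_def)
  qed
qed

lemma gap_commute: "gap k l = gap l k" and gap_nonneg: "0 \<le> gap k l"
  by (auto simp: gap_def)

lemma class_inv_invol_reps:
  assumes d: "d \<in> invol_reps" and ij: "i \<in> {1..N}" "j \<in> {1..N}"
  shows "class_inv d i j = gap (win (d i)) (win (d j))"
proof -
  have less: "class_inv d i j = gap (win (d i)) (win (d j))" if "i \<in> {1..N}" "j \<in> {1..N}" "i < j" for i j
  proof -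
    have "(j - i) div N = 0" using that by (intro div_pos_pos_trivial) auto
    then show ?thesis unfolding class_inv_def class_inv_invol_reps_less[OF d that] by (simp add: gap_nonneg)
  qed
  have comm: "class_inv d i j = class_inv d j i" if "i \<in> {1..N}" "j \<in> {1..N}" "i < j" for i j
  proof -
    have nd: "\<not> N dvd j - i" using that zdvd_imp_le[of N "j - i"] by auto
    then have "\<not> N dvd d j - d i" using aperm_dvd_diff[OF drepsD(1)[OF d]] by blast
    with nd have "(i - j) div N = - ((j - i) div N) - 1" "(d i - d j) div N = - ((d j - d i) div N) - 1"
      using div_minus[of "j - i"] div_minus[of "d j - d i"] by simp_all
    then show ?thesis by (simp add: class_inv_def abs_minus_commute)
  qed
  consider "i < j" | "i = j" | "j < i" by linarith
  then show ?thesis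
  proof cases
    case 1
    then show ?thesis using less ij by blast
  next
    case 2
    then show ?thesis by (simp add: class_inv_def gap_def)
  next
    case 3
    then show ?thesis using less[OF ij(2,1)] comm[OF ij(2,1)] by (simp add: gap_commute)
  qed
qed

lemma wt_sum: "wt b = (\<Sum>i<length b. i * b ! i)"
proof (induction b)
  case (Cons x b)
  have "(\<Sum>i<length (x # b). i * (x # b) ! i) = (\<Sum>i<length b. Suc i * b ! i)"
    by (simp add: sum.lessThan_Suc_shift del: sum.lessThan_Suc)
  also have "\<dots> = (\<Sum>i<length b. i * b ! i) + sum_list b"
    by (simp add: sum_list_sum_nth atLeast0LessThan sum.distrib)
  finally show ?case using Cons by simp
qed simp

lemma en_sum: "int (en b) = (\<Sum>i<length b. \<Sum>j<length b. int (b ! i) * int (b ! j) * gap (int i) (int j))"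
proof (induction b)
  case (Cons x b)
  define F where "F i j = int ((x # b) ! i) * int ((x # b) ! j) * gap (int i) (int j)" for i j
  have gap: "gap 0 (int (Suc j)) = int j" "gap (int (Suc j)) 0 = int j" "gap (int (Suc i)) (int (Suc j)) = gap (int i) (int j)" for i j
    by (auto simp: gap_def)
  have W: "(\<Sum>j<length b. int x * int (b ! j) * int j) = int x * int (wt b)"
    unfolding wt_sum by (simp add: sum_distrib_left mult_ac)
  have "(\<Sum>i<length (x # b). \<Sum>j<length (x # b). F i j) =
      F 0 0 + (\<Sum>j<length b. F 0 (Suc j)) + ((\<Sum>i<length b. F (Suc i) 0) + (\<Sum>i<length b. \<Sum>j<length b. F (Suc i) (Suc j)))"
    by (simp add: sum.lessThan_Suc_shift sum.distrib del: sum.lessThan_Suc)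
  also have "F 0 0 = 0" by (simp add: F_def gap_def)
  also have "(\<Sum>j<length b. F 0 (Suc j)) = int x * int (wt b)"
    unfolding W[symmetric] by (rule sum.cong) (simp_all add: F_def gap del: of_nat_Suc)
  also have "(\<Sum>i<length b. F (Suc i) 0) = int x * int (wt b)"
    unfolding W[symmetric] by (rule sum.cong) (simp_all add: F_def gap mult_ac del: of_nat_Suc)
  also have "(\<Sum>i<length b. \<Sum>j<length b. F (Suc i) (Suc j)) = int (en b)"
    unfolding Cons by (simp add: F_def gap del: of_nat_Suc)
  finally show ?case by (simp add: F_def)
qed simp

text \<open>By \<open>sum_by_window\<close>, \<open>inv2 d\<close> is a quadratic form in the shift
  counts with coefficients \<open>gap k l\<close>. Shifts of equal sign give \<open>en\<close>;
  shifts i + 1 and -(j + 1) have gap i + j + 1 and give M^2 and a multiple of \<open>wt\<close>;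
  pairs with a fixed point give the rest.\<close>

lemma alen_invol_reps:
  assumes d: "d \<in> invol_reps" "d \<in> bounded_shift h"
  defines "b \<equiv> blist h d"
  shows "alen d = en b + sum_list b * sum_list b + 2 * (n - sum_list b) * wt b"
proof -
  note dD = drepsD[OF d(1)]
  define M where "M = int (sum_list b)"
  define A0 where "A0 = int (shift_count d 0)"
  have "inv2 d = (\<Sum>i=1..N. \<Sum>j=1..N. gap (win (d i)) (win (d j)))"
    unfolding inv2_def by (intro sum.cong refl) (rule class_inv_invol_reps[OF d(1)])
  also have "\<dots> = (\<Sum>k\<in>{- int h..int h}. int (shift_count d k) * (\<Sum>l\<in>{- int h..int h}. int (shift_count d l) * gap k l))"
    by (simp only: sum_by_window[OF d(2)])
      (rule sum_by_window[OF d(2), of "\<lambda>k. \<Sum>l\<in>{- int h..int h}. int (shift_count d l) * gap k l"])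
  finally have i2: "inv2 d = (\<Sum>k\<in>{- int h..int h}. int (shift_count d k) * (\<Sum>l\<in>{- int h..int h}. int (shift_count d l) * gap k l))" .
  have e: "gap 0 (int j + 1) = int j" "gap 0 (- (int j + 1)) = int j"
      "gap (int j + 1) 0 = int j" "gap (- (int j + 1)) 0 = int j"
      "gap (int i + 1) (int j + 1) = gap (int i) (int j)" "gap (- (int i + 1)) (- (int j + 1)) = gap (int i) (int j)"
      "gap (int i + 1) (- (int j + 1)) = int i + int j + 1" "gap (- (int i + 1)) (int j + 1) = int i + int j + 1"
    for i j by (auto simp: gap_def)
  have bn: "shift_count d (int i + 1) = b ! i" if "i < h" for i using that by (simp add: b_def nth_blist)
  have Ms: "(\<Sum>i<h. int (b ! i)) = M"
    by (simp add: M_def b_def sum_list_sum_nth atLeast0LessThan)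
  have Ws: "(\<Sum>i<h. int (b ! i) * int i) = int (wt b)"
    unfolding wt_sum by (simp add: b_def mult_ac)
  \<comment> \<open>The inner sum for the shift i + 1, and likewise for -(i + 1): fixed points, then
    shifts of equal sign, then shifts of opposite sign.\<close>
  define R where "R i = A0 * int i + ((\<Sum>j<h. int (b ! j) * gap (int i) (int j)) + (int i * M + int (wt b) + M))" for i
  have inner0: "(\<Sum>l\<in>{- int h..int h}. int (shift_count d l) * gap 0 l) = 2 * int (wt b)"
    unfolding sum_symmetric_range shift_count_minus[OF dD(1,2)] e Ws[symmetric] by (simp add: gap_def bn)
  have S: "(\<Sum>j<h. int (b ! j) * (int i + int j + 1)) = int i * M + int (wt b) + M" for i
    unfolding Ms[symmetric] Ws[symmetric] by (simp add: sum_distrib_left sum.distrib algebra_simps)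
  have innerp: "(\<Sum>l\<in>{- int h..int h}. int (shift_count d l) * gap (int i + 1) l) = R i" for i
    unfolding sum_symmetric_range shift_count_minus[OF dD(1,2)] e R_def S[symmetric] A0_def by (simp add: bn)
  have innerm: "(\<Sum>l\<in>{- int h..int h}. int (shift_count d l) * gap (- (int i + 1)) l) = R i" for i
    unfolding sum_symmetric_range shift_count_minus[OF dD(1,2)] e R_def S[symmetric] A0_def by (simp add: bn)
  have "inv2 d = A0 * (2 * int (wt b)) + 2 * (\<Sum>i<h. int (b ! i) * R i)"
    unfolding i2 sum_symmetric_range[of "\<lambda>k. int (shift_count d k) * (\<Sum>l\<in>{- int h..int h}. int (shift_count d l) * gap k l)"]
      inner0 innerp innerm shift_count_minus[OF dD(1,2)] A0_def by (simp add: bn)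
  also have "(\<Sum>i<h. int (b ! i) * R i) = A0 * int (wt b) + int (en b) + (2 * M * int (wt b) + M * M)"
  proof -
    have E: "int (en b) = (\<Sum>i<h. \<Sum>j<h. int (b ! i) * int (b ! j) * gap (int i) (int j))"
      using en_sum[of b] by (simp add: b_def)
    have "(\<Sum>i<h. int (b ! i) * R i) = A0 * (\<Sum>i<h. int (b ! i) * int i) +
        (\<Sum>i<h. \<Sum>j<h. int (b ! i) * int (b ! j) * gap (int i) (int j)) +
        ((\<Sum>i<h. int (b ! i) * int i) * M + (\<Sum>i<h. int (b ! i)) * (int (wt b) + M))"
      unfolding R_def by (simp add: sum_distrib_left sum_distrib_right sum.distrib algebra_simps)
    then show ?thesis unfolding Ws Ms E[symmetric] by (simp add: algebra_simps)
  qed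
  finally have "inv2 d = 2 * (int (en b) + M * M + 2 * (A0 + M) * int (wt b))" by (simp add: algebra_simps)
  moreover have "A0 + M = int (n - sum_list b)"
    using shift_count_total[OF dD(1,2) d(2)] by (simp add: A0_def M_def b_def)
  ultimately have "inv2 d = int (2 * (en b + sum_list b * sum_list b + 2 * (n - sum_list b) * wt b))"
    by (simp add: M_def)
  then have "nat (inv2 d) = 2 * (en b + sum_list b * sum_list b + 2 * (n - sum_list b) * wt b)"
    by (simp only: nat_int)
  then show ?thesis unfolding alen_def by simp
qed

lemma shift_count_outside:
  assumes "d \<in> bounded_shift h" "\<bar>k\<bar> > int h" shows "shift_count d k = 0"
proof -
  have "{i \<in> {1..N}. win (d i) = k} = {}" using window_bounded[OF assms(1)] assms(2) by fastforce
  then show ?thesis unfolding shift_count_def by (simp only: card.empty)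
qed

text \<open>The counts determine the borders of the blocks, hence the period of each image, and
  \<open>invol_reps_unique\<close> applies.\<close>

lemma invol_reps_eqI:
  assumes d: "d \<in> invol_reps" "d' \<in> invol_reps" and counts: "\<And>k. shift_count d k = shift_count d' k" and b: "d \<in> bounded_shift h" "d' \<in> bounded_shift h"
  shows "d = d'"
proof (rule invol_reps_unique[OF d])
  have block_start: "block_start d k = block_start d' k" for k
  proof -
    have off0: "block_start f (- int h) = 0" if "f \<in> bounded_shift h" for f
    proof -
      have "{i \<in> {1..N}. win (f i) < - int h} = {}" using window_bounded[OF that] by fastforce
      then show ?thesis unfolding block_start_def by (simp only: card.empty of_nat_0)
    qed
    show ?thesis
    proof (induction k rule: int_induct[where k = "- int h"])
      case base
      show ?case using off0[OF b(1)] off0[OF b(2)] by simp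
    next
      case (step1 k)
      then show ?case by (simp add: block_start_Suc counts)
    next
      case (step2 k)
      then show ?case using block_start_Suc[of d "k - 1"] block_start_Suc[of d' "k - 1"] counts by simp
    qed
  qed
  fix i
  obtain r k where r: "i = r + N * k" "r \<in> {1..N}" by (rule window_repr)
  have "win (d r) = win (d' r)"
    using block_iff[OF d(1), of r "win (d r)"] block_iff[OF d(2), of r "win (d r)"] r(2) block_start counts by auto
  then show "win (d i) = win (d' i)"
    using drepsD(1)[OF d(1)] drepsD(1)[OF d(2)] by (simp add: r(1) win_aperm_shift)
qed

end

subsection \<open>Evaluation of the series\<close>

text \<open>Supplies a list of shifts, one for each point to be moved up, in
  \<open>exists_involution_with_counts\<close>.\<close>

lemma list_with_counts:
  "\<exists>mu. length mu = sum_list b \<and> set mu \<subseteq> {1..length b} \<and> (\<forall>i<length b. count_list mu (Suc i) = b ! i)"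
proof (induction b rule: rev_induct)
  case (snoc x b)
  then obtain mu where mu: "length mu = sum_list b" "set mu \<subseteq> {1..length b}" "\<forall>i<length b. count_list mu (Suc i) = b ! i"
    by blast
  have z: "count_list mu (Suc (length b)) = 0" using mu(2) by (intro count_notin) auto
  have r: "count_list (replicate x a) c = (if a = c then x else 0)" for a c :: nat
    by (induction x) auto
  show ?case
    using mu z by (intro exI[of _ "mu @ replicate x (Suc (length b))"]) (auto simp: r nth_append less_Suc_eq)
qed simp

text \<open>Convergence of formal power series is coefficientwise, and outside \<open>F m\<close> no
  term contributes to the coefficient of index m.\<close>

lemma fps_infsum_eqI:
  fixes f :: "'b \<Rightarrow> 'a::field fps"
  assumes "\<And>m. finite (F m)" "\<And>m. F m \<subseteq> A" "\<And>m x. x \<in> A \<Longrightarrow> x \<notin> F m \<Longrightarrow> f x $ m = 0"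
    and S: "\<And>m. (\<Sum>x\<in>F m. f x) $ m = S $ m"
  shows "infsum f A = S"
proof (rule infsumI)
  show "(f has_sum S) A"
    unfolding has_sum_def tendsto_fps_iff
  proof
    fix m
    have "sum f Y $ m = S $ m" if Y: "finite Y" "F m \<subseteq> Y" "Y \<subseteq> A" for Y
    proof -
      have "sum f Y $ m = (\<Sum>x\<in>Y. f x $ m)" by (rule fps_sum_nth)
      also have "\<dots> = (\<Sum>x\<in>F m. f x $ m)"
        by (rule sum.mono_neutral_right) (use Y assms(3) in auto)
      also have "\<dots> = S $ m" using S[of m] by (simp add: fps_sum_nth)
      finally show ?thesis .
    qed
    then show "\<forall>\<^sub>F Y in finite_subsets_at_top A. sum f Y $ m = S $ m"
      using assms(1,2) by (auto simp: eventually_finite_subsets_at_top intro!: exI[of _ "F m"])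
  qed
qed

lemma fps_nth_eq_of_dvd:
  assumes "qX ^ h dvd (f - g :: 'a::field fps)" "m < h" shows "f $ m = g $ m"
proof -
  obtain c where "f - g = qX ^ h * c" using assms(1) by (rule dvdE)
  then have "(f - g) $ m = 0" using assms(2) by (simp add: fps_X_power_mult_nth)
  then show ?thesis by simp
qed

lemma fps_nth_qX_power: "m < k \<Longrightarrow> (qX ^ k * f :: 'a::field fps) $ m = 0"
  by (simp add: fps_X_power_mult_nth)

definition Hfin :: "nat \<Rightarrow> nat \<Rightarrow> 'a::field fps \<Rightarrow> 'a fps" where
  "Hfin h n z = (\<Sum>k\<le>n div 2. z ^ k * qX ^ (k * k) * inv_qfact qX (n - 2 * k) * Aser h k (2 * (n - k)))"

lemma Hfin_Hser: assumes "n > 0" shows "qX ^ h dvd (Hfin h n z - Hser n z :: 'a::field fps)"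
proof -
  have "Hfin h n z - Hser n z = (\<Sum>k\<le>n div 2. z ^ k * qX ^ (k * k) * inv_qfact qX (n - 2 * k) *
      (Aser h k (2 * (n - k)) - Bser k (2 * (n - k))))"
    by (simp add: Hfin_def Hser_def sum_subtractf right_diff_distrib)
  also have "qX ^ h dvd \<dots>"
  proof (rule dvd_sum)
    fix k assume "k \<in> {..n div 2}"
    then have "2 * (n - k) > 0" using assms by auto
    then have "(qX ^ h :: 'a fps) dvd Aser h k (2 * (n - k)) - Bser k (2 * (n - k))" by (rule Aser_Bser)
    then show "qX ^ h dvd z ^ k * qX ^ (k * k) * inv_qfact qX (n - 2 * k) * (Aser h k (2 * (n - k)) - Bser k (2 * (n - k)))"
      by (rule dvd_mult)
  qed
  finally show ?thesis .
qed

lemma fps_minus_one_div: "(qX - 1) / (qX + 1) = (- wX :: 'a::field fps)"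
proof -
  have e1: "(qX - 1) / (qX + 1) = (qX - 1) * inverse (qX + 1 :: 'a fps)" by (rule fps_divide_unit) simp
  have e2: "wX = (1 - qX) * inverse (1 + qX :: 'a fps)" unfolding wX_def by (rule fps_divide_unit) simp
  have "(a - b) * c = - ((b - a) * c)" for a b c :: "'a fps" by (simp add: algebra_simps)
  then show ?thesis unfolding e1 unfolding e2 add.commute[of qX 1] .
qed

lemma cox_length_one: "cox_length G {} \<one>\<^bsub>G\<^esub> = 0"
  unfolding cox_length_def by (rule Least_equality) auto

lemma abs_length_trivial:
  assumes "twisted_invols G dia = {\<one>\<^bsub>G\<^esub>}"
  shows "abs_length G {} dia \<one>\<^bsub>G\<^esub> = 0"
proof -
  have "abs_length G {} dia = restrict (\<lambda>_. 0) {\<one>\<^bsub>G\<^esub>}"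
    unfolding abs_length_def assms
    by (rule the_equality) (auto intro!: extensionalityI[of _ "{\<one>\<^bsub>G\<^esub>}"])
  then show ?thesis by simp
qed

lemma L_series_trivial: "twisted_invols G dia = {\<one>\<^bsub>G\<^esub>} \<Longrightarrow> L_series G {} dia (q :: 'a::field fps) = 1"
  by (simp add: L_series_def abs_length_trivial cox_length_one)

text \<open>Without generators and with a trivial group, each series reduces to a single term equal
  to 1.\<close>

lemma T_affine_1: "T_affine 1 s (q :: 'a::field fps) = 1"
proof -
  define G where "G = affine_sym 1"
  have C: "carrier G = {id}" unfolding G_def by (rule carrier_affine_sym_1)
  have m: "monoid.mult G = (\<lambda>v w. v \<circ> w)" "\<one>\<^bsub>G\<^esub> = id" by (simp_all add: G_def affine_sym_def)
  have grp: "group G" by (rule groupI) (auto simp: C m)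
  have inv1: "m_inv G id = id" using group.inv_equality[OF grp, of id id] by (simp add: C m)
  have t1: "twisted_invols G (\<lambda>x. x) = {\<one>\<^bsub>G\<^esub>}" by (auto simp: twisted_invols_def C m inv1)
  have gens: "affine_gens 1 = {}" "finite_gens 1 = {}" by (auto simp: affine_gens_def finite_gens_def)
  have par: "parabolic G {} = G"
    using group.generate_empty[OF grp] by (simp add: parabolic_def m C[symmetric])
  have mc: "min_coset_reps G {} {} = {id}" by (auto simp: min_coset_reps_def C)
  have P: "poincare_series G {} q' = 1" for q' :: "'a fps"
    using cox_length_one[of G] by (simp add: poincare_series_def C m)
  have t2: "twisted_invols G (\<lambda>x. id \<circ> x \<circ> id) = {\<one>\<^bsub>G\<^esub>}" using t1 by simp
  have "LJ_series G {} {} s q = 1"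
    using L_series_trivial[OF t2, of q] abs_length_trivial[OF t1] cox_length_one[of G]
    by (simp add: LJ_series_def t1 mc m par P Let_def)
  then show ?thesis
    unfolding T_affine_def gens G_def[symmetric] using L_series_trivial[OF t1, of q] by simp
qed

context affine
begin

lemma rep_unique: "r \<in> {1..N} \<Longrightarrow> win (r + N * k) = k"
  using win_shift[of r k] win_1N[of r] by simp

text \<open>It is enough to pair the points r and M + r of the window, shifting r up by g r periods
  and M + r down by as many. The result may fail to be minimal; the representative of its double
  coset has the same counts.\<close>

lemma exists_involution_with_counts:
  assumes b: "2 * sum_list b \<le> n"
  shows "\<exists>w. w \<in> aperm \<and> w \<circ> w = id \<and> w \<in> bounded_shift (length b) \<and> blist (length b) w = b"
proof -
  obtain mu where mu: "length mu = sum_list b" "set mu \<subseteq> {1..length b}" "\<forall>i<length b. count_list mu (Suc i) = b ! i"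
    using list_with_counts by blast
  define M where "M = int (sum_list b)"
  have M: "0 \<le> M" "2 * M \<le> N" using b by (auto simp: M_def)
  define g where "g r = int (mu ! nat (r - 1))" for r
  have g: "1 \<le> g r" "g r \<le> int (length b)" if "1 \<le> r" "r \<le> M" for r
  proof -
    have "mu ! nat (r - 1) \<in> set mu" using that by (intro nth_mem) (auto simp: mu(1) M_def)
    then show "1 \<le> g r" "g r \<le> int (length b)" using mu(2) by (auto simp: g_def)
  qed
  define w where "w i = (let r = i - N * win i in
     if r \<le> M then i + M + N * g r else if r \<le> 2 * M then i - M - N * g (r - M) else i)" for i
  have w1: "w (r + N * k) = r + M + N * (k + g r)" if "1 \<le> r" "r \<le> M" for r k
    using that M rep_unique[of r k] by (simp add: w_def Let_def algebra_simps)
  have w2: "w (r + N * k) = r - M + N * (k - g (r - M))" if "M < r" "r \<le> 2 * M" for r k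
    using that M rep_unique[of r k] by (simp add: w_def Let_def algebra_simps)
  have w3: "w (r + N * k) = r + N * k" if "2 * M < r" "r \<le> N" for r k
    using that M rep_unique[of r k] by (simp add: w_def Let_def)
  have cases: "P i" if "\<And>r k. 1 \<le> r \<Longrightarrow> r \<le> M \<Longrightarrow> P (r + N * k)"
    "\<And>r k. M < r \<Longrightarrow> r \<le> 2 * M \<Longrightarrow> P (r + N * k)" "\<And>r k. 2 * M < r \<Longrightarrow> r \<le> N \<Longrightarrow> P (r + N * k)" for P i
  proof -
    obtain r k where rk: "i = r + N * k" "r \<in> {1..N}" by (rule window_repr)
    consider "1 \<le> r" "r \<le> M" | "M < r" "r \<le> 2 * M" | "2 * M < r" "r \<le> N" using rk by force
    then show ?thesis by cases (use that rk in auto)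
  qed
  have shift: "w (i + N) = w i + N" for i
    by (simp add: w_def Let_def win_shift[of i 1, simplified] algebra_simps)
  have inv: "w (w i) = i" for i
  proof (rule cases[of "\<lambda>i. w (w i) = i"])
    show "w (w (r + N * k)) = r + N * k" if "1 \<le> r" "r \<le> M" for r k
      unfolding w1[OF that] using that M by (subst w2) auto
    show "w (w (r + N * k)) = r + N * k" if "M < r" "r \<le> 2 * M" for r k
      unfolding w2[OF that] using that M by (subst w1) auto
    show "w (w (r + N * k)) = r + N * k" if "2 * M < r" "r \<le> N" for r k
      unfolding w3[OF that] ..
  qed
  have wa: "w \<in> aperm" by (rule periodic_involution_aperm[OF shift inv])
  have win1: "win (w (r + N * k)) = k + g r" if "1 \<le> r" "r \<le> M" for r k
    unfolding w1[OF that] using that M by (intro rep_unique) auto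
  have win2: "win (w (r + N * k)) = k - g (r - M)" if "M < r" "r \<le> 2 * M" for r k
    unfolding w2[OF that] using that M by (intro rep_unique) auto
  have win3: "win (w (r + N * k)) = k" if "2 * M < r" "r \<le> N" for r k
    unfolding w3[OF that] using that M by (intro rep_unique) auto
  have bd: "\<bar>win (w i) - win i\<bar> \<le> int (length b)" for i
  proof (rule cases[of "\<lambda>i. \<bar>win (w i) - win i\<bar> \<le> int (length b)"])
    show "\<bar>win (w (r + N * k)) - win (r + N * k)\<bar> \<le> int (length b)" if "1 \<le> r" "r \<le> M" for r k
      unfolding win1[OF that] using that M rep_unique[of r k] g[of r] by simp
    show "\<bar>win (w (r + N * k)) - win (r + N * k)\<bar> \<le> int (length b)" if "M < r" "r \<le> 2 * M" for r k
      unfolding win2[OF that] using that M rep_unique[of r k] g[of "r - M"] by simp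
    show "\<bar>win (w (r + N * k)) - win (r + N * k)\<bar> \<le> int (length b)" if "2 * M < r" "r \<le> N" for r k
      unfolding win3[OF that] using that M rep_unique[of r k] by simp
  qed
  have "shift_count w (int i + 1) = b ! i" if i: "i < length b" for i
  proof -
    have "{r \<in> {1..N}. win (w r) = int i + 1} = {r \<in> {1..M}. g r = int i + 1}"
    proof safe
      fix r assume r: "r \<in> {1..N}" "win (w r) = int i + 1"
      then consider "1 \<le> r" "r \<le> M" | "M < r" "r \<le> 2 * M" | "2 * M < r" "r \<le> N" by force
      then have "r \<le> M \<and> g r = int i + 1"
      proof cases
        case 1
        then show ?thesis using win1[of r 0] r by simp
      next
        case 2
        then show ?thesis using win2[of r 0] r g[of "r - M"] by simp
      next
        case 3
        then show ?thesis using win3[of r 0] r by simp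
      qed
      then show "r \<in> {1..M}" "g r = int i + 1" using r by auto
    next
      fix r assume r: "r \<in> {1..M}" "g r = int i + 1"
      then show "r \<in> {1..N}" "win (w r) = int i + 1" using win1[of r 0] M by auto
    qed
    then have "shift_count w (int i + 1) = card {r \<in> {1..M}. g r = int i + 1}" by (simp only: shift_count_def)
    also have "\<dots> = card {j. j < length mu \<and> mu ! j = Suc i}"
      by (rule bij_betw_same_card[of "\<lambda>r. nat (r - 1)"], rule bij_betwI[where g = "\<lambda>j. int j + 1"])
        (auto simp: g_def M_def mu(1) nat_less_iff)
    also have "\<dots> = length (filter (\<lambda>x. x = Suc i) mu)" by (rule length_filter_conv_card[symmetric])
    also have "(\<lambda>x. x = Suc i) = (=) (Suc i)" by auto
    also have "length (filter ((=) (Suc i)) mu) = count_list mu (Suc i)"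
      by (simp only: count_list_eq_length_filter)
    finally show ?thesis using mu(3) i by simp
  qed
  then have "blist (length b) w = b" by (intro nth_equalityI) (auto simp: nth_blist)
  then show ?thesis using wa inv bd by (intro exI[of _ w]) (auto simp: bounded_shift_def)
qed

lemma shift_count_conj:
  assumes x: "x \<in> parab J" and u: "\<And>i. win (u i) = win (d i)"
  shows "shift_count (x \<circ> u \<circ> finv x) k = shift_count d k"
proof -
  have xa: "x \<in> aperm" using x by (rule parab_aperm)
  have wx: "win (x j) = win j" for j using x by (simp add: parab_J)
  have wfx: "win (finv x j) = win j" for j using wx[of "finv x j"] xa by simp
  have "bij_betw (finv x) {i \<in> {1..N}. win ((x \<circ> u \<circ> finv x) i) = k} {i \<in> {1..N}. win (d i) = k}"
    by (rule bij_betwI[where g = x]) (use xa wx wfx u in \<open>auto simp: win_1N[symmetric] simp del: atLeastAtMost_iff\<close>)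
  then show ?thesis unfolding shift_count_def by (rule bij_betw_same_card)
qed

text \<open>The counts determine d. Conversely, an involution with the wanted counts has a
  representative in its double coset, and passing to it does not change the counts
  (\<open>shift_count_conj\<close>).\<close>

lemma blist_bij: "bij_betw (blist h) (invol_reps \<inter> bounded_shift h) {b. length b = h \<and> 2 * sum_list b \<le> n}"
proof (rule bij_betwI')
  show "blist h d = blist h d' \<longleftrightarrow> d = d'" if d: "d \<in> invol_reps \<inter> bounded_shift h" "d' \<in> invol_reps \<inter> bounded_shift h" for d d'
  proof
    assume eq: "blist h d = blist h d'"
    have pos: "shift_count d (int i + 1) = shift_count d' (int i + 1)" if "i < h" for i
      using arg_cong[OF eq, of "\<lambda>b. b ! i"] that by (simp add: nth_blist)
    have zero: "shift_count d 0 = shift_count d' 0"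
      using shift_count_total[of d h] shift_count_total[of d' h] d eq drepsD by auto
    have "shift_count d k = shift_count d' k" if k: "k \<ge> 0" for k
    proof (cases "k > int h")
      case True
      then show ?thesis using shift_count_outside[of d h k] shift_count_outside[of d' h k] d by simp
    next
      case False
      then show ?thesis using pos[of "nat (k - 1)"] zero k by (cases "k = 0") auto
    qed
    then have nonneg: "shift_count d k = shift_count d' k" if "k \<ge> 0" for k using that by blast
    have minus: "shift_count f (- k) = shift_count f k" if "f \<in> invol_reps" for f k
      by (rule shift_count_minus[OF drepsD(1,2)[OF that]])
    have "shift_count d k = shift_count d' k" for k
    proof (cases "k \<ge> 0")
      case False
      then have "shift_count d (- k) = shift_count d' (- k)" by (intro nonneg) simp
      then show ?thesis using minus d by simp
    qed (rule nonneg)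
    then show "d = d'" using d by (intro invol_reps_eqI[of d d' h]) auto
  qed simp
  show "blist h d \<in> {b. length b = h \<and> 2 * sum_list b \<le> n}" if "d \<in> invol_reps \<inter> bounded_shift h" for d
    using shift_count_total[of d h] that drepsD by auto
  show "\<exists>d\<in>invol_reps \<inter> bounded_shift h. b = blist h d" if b: "b \<in> {b. length b = h \<and> 2 * sum_list b \<le> n}" for b
  proof -
    obtain w where w: "w \<in> aperm" "w \<circ> w = id" "w \<in> bounded_shift h" "blist h w = b"
      using exists_involution_with_counts[of b] b by auto
    then obtain p where p: "p \<in> (SIGMA d:invol_reps \<inter> bounded_shift h. twisted (stab d) d \<times> coset_reps (stab d))"
      "w = (case p of (d, y, x) \<Rightarrow> x \<circ> (y \<circ> d) \<circ> finv x)"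
      using bij_betw_imp_surj_on[OF involution_bij[of h]] by (metis (mono_tags, lifting) imageE mem_Collect_eq)
    obtain d y x where pd: "p = (d, y, x)" by (cases p)
    have m: "d \<in> invol_reps" "d \<in> bounded_shift h" "y \<in> twisted (stab d) d" "x \<in> coset_reps (stab d)" "w = x \<circ> (y \<circ> d) \<circ> finv x"
      using p by (auto simp: pd)
    have "shift_count w k = shift_count d k" for k
      unfolding m(5) by (rule shift_count_conj[OF coset_reps_parab[OF m(4)]]) (simp add: invol_reps_twisted_sorted_invols(2)[OF m(1,3)])
    then have "blist h d = b" using w(4) by (simp add: blist_def)
    then show ?thesis using m by blast
  qed
qed

section \<open>Convergence of the series\<close>

lemma alen_lower_bound:
  assumes w: "w \<in> aperm" and ij: "i \<in> {1..N}" "j \<in> {1..N}" "N * int h \<le> w j - w i"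
  shows "h \<le> alen w"
proof (cases "h = 0")
  case False
  define x where "x = (w j - w i) div N"
  have "N * int h div N \<le> (w j - w i) div N" by (rule zdiv_mono1[OF ij(3)]) simp
  then have x: "int h \<le> x" by (simp add: x_def)
  have "0 < N * int h" using False by simp
  then have ne: "i \<noteq> j" using ij(3) by auto
  have nd: "\<not> N dvd j - i"
    using ne ij zdvd_imp_le[of N "j - i"] zdvd_imp_le[of N "i - j"] dvd_diff_commute[of N i j]
    by (cases "i < j") auto
  then have nd': "\<not> N dvd w j - w i" using aperm_dvd_diff[OF w] by blast
  have y: "(i - j) div N = - ((j - i) div N) - 1" "(w i - w j) div N = - x - 1"
    using div_minus[OF nd] div_minus[OF nd'] by (simp_all add: x_def)
  \<comment> \<open>For i, j in the window this quotient is 0 or -1, so subtracting it cannot push x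
    below h.\<close>
  have "(j - i) div N \<le> 0" using ij by (cases "i < j") (auto simp: div_pos_pos_trivial div_nonpos_pos_le0)
  then have "int h \<le> class_inv w i j" "int h \<le> class_inv w j i"
    unfolding class_inv_def y x_def[symmetric] using x by auto
  moreover have "class_inv w i j + class_inv w j i \<le> inv2 w"
  proof -
    have "(\<Sum>p\<in>{(i, j), (j, i)}. class_inv w (fst p) (snd p)) \<le> (\<Sum>p\<in>{1..N} \<times> {1..N}. class_inv w (fst p) (snd p))"
      by (rule sum_mono2) (use ij in \<open>auto simp: class_inv_def\<close>)
    then show ?thesis using ne by (simp add: inv2_def sum.cartesian_product case_prod_unfold)
  qed
  ultimately show ?thesis by (simp add: alen_def)
qed simp

text \<open>If a point of the window moves up by more than h periods, some other one does not move
  up, since the displacements sum to zero. The two images are at least N h apart, which forces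
  length h. Downward moves are symmetric.\<close>

lemma alen_unbounded:
  assumes w: "w \<in> aperm" "w \<notin> bounded_shift h" shows "h \<le> alen w"
proof -
  have s0: "(\<Sum>i=1..N. w i - i) = 0" using w by (simp add: aperm_def)
  have ne: "{1..N} \<noteq> {}" using n_ge_2 by auto
  obtain i where i: "\<bar>win (w i) - win i\<bar> > int h" using w by (auto simp: bounded_shift_def not_le)
  obtain r k where r: "i = r + N * k" "r \<in> {1..N}" "k = win i" by (rule window_repr)
  have "win (w i) = win (w r) + k" unfolding r(1) by (rule win_aperm_shift[OF w(1)])
  then have "win (w r) > int h \<or> win (w r) < - int h" using i r(3) by linarith
  then show ?thesis
  proof
    assume h: "win (w r) > int h"
    have "\<exists>j\<in>{1..N}. w j \<le> j"
    proof (rule ccontr)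
      assume "\<not> (\<exists>j\<in>{1..N}. w j \<le> j)"
      then have "0 < w i - i" if "i \<in> {1..N}" for i using that by force
      then have "0 < (\<Sum>i=1..N. w i - i)" by (intro sum_pos[OF _ ne]) simp_all
      with s0 show False by simp
    qed
    then obtain j where j: "j \<in> {1..N}" "w j \<le> j" by blast
    have "\<not> w r \<le> N * (int h + 1)" using h win_le[of "w r" "int h"] by simp
    then have "N * int h \<le> w r - w j" using j by (simp add: distrib_left)
    then show ?thesis using alen_lower_bound[OF w(1) j(1) r(2)] by simp
  next
    assume h: "win (w r) < - int h"
    have "\<exists>j\<in>{1..N}. j \<le> w j"
    proof (rule ccontr)
      assume "\<not> (\<exists>j\<in>{1..N}. j \<le> w j)"
      then have "0 < - (w i - i)" if "i \<in> {1..N}" for i using that by force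
      then have "0 < (\<Sum>i=1..N. - (w i - i))" by (intro sum_pos[OF _ ne]) simp_all
      with s0 show False by (simp only: sum_negf)
    qed
    then obtain j where j: "j \<in> {1..N}" "j \<le> w j" by blast
    have "w r \<le> N * (- int h - 1 + 1)" using h win_le[of "w r" "- int h - 1"] by simp
    then have "N * int h \<le> w j - w r" using j by simp
    then show ?thesis using alen_lower_bound[OF w(1) r(2) j(1)] by simp
  qed
qed

lemma finite_invol_reps_bounded: "finite (invol_reps \<inter> bounded_shift h)"
  by (rule finite_subset[OF _ finite_bounded_shift[of h]]) (auto simp: invol_reps_def)

lemma length_gf_nth_0:
  assumes "periodic K" "K \<subseteq> J" "q $ 0 = 0" shows "length_gf K q $ 0 = (1 :: 'a::field)"
proof -
  have "(\<Prod>i\<in>A. qn q (run_length K i + 1)) $ 0 = 1" if "finite A" for A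
    using that by (induction A) (simp_all add: fps_nth_0_qn[OF assms(3)])
  then show ?thesis unfolding length_gf_Pprod[OF assms(1,2)] Pprod_def by simp
qed

lemma Cprod_nth_0:
  assumes "d \<in> invol_reps" "d \<in> bounded_shift h" "q $ 0 = 0" shows "Cprod (stab d) d q $ 0 = (1 :: 'a::field)"
proof -
  have "(\<Prod>i<m. qfact (q\<^sup>2) (shift_count d (int i + 1))) $ 0 = 1" for m
    by (induction m) (simp_all add: fps_nth_0_qfact assms(3))
  then show ?thesis unfolding Cprod_invol_reps[OF assms(1,2)] by (simp add: fps_nth_0_qfact assms(3))
qed

lemma inverse_Cprod:
  assumes d: "d \<in> invol_reps" "d \<in> bounded_shift h"
  shows "inverse (Cprod (stab d) d qX) =
    inv_qfact qX (n - 2 * sum_list (blist h d)) * (inverse (\<Prod>x\<leftarrow>blist h d. qfact (qX\<^sup>2) x) :: 'a::field fps)"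
proof -
  have "shift_count d 0 = n - 2 * sum_list (blist h d)" using shift_count_total[of d h] d drepsD by auto
  moreover have "(\<Prod>i<h. qfact (qX\<^sup>2) (shift_count d (int i + 1))) = (\<Prod>x\<leftarrow>blist h d. qfact (qX\<^sup>2 :: 'a fps) x)"
    by (simp add: blist_def comp_def prod.list_conv_set_nth atLeast0LessThan)
  ultimately show ?thesis unfolding Cprod_invol_reps[OF d] by (simp add: fps_inverse_mult inv_qfact_def)
qed

text \<open>Grouping the lists b by k = \<open>sum_list b\<close>, which is \<open>cyc d\<close>,
  makes the inner sums \<open>Aser\<close>.\<close>

lemma invol_reps_sum_Hfin:
  "(\<Sum>d\<in>invol_reps \<inter> bounded_shift h. qX ^ alen d * z ^ cyc d * inverse (Cprod (stab d) d qX)) = (Hfin h n z :: 'a::field fps)"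
proof -
  define G :: "nat list \<Rightarrow> 'a fps" where "G b = qX ^ (en b + sum_list b * sum_list b + 2 * (n - sum_list b) * wt b) *
     z ^ sum_list b * (inv_qfact qX (n - 2 * sum_list b) * inverse (\<Prod>x\<leftarrow>b. qfact (qX\<^sup>2) x))" for b
  have "(\<Sum>d\<in>invol_reps \<inter> bounded_shift h. qX ^ alen d * z ^ cyc d * inverse (Cprod (stab d) d qX)) =
      (\<Sum>d\<in>invol_reps \<inter> bounded_shift h. G (blist h d))"
    by (rule sum.cong[OF refl]) (simp add: G_def alen_invol_reps[of _ h] cyc_invol_reps[of _ h] inverse_Cprod[of _ h])
  also have "\<dots> = (\<Sum>b | length b = h \<and> 2 * sum_list b \<le> n. G b)"
    by (rule sum.reindex_bij_betw[OF blist_bij])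
  also have "{b. length b = h \<and> 2 * sum_list b \<le> n} = (\<Union>k\<le>n div 2. clists h k)"
    by (auto simp: clists_def)
  also have "sum G \<dots> = (\<Sum>k\<le>n div 2. \<Sum>b\<in>clists h k. G b)"
    by (rule sum.UNION_disjoint) (auto simp: finite_clists, auto simp: clists_def)
  also have "\<dots> = Hfin h n z"
    unfolding Hfin_def Aser_def sum_distrib_left
  proof (intro sum.cong refl)
    fix k b assume "b \<in> clists h k"
    then have k: "sum_list b = k" by (simp add: clists_def)
    have e: "qX ^ (en b + k * k + 2 * (n - k) * wt b) = qX ^ (k * k) * (qX ^ (en b + 2 * (n - k) * wt b) :: 'a fps)"
      by (simp flip: power_add add: algebra_simps)
    show "G b = z ^ k * qX ^ (k * k) * inv_qfact qX (n - 2 * k) *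
        (qX ^ (en b + 2 * (n - k) * wt b) * inverse (\<Prod>x\<leftarrow>b. qfact (qX\<^sup>2) x))"
      unfolding G_def k e by (simp only: mult_ac)
  qed
  finally show ?thesis .
qed

lemma twisted_gf_quotient:
  fixes z :: "'a::field fps"
  assumes d: "d \<in> invol_reps" "d \<in> bounded_shift h" and z: "z * (1 + qX) = qX - 1"
  shows "twisted_gf (stab d) d qX z = length_gf (stab d) (qX\<^sup>2) * inverse (Cprod (stab d) d qX)"
proof -
  note a = adm_stab[OF d(1)]
  have "1 + qX \<noteq> (0 :: 'a fps)" by (rule fps_nz) simp
  then have e: "twisted_gf (stab d) d qX z * Cprod (stab d) d qX = length_gf (stab d) (qX\<^sup>2)"
    using twisted_gf_Cprod[OF z _ a stab_J] length_gf_Pprod[OF adm_simps(1)[OF a] stab_J, of "qX\<^sup>2 :: 'a fps"] by simp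
  have u: "Cprod (stab d) d qX * inverse (Cprod (stab d) d qX) = (1 :: 'a fps)"
    by (rule fps_mult_inverse) (simp add: Cprod_nth_0[OF d])
  have "twisted_gf (stab d) d qX z = twisted_gf (stab d) d qX z * (Cprod (stab d) d qX * inverse (Cprod (stab d) d qX))"
    by (simp add: u)
  then show ?thesis unfolding e[symmetric] by (simp only: mult.assoc)
qed

text \<open>P_J(q^2), the common factor of both series, which cancels in the quotient.\<close>

definition PJ :: "'a::field fps" where "PJ = length_gf J (qX\<^sup>2)"

lemma PJ_nz: "PJ \<noteq> (0 :: 'a::field fps)"
  unfolding PJ_def by (rule fps_nz) (simp add: length_gf_nth_0[OF periodic_J])

lemma wX_neg: "- wX * (1 + qX) = (qX - 1 :: 'a::field fps)"
  using wX_mult[where 'a = 'a] by (simp add: algebra_simps)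

text \<open>The coset representatives contribute P_J / P_K at q^2, and P_K is the numerator in
  \<open>twisted_gf_quotient\<close>, so each d is left with P_J over \<open>Cprod\<close>.\<close>

lemma involution_sum_Hfin:
  "(\<Sum>w | w \<in> aperm \<and> w \<circ> w = id \<and> w \<in> bounded_shift h. qX ^ alen w * (- wX) ^ cyc w) =
    PJ * (Hfin h n (- wX) :: 'a::field fps)"
proof -
  have "(\<Sum>w | w \<in> aperm \<and> w \<circ> w = id \<and> w \<in> bounded_shift h. qX ^ alen w * (- wX) ^ cyc w) =
      (\<Sum>d\<in>invol_reps \<inter> bounded_shift h. PJ * (qX ^ alen d * (- wX) ^ cyc d * inverse (Cprod (stab d) d qX)) :: 'a fps)"
    unfolding involution_sum
  proof (rule sum.cong[OF refl])
    fix d assume "d \<in> invol_reps \<inter> bounded_shift h"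
    then have d: "d \<in> invol_reps" "d \<in> bounded_shift h" by auto
    have X: "(\<Sum>x\<in>coset_reps (stab d). (qX\<^sup>2) ^ alen x) * length_gf (stab d) (qX\<^sup>2) = (PJ :: 'a fps)"
      unfolding PJ_def by (rule length_gf_coset[OF adm_simps(1)[OF adm_stab[OF d(1)]] stab_J, symmetric])
    show "qX ^ alen d * (- wX) ^ cyc d * twisted_gf (stab d) d qX (- wX) * (\<Sum>x\<in>coset_reps (stab d). (qX\<^sup>2) ^ alen x) =
        PJ * (qX ^ alen d * (- wX) ^ cyc d * inverse (Cprod (stab d) d qX) :: 'a fps)"
      unfolding twisted_gf_quotient[OF d wX_neg] X[symmetric] by (simp only: mult_ac)
  qed
  then show ?thesis by (simp only: sum_distrib_left[symmetric] invol_reps_sum_Hfin)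
qed

section \<open>The series of the definitions\<close>

lemma adm_UNIV: "adm UNIV id"
  by (simp add: adm_def periodic_UNIV)

lemma twisted_UNIV: "twisted UNIV id = {w \<in> aperm. w \<circ> w = id}"
  by (simp add: twisted_def parab_UNIV)

lemma affine_lengths:
  assumes "w \<in> aperm" shows "cox_length (affine_sym n) (affine_gens n) w = alen w"
    "w \<circ> w = id \<Longrightarrow> abs_length (affine_sym n) (affine_gens n) (\<lambda>x. x) w = cyc w"
proof -
  show "cox_length (affine_sym n) (affine_gens n) w = alen w"
    using cox_length_WG[of w UNIV] assms unfolding WG_UNIV affine_gens_eq by (simp add: parab_UNIV periodic_UNIV)
  show "abs_length (affine_sym n) (affine_gens n) (\<lambda>x. x) w = cyc w" if "w \<circ> w = id"
    using abs_length_WG[OF adm_UNIV, of w] that assms unfolding WG_UNIV affine_gens_eq twisted_UNIV by simp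
qed

lemma twisted_invols_affine: "twisted_invols (affine_sym n) (\<lambda>x. x) = {w \<in> aperm. w \<circ> w = id}"
  using twisted_invols_WG[OF adm_UNIV] unfolding WG_UNIV twisted_UNIV by simp

lemma L_series_affine: "L_series (affine_sym n) (affine_gens n) (\<lambda>x. x) qX = (PJ * Hser n (- wX) :: 'a::field fps)"
proof -
  have "L_series (affine_sym n) (affine_gens n) (\<lambda>x. x) qX =
      (\<Sum>\<^sub>\<infinity>w\<in>{w \<in> aperm. w \<circ> w = id}. qX ^ alen w * (- wX) ^ cyc w :: 'a fps)"
    unfolding L_series_def twisted_invols_affine fps_minus_one_div
    by (rule infsum_cong) (simp add: affine_lengths)
  also have "\<dots> = PJ * Hser n (- wX)"
  \<comment> \<open>Elements outside the truncation m + 1 have length above m, and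
    \<open>Hfin (m + 1)\<close> agrees with \<open>Hser\<close> below q^(m+1), so the coefficient of
    index m is already correct.\<close>
  proof (rule fps_infsum_eqI[where F = "\<lambda>m. {w. w \<in> aperm \<and> w \<circ> w = id \<and> w \<in> bounded_shift (m + 1)}"])
    fix m
    show "finite {w. w \<in> aperm \<and> w \<circ> w = id \<and> w \<in> bounded_shift (m + 1)}"
      by (rule finite_subset[OF _ finite_bounded_shift[of "m + 1"]]) auto
    show "(qX ^ alen x * (- wX) ^ cyc x :: 'a fps) $ m = 0"
      if "x \<in> {w \<in> aperm. w \<circ> w = id}" "x \<notin> {w. w \<in> aperm \<and> w \<circ> w = id \<and> w \<in> bounded_shift (m + 1)}" for x
      using alen_unbounded[of x "m + 1"] that by (intro fps_nth_qX_power) auto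
    have "qX ^ (m + 1) dvd PJ * Hfin (m + 1) n (- wX) - PJ * (Hser n (- wX) :: 'a fps)"
      unfolding right_diff_distrib[symmetric] by (intro dvd_mult Hfin_Hser) simp
    then show "(\<Sum>w | w \<in> aperm \<and> w \<circ> w = id \<and> w \<in> bounded_shift (m + 1). qX ^ alen w * (- wX) ^ cyc w) $ m =
        (PJ * Hser n (- wX) :: 'a fps) $ m"
      unfolding involution_sum_Hfin by (rule fps_nth_eq_of_dvd) simp
  qed auto
  finally show ?thesis .
qed

lemma poincare_series_WG:
  fixes q :: "'a::field fps"
  assumes "periodic K" "K \<subseteq> J" shows "poincare_series (WG K) (refl ` K) q = length_gf K q"
  using finite_parab[OF assms(2)] unfolding poincare_series_def length_gf_def
  by (simp add: infsum_finite cox_length_WG assms(1))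

lemma L_series_WG:
  assumes "adm K d" "K \<subseteq> J"
  shows "L_series (WG K) (refl ` K) (\<lambda>x. d \<circ> x \<circ> d) qX = (twisted_gf K d qX (- wX) :: 'a::field fps)"
  using finite_twisted[OF assms(2)] unfolding L_series_def twisted_gf_def twisted_invols_WG[OF assms(1)] fps_minus_one_div
  by (simp add: infsum_finite cox_length_WG twisted_parab[OF assms(1)] abs_length_WG[OF assms(1)] adm_simps(1)[OF assms(1)])

text \<open>P_J / P_K times the twisted series is P_J over \<open>Cprod\<close>, so the summands are
  those of \<open>involution_sum_Hfin\<close> with \<open>s * wX\<close> in place of
  \<open>- wX\<close>.\<close>

lemma LJ_series_affine:
  "LJ_series (affine_sym n) (affine_gens n) (finite_gens n) s qX = (PJ * Hser n (s * wX) :: 'a::field fps)"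
proof -
  have summand: "(let dia = \<lambda>x. d \<otimes>\<^bsub>affine_sym n\<^esub> x \<otimes>\<^bsub>affine_sym n\<^esub> d; K = finite_gens n \<inter> dia ` finite_gens n
      in qX ^ cox_length (affine_sym n) (affine_gens n) d *
         (s * ((1 - qX) / (1 + qX))) ^ abs_length (affine_sym n) (affine_gens n) (\<lambda>x. x) d *
         (poincare_series (parabolic (affine_sym n) (finite_gens n)) (finite_gens n) (qX\<^sup>2) /
          poincare_series (parabolic (affine_sym n) K) K (qX\<^sup>2)) *
         L_series (parabolic (affine_sym n) K) K dia qX) =
      (PJ * (qX ^ alen d * (s * wX) ^ cyc d * inverse (Cprod (stab d) d qX)) :: 'a fps)" if d: "d \<in> invol_reps" for d
  proof -
    note dD = drepsD[OF d] and a = adm_stab[OF d]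
    note per = adm_simps(1)[OF a]
    \<comment> \<open>Each single d lies in some truncation, because its length bounds its
      displacement.\<close>
    obtain h where h: "d \<in> bounded_shift h"
      using alen_unbounded[OF dD(1), of "alen d + 1"] by fastforce
    have P0: "length_gf (stab d) (qX\<^sup>2) $ 0 = (1 :: 'a)" by (rule length_gf_nth_0[OF per stab_J]) simp
    then have "PJ / length_gf (stab d) (qX\<^sup>2) = PJ * inverse (length_gf (stab d) (qX\<^sup>2) :: 'a fps)"
      by (intro fps_divide_unit) simp
    moreover have "length_gf (stab d) (qX\<^sup>2) * inverse (length_gf (stab d) (qX\<^sup>2)) = (1 :: 'a fps)"
      by (rule fps_mult_inverse) (simp add: P0)
    ultimately have PL: "PJ / length_gf (stab d) (qX\<^sup>2) * twisted_gf (stab d) d qX (- wX) = (PJ * inverse (Cprod (stab d) d qX) :: 'a fps)"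
      unfolding twisted_gf_quotient[OF d h wX_neg] by (simp only: mult_ac) (simp only: mult.assoc[symmetric] mult_1_left)
    have K: "finite_gens n \<inter> (\<lambda>x. d \<circ> x \<circ> d) ` finite_gens n = refl ` stab d"
      unfolding finite_gens_eq by (rule stab_generators[OF d])
    show ?thesis
      unfolding Let_def affine_mult K unfolding finite_gens_eq parabolic_parab[OF per] parabolic_parab[OF periodic_J]
        poincare_series_WG[OF per stab_J] poincare_series_WG[OF periodic_J order_refl] L_series_WG[OF a stab_J]
        affine_lengths(1)[OF dD(1)] affine_lengths(2)[OF dD(1,2)] wX_def[symmetric] PJ_def[symmetric]
        mult.assoc PL by (simp only: mult_ac)
  qed
  have "LJ_series (affine_sym n) (affine_gens n) (finite_gens n) s qX =
      (\<Sum>\<^sub>\<infinity>d\<in>invol_reps. PJ * (qX ^ alen d * (s * wX) ^ cyc d * inverse (Cprod (stab d) d qX)) :: 'a fps)"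
    unfolding LJ_series_def involutions_min_coset_reps by (rule infsum_cong) (rule summand)
  also have "\<dots> = PJ * Hser n (s * wX)"
  proof (rule fps_infsum_eqI[where F = "\<lambda>m. invol_reps \<inter> bounded_shift (m + 1)"])
    fix m
    show "finite (invol_reps \<inter> bounded_shift (m + 1))" by (rule finite_invol_reps_bounded)
    show "(PJ * (qX ^ alen x * (s * wX) ^ cyc x * inverse (Cprod (stab x) x qX)) :: 'a fps) $ m = 0"
      if "x \<in> invol_reps" "x \<notin> invol_reps \<inter> bounded_shift (m + 1)" for x
    proof -
      have "m < alen x" using alen_unbounded[of x "m + 1"] that drepsD(1)[of x] by auto
      then have "(qX ^ alen x * (PJ * ((s * wX) ^ cyc x * inverse (Cprod (stab x) x qX))) :: 'a fps) $ m = 0"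
        by (rule fps_nth_qX_power)
      then show ?thesis by (simp only: mult_ac)
    qed
    have "qX ^ (m + 1) dvd PJ * Hfin (m + 1) n (s * wX) - PJ * (Hser n (s * wX) :: 'a fps)"
      unfolding right_diff_distrib[symmetric] by (intro dvd_mult Hfin_Hser) simp
    then show "(\<Sum>d\<in>invol_reps \<inter> bounded_shift (m + 1). PJ * (qX ^ alen d * (s * wX) ^ cyc d * inverse (Cprod (stab d) d qX))) $ m =
        (PJ * Hser n (s * wX) :: 'a fps) $ m"
      unfolding sum_distrib_left[symmetric] invol_reps_sum_Hfin by (rule fps_nth_eq_of_dvd) simp
  qed auto
  finally show ?thesis .
qed

lemma T_affine_eq: "T_affine n s qX = (qcheb_T n 1 s qX :: 'a::field fps)"
proof -
  have nz: "PJ * Hser n (- wX) \<noteq> (0 :: 'a fps)" by (simp add: PJ_nz Hser_qcheb(2))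
  have "T_affine n s qX = (qcheb_T n 1 s qX * (PJ * Hser n (- wX))) / (PJ * Hser n (- wX) :: 'a fps)"
    unfolding T_affine_def L_series_affine LJ_series_affine Hser_qcheb(1)[OF n_simps(2)] by (simp only: mult_ac)
  also have "\<dots> = qcheb_T n 1 s qX" using nz by (rule nonzero_mult_div_cancel_right)
  finally show ?thesis .
qed

end

theorem theorem1p14:
  fixes n :: nat
  assumes "n > 0"
  shows "T_affine n s_var q_var = qcheb_T n 1 s_var q_var"
proof (cases "n = 1")
  case True
  then show ?thesis using T_affine_1[of s_var q_var] by simp
next
  case False
  with assms interpret affine n by unfold_locales simp
  show ?thesis unfolding q_var_def by (rule T_affine_eq)
qed

end
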